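(* Let $R=(r,H,N)$ be a state in the grand-potential resource theory defined by $(\beta,\mu)$, with associated equilibrium state $G_R=(g_R,H,N)$. Then for every $\epsilon\in(0,1)$ $$\lim_{n\to\infty}\frac1n W^\epsilon_{\rm gain}(R^{\otimes n})=\lim_{n\to\infty}\frac1n W^\epsilon_{\rm cost}(R^{\otimes n})=\frac1\beta D(r\|g_R)=\Phi_{\beta,\mu}(R)-\Phi_{\beta,\mu}(G_R).$$
   Context: Fix $\beta>0$ and $\mu\in\mathbb R$. A state is $R=(\rho,H,N)$: a density operator, Hamiltonian and number operator on a finite-dimensional Hilbert space, pairwise commuting; equivalently $R=(r,H,N)$ with $r$ the vector of eigenvalues of $\rho$ in a common eigenbasis of $H,N$. Composition: $R+S=(\rho\otimes\sigma,\,H_R\otimes\mathbb 1+\mathbb 1\otimes H_S,\,N_R\otimes\mathbb 1+\mathbb 1\otimes N_S)$; $R^{\otimes n}=(r^{\otimes n},\sum_{i=1}^nH_i,\sum_{i=1}^nN_i)$ is the composition of $n$ copies of $R$. Free states are $(\gamma,H,N)$ with $\gamma=e^{-\beta(H-\mu N)}/Z$; $G_R=(g_R,H,N)$ is the free state with the same $H,N$ as $R$, and $g_R$ is its vector of eigenvalues. Equilibrating operation on $R=(\rho,H_R,N_R)$: draw any free state $G=(\gamma,H_G,N_G)$; apply to $R+G$ a unitary $U$ commuting with $H_R+H_G$ and $N_R+N_G$; trace out any subsystem with its own Hamiltonian and number operator. Existence of such an operation from $X$ to $Y$ is written $X\xmapsto{\beta,\mu}Y$; it is characterized by equimajorization: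 $X=(x,\cdot,\cdot)$ can be mapped to $Y=(y,\cdot,\cdot)$ iff there is a column-stochastic matrix $M$ with $Mx=y$, $Mg_X=g_Y$. Write $X\xmapsto{\beta,\mu}_\epsilon Y$, for $Y=(\sigma,H,N)$, if $X\xmapsto{\beta,\mu}Y'$ for some $Y'=(\sigma',H,N)$ with $\tfrac12\|\sigma'-\sigma\|_1\le\epsilon$. Battery: a battery is any system whose energies, in the range accessed by the agent, are finely spaced (so the energies $E$, $E+W$ used below are available levels), and which occupies an energy eigenstate. $B_E=(|E\rangle\langle E|,H_B,N_B)$ denotes the battery in the eigenstate of energy $E$. The equilibrium state of the battery assigns weight $e^{-\beta E}/Z$ to the level $|E\rangle$. It is assumed that $\beta E\gg1$. Work quantities: $W^\epsilon_{\rm gain}(R)=\max\{W: R+B_E\xmapsto{\beta,\mu}_\epsilon B_{E+W},\ \beta E\gg1\}$, $W^\epsilon_{\rm cost}(R)=\min\{W: B_{E+W}\xmapsto{\beta,\mu}_\epsilon R+B_E,\ \beta E\gg1\}$. Relative entropy: $D(r\|s)=\sum_i r_i\ln(r_i/s_i)$ with $0\ln0=0$. Grand potential: with $E_i,n_i$ the eigenvalues of $H,N$ on the $i$th common eigenvector, $\Phi_{\beta,\mu}(R)=\sum_i r_iE_i-\frac1\beta S(r)-\mu\sum_i r_in_i$, where $S(r)=-\sum_i r_i\ln r_i$. *)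

theory Defs
  imports
    "HOL-Library.Extended_Real"
    "Jordan_Normal_Form.Schur_Decomposition"
begin

section \<open>Systems and states\<close>

text \<open>
  A finite-dimensional Hilbert space with commuting Hamiltonian \<open>H\<close> and number operator \<open>N\<close>
  is coordinatised by a common orthonormal eigenbasis, indexed by \<open>0, ..., d - 1\<close>; \<open>energy i\<close> and
  \<open>number i\<close> are the eigenvalues of \<open>H\<close> and \<open>N\<close> on the \<open>i\<close>-th basis vector. For a state the basis
  also diagonalises the density operator, whose eigenvalues are \<open>weight i\<close>: this is the
  description \<open>(r, H, N)\<close> of \<open>(\<rho>, H, N)\<close>. Values at indices \<open>\<ge> d\<close> are irrelevant.
\<close>

record system =
  hdim :: nat
  energy :: "nat \<Rightarrow> real"
  number :: "nat \<Rightarrow> real"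

record state =
  sys :: system
  weight :: "nat \<Rightarrow> real"

definition is_state :: "state \<Rightarrow> bool" where
  "is_state R \<longleftrightarrow> hdim (sys R) > 0
     \<and> (\<forall>i < hdim (sys R). 0 \<le> weight R i)
     \<and> (\<Sum>i < hdim (sys R). weight R i) = 1"

definition hamiltonian :: "system \<Rightarrow> complex mat" where
  "hamiltonian S = mat_diag (hdim S) (\<lambda>i. complex_of_real (energy S i))"

definition number_op :: "system \<Rightarrow> complex mat" where
  "number_op S = mat_diag (hdim S) (\<lambda>i. complex_of_real (number S i))"

definition density :: "state \<Rightarrow> complex mat" where
  "density R = mat_diag (hdim (sys R)) (\<lambda>i. complex_of_real (weight R i))"

text \<open>
  Composition. The product basis vector \<open>|i> \<otimes> |j>\<close> has index \<open>i * d\<^sub>T + j\<close>, so that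
  \<open>H\<^sub>S \<otimes> 1 + 1 \<otimes> H\<^sub>T\<close> has the eigenvalue \<open>energy S i + energy T j\<close> on it.
\<close>

definition sys_comp :: "system \<Rightarrow> system \<Rightarrow> system"  (infixl \<open>\<oplus>\<^sub>s\<close> 65) where
  "S \<oplus>\<^sub>s T = \<lparr> hdim = hdim S * hdim T,
     energy = (\<lambda>k. energy S (k div hdim T) + energy T (k mod hdim T)),
     number = (\<lambda>k. number S (k div hdim T) + number T (k mod hdim T)) \<rparr>"

definition state_comp :: "state \<Rightarrow> state \<Rightarrow> state"  (infixl \<open>\<boxplus>\<close> 65) where
  "R \<boxplus> S = \<lparr> sys = sys R \<oplus>\<^sub>s sys S,
     weight = (\<lambda>k. weight R (k div hdim (sys S)) * weight S (k mod hdim (sys S))) \<rparr>"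

definition trivial_state :: state where
  "trivial_state = \<lparr> sys = \<lparr> hdim = 1, energy = (\<lambda>_. 0), number = (\<lambda>_. 0) \<rparr>, weight = (\<lambda>_. 1) \<rparr>"

primrec copies :: "nat \<Rightarrow> state \<Rightarrow> state" where
  "copies 0 R = trivial_state"
| "copies (Suc n) R = copies n R \<boxplus> R"

section \<open>Equilibrium states and free states\<close>

definition gibbs :: "real \<Rightarrow> real \<Rightarrow> system \<Rightarrow> nat \<Rightarrow> real" where
  "gibbs \<beta> \<mu> S i = exp (- \<beta> * (energy S i - \<mu> * number S i))
     / (\<Sum>k < hdim S. exp (- \<beta> * (energy S k - \<mu> * number S k)))"

definition equilibrium :: "real \<Rightarrow> real \<Rightarrow> system \<Rightarrow> state" where
  "equilibrium \<beta> \<mu> S = \<lparr> sys = S, weight = gibbs \<beta> \<mu> S \<rparr>"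

section \<open>Equilibrating operations\<close>

definition is_unitary :: "nat \<Rightarrow> complex mat \<Rightarrow> bool" where
  "is_unitary d U \<longleftrightarrow> U \<in> carrier_mat d d \<and> U * mat_adjoint U = 1\<^sub>m d \<and> mat_adjoint U * U = 1\<^sub>m d"

text \<open>The partial trace over the second factor of a tensor product of dimensions \<open>d\<^sub>S\<close> and \<open>d\<^sub>T\<close>.\<close>

definition partial_trace :: "nat \<Rightarrow> nat \<Rightarrow> complex mat \<Rightarrow> complex mat" where
  "partial_trace d\<^sub>S d\<^sub>T A = mat d\<^sub>S d\<^sub>S (\<lambda>(i, j). \<Sum>k < d\<^sub>T. A $$ (i * d\<^sub>T + k, j * d\<^sub>T + k))"

text \<open>
  \<open>equilibrates \<beta> \<mu> X S \<sigma>\<close>: some equilibrating operation turns \<open>X\<close> into \<open>(\<sigma>, H\<^sub>S, N\<^sub>S)\<close>.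
  The free state is \<open>equilibrium \<beta> \<mu> G\<close>, and \<open>U\<close> is the unitary commuting with the total
  Hamiltonian and number operator. The unitary \<open>J\<close> identifies the total Hilbert space with the
  tensor product of the kept subsystem \<open>S\<close> and the discarded one \<open>T\<close>; as each of them has its own
  Hamiltonian and number operator, it takes the total operators to \<open>H\<^sub>S \<otimes> 1 + 1 \<otimes> H\<^sub>T\<close> and
  \<open>N\<^sub>S \<otimes> 1 + 1 \<otimes> N\<^sub>T\<close>. These conditions force \<open>\<sigma>\<close> to be a density operator commuting
  with \<open>H\<^sub>S\<close> and \<open>N\<^sub>S\<close>, but not to be diagonal in the chosen basis of \<open>S\<close>.
\<close>

definition equilibrates :: "real \<Rightarrow> real \<Rightarrow> state \<Rightarrow> system \<Rightarrow> complex mat \<Rightarrow> bool" where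
  "equilibrates \<beta> \<mu> X S \<sigma> \<longleftrightarrow>
     (\<exists>G T U J.
        let A = X \<boxplus> equilibrium \<beta> \<mu> G;
            H = hamiltonian (sys A); N = number_op (sys A); d = hdim (sys A)
        in hdim G > 0 \<and> hdim S * hdim T = d
         \<and> is_unitary d U \<and> U * H = H * U \<and> U * N = N * U
         \<and> is_unitary d J
         \<and> J * H * mat_adjoint J = hamiltonian (S \<oplus>\<^sub>s T)
         \<and> J * N * mat_adjoint J = number_op (S \<oplus>\<^sub>s T)
         \<and> \<sigma> = partial_trace (hdim S) (hdim T)
                  (J * (U * density A * mat_adjoint U) * mat_adjoint J))"

text \<open>The trace norm: the sum of the singular values, counted with multiplicity.\<close>

definition trace_norm :: "complex mat \<Rightarrow> real" where
  "trace_norm A = (\<Sum>x \<in># proots (char_poly (mat_adjoint A * A)). sqrt (Re x))"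

definition equilibrates_approx :: "real \<Rightarrow> real \<Rightarrow> real \<Rightarrow> state \<Rightarrow> state \<Rightarrow> bool" where
  "equilibrates_approx \<beta> \<mu> \<epsilon> X Y \<longleftrightarrow>
     (\<exists>\<sigma>. equilibrates \<beta> \<mu> X (sys Y) \<sigma> \<and> trace_norm (\<sigma> - density Y) / 2 \<le> \<epsilon>)"

section \<open>Batteries and work\<close>

definition is_battery :: "real \<Rightarrow> real \<Rightarrow> system \<Rightarrow> bool" where
  "is_battery \<beta> \<mu> B \<longleftrightarrow> hdim B > 0 \<and>
     (\<forall>i < hdim B. gibbs \<beta> \<mu> B i = exp (- \<beta> * energy B i) / (\<Sum>k < hdim B. exp (- \<beta> * energy B k)))"

definition finely_spaced :: "real \<Rightarrow> system \<Rightarrow> real \<Rightarrow> real \<Rightarrow> bool" where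
  "finely_spaced \<delta> B a b \<longleftrightarrow>
     (\<forall>x. min a b \<le> x \<and> x \<le> max a b \<longrightarrow> (\<exists>i < hdim B. \<bar>energy B i - x\<bar> \<le> \<delta>))"

definition battery_state :: "system \<Rightarrow> nat \<Rightarrow> state" where
  "battery_state B j = \<lparr> sys = B, weight = (\<lambda>i. if i = j then 1 else 0) \<rparr>"

text \<open>
  \<open>battery_levels \<beta> \<mu> \<kappa> \<delta> B j k W\<close>: in the battery \<open>B\<close> the level \<open>j\<close> has an energy \<open>E\<close>, the level \<open>k\<close>
  has energy \<open>E + W\<close>, and the levels in between are finely spaced. The informal \<open>\<beta> E \<gg> 1\<close> and
  ``finely spaced'' are made precise by a threshold \<open>\<kappa>\<close>, in the form \<open>\<beta> E \<ge> \<kappa>\<close>, and a resolution \<open>\<delta>\<close>;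
  both are meant to be arbitrary.
\<close>

definition battery_levels ::
  "real \<Rightarrow> real \<Rightarrow> real \<Rightarrow> real \<Rightarrow> system \<Rightarrow> nat \<Rightarrow> nat \<Rightarrow> real \<Rightarrow> bool" where
  "battery_levels \<beta> \<mu> \<kappa> \<delta> B j k W \<longleftrightarrow> is_battery \<beta> \<mu> B \<and> j < hdim B \<and> k < hdim B
     \<and> energy B k = energy B j + W
     \<and> \<beta> * energy B j \<ge> \<kappa>
     \<and> finely_spaced \<delta> B (energy B j) (energy B k)"

text \<open>
  Maximum and minimum are taken as supremum and infimum in the extended reals, which agree with
  them whenever these are attained.
\<close>

definition W_gain :: "real \<Rightarrow> real \<Rightarrow> real \<Rightarrow> real \<Rightarrow> real \<Rightarrow> state \<Rightarrow> ereal" where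
  "W_gain \<beta> \<mu> \<kappa> \<delta> \<epsilon> R = Sup (ereal ` {W. \<exists>B j k. battery_levels \<beta> \<mu> \<kappa> \<delta> B j k W \<and>
     equilibrates_approx \<beta> \<mu> \<epsilon> (R \<boxplus> battery_state B j) (battery_state B k)})"

definition W_cost :: "real \<Rightarrow> real \<Rightarrow> real \<Rightarrow> real \<Rightarrow> real \<Rightarrow> state \<Rightarrow> ereal" where
  "W_cost \<beta> \<mu> \<kappa> \<delta> \<epsilon> R = Inf (ereal ` {W. \<exists>B j k. battery_levels \<beta> \<mu> \<kappa> \<delta> B j k W \<and>
     equilibrates_approx \<beta> \<mu> \<epsilon> (battery_state B k) (R \<boxplus> battery_state B j)})"

section \<open>Relative entropy and grand potential\<close>

text \<open>As \<open>ln 0 = 0\<close> in HOL, the convention \<open>0 ln 0 = 0\<close> is built in.\<close>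

definition rel_entropy :: "nat \<Rightarrow> (nat \<Rightarrow> real) \<Rightarrow> (nat \<Rightarrow> real) \<Rightarrow> real" where
  "rel_entropy d r s = (\<Sum>i < d. r i * ln (r i / s i))"

definition entropy :: "nat \<Rightarrow> (nat \<Rightarrow> real) \<Rightarrow> real" where
  "entropy d r = - (\<Sum>i < d. r i * ln (r i))"

definition grand_potential :: "real \<Rightarrow> real \<Rightarrow> state \<Rightarrow> real" where
  "grand_potential \<beta> \<mu> R =
     (let d = hdim (sys R); r = weight R in
        (\<Sum>i < d. r i * energy (sys R) i) - entropy d r / \<beta> - \<mu> * (\<Sum>i < d. r i * number (sys R) i))"

end

theory Submission
  imports Defs "HOL-Analysis.L2_Norm"
begin

text \<open>
  An equilibrating operation acts on the diagonal as a column-stochastic matrix that maps the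
  equilibrium weights of the input to those of the output. For a work process this matrix is a
  test of \<open>r\<close> against \<open>g\<^sub>R\<close> on the \<open>n\<close> copies whose errors are \<open>\<epsilon>\<close> and \<open>e\<close> to the power
  \<open>- \<beta> W\<close>. Conversely, every test that leaves a factor \<open>2\<close> to spare comes from an operation
  with a sufficiently large bath, and this factor costs only \<open>ln 2\<close> of work. By Chebyshev's inequality the
  log-likelihood ratio \<open>ln (r / g\<^sub>R)\<close> of \<open>n\<close> copies concentrates at \<open>n D(r \<parallel> g\<^sub>R)\<close>, which
  determines the optimal errors up to \<open>o(n)\<close> in the exponent for every fixed \<open>\<epsilon>\<close>.
\<close>

section \<open>The trace norm\<close>

text \<open>The bath therefore holds occupation numbers of the levels of input and output;
  exchanging quanta with it conserves every charge linear in the occupation, whatever the arithmetic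
  of the eigenvalues. Its degeneracies imitate inverse Boltzmann weights; rounding them up at most
  doubles them, which is the origin of the factor \<open>2\<close>. Outputs are controlled from
  below only: basis states for which nothing is prescribed move freely within their sector, and
  normalisation turns lower bounds into a bound on the trace distance. In the converse the output
  may have coherences between degenerate levels, so its trace distance from the target has to be
  bounded below through its diagonal; this is why Hermitian matrices are diagonalised first. The
  Chebyshev tail \<open>V / (n * \<eta>\<^sup>2)\<close> eventually falls below both
  \<open>\<epsilon>\<close> and \<open>(1 - \<epsilon>) / 2\<close>, so every fixed
  \<open>\<epsilon>\<close> leads to the same rate.\<close>

lemma mat_adjoint_carrier [simp]:
  assumes "A \<in> carrier_mat n n"
  shows "mat_adjoint A \<in> carrier_mat n n"
  using assms unfolding mat_adjoint_def by (auto simp: mat_of_rows_def)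

lemma mat_adjoint_dim [simp]: "dim_row (mat_adjoint A) = dim_col A" "dim_col (mat_adjoint A) = dim_row A"
  unfolding mat_adjoint_def by auto

lemma square_mult_carrier [simp]:
  assumes "A \<in> carrier_mat n n" "B \<in> carrier_mat n n"
  shows "A * B \<in> carrier_mat n n"
  using assms by (rule mult_carrier_mat)

lemma mat_adjoint_index:
  fixes A :: "complex mat"
  assumes "A \<in> carrier_mat n n" "i < n" "j < n"
  shows "mat_adjoint A $$ (i, j) = cnj (A $$ (j, i))"
  using assms unfolding mat_adjoint_def by (auto simp: mat_of_rows_def)

lemma mat_mult_index:
  assumes "A \<in> carrier_mat n m" "B \<in> carrier_mat m k" "i < n" "j < k"
  shows "(A * B) $$ (i, j) = (\<Sum>l<m. A $$ (i, l) * B $$ (l, j))"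
  using assms by (auto simp: scalar_prod_def atLeast0LessThan)

declare index_mult_mat(1) [simp del]

lemma mat_adjoint_mult:
  fixes A B :: "complex mat"
  assumes [simp]: "A \<in> carrier_mat n n" "B \<in> carrier_mat n n"
  shows "mat_adjoint (A * B) = mat_adjoint B * mat_adjoint A"
proof (rule eq_matI)
  have c: "A * B \<in> carrier_mat n n" "mat_adjoint B * mat_adjoint A \<in> carrier_mat n n"
    by simp_all
  fix i j assume "i < dim_row (mat_adjoint B * mat_adjoint A)" "j < dim_col (mat_adjoint B * mat_adjoint A)"
  hence ij: "i < n" "j < n" using assms by auto
  show "mat_adjoint (A * B) $$ (i, j) = (mat_adjoint B * mat_adjoint A) $$ (i, j)"
    using ij by (simp add: mat_adjoint_index[OF c(1)] mat_mult_index[of _ n n _ n] mat_adjoint_index[of _ n]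
      mult.commute)
qed (use assms mat_adjoint_carrier[of "A*B" n] mat_adjoint_carrier[of A n] mat_adjoint_carrier[of B n] in auto)

lemma mat_adjoint_adjoint:
  fixes A :: "complex mat"
  assumes [simp]: "A \<in> carrier_mat n n"
  shows "mat_adjoint (mat_adjoint A) = A"
proof (rule eq_matI)
  fix i j assume "i < dim_row A" "j < dim_col A"
  hence ij: "i < n" "j < n" using assms by auto
  show "mat_adjoint (mat_adjoint A) $$ (i, j) = A $$ (i, j)"
    using ij by (simp add: mat_adjoint_index[of _ n])
qed (use assms mat_adjoint_carrier[OF mat_adjoint_carrier[OF assms]] in auto)

lemma is_unitaryI:
  assumes "U \<in> carrier_mat n n" "mat_adjoint U * U = 1\<^sub>m n"
  shows "is_unitary n U"
  using mat_mult_left_right_inverse[of "mat_adjoint U" n U] assms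
  unfolding is_unitary_def by auto

lemma is_unitary_mult:
  assumes "is_unitary n U" "is_unitary n V"
  shows "is_unitary n (U * V)"
proof (rule is_unitaryI)
  have c[simp]: "U \<in> carrier_mat n n" "V \<in> carrier_mat n n" 
    and u: "mat_adjoint U * U = 1\<^sub>m n" and v: "mat_adjoint V * V = 1\<^sub>m n"
    using assms unfolding is_unitary_def by auto
  show "U * V \<in> carrier_mat n n" by simp
  have "mat_adjoint (U * V) * (U * V) = mat_adjoint V * (mat_adjoint U * U) * V"
    by (simp add: mat_adjoint_mult[of _ n] assoc_mult_mat[of _ n n _ n _ n])
  thus "mat_adjoint (U * V) * (U * V) = 1\<^sub>m n" using u v by (simp add: right_mult_one_mat[of _ n n])
qed

text \<open>Gram-Schmidt applied to a basis that begins with \<open>v\<close> keeps \<open>v\<close>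
  as its first vector. Dividing the orthogonal vectors by their norms \<open>q j\<close> makes them
  the columns of a unitary, with \<open>c\<close> the inverse norm of \<open>v\<close>.\<close>

lemma unitary_completion:
  fixes v :: "complex vec"
  assumes v: "v \<in> carrier_vec n" "v \<noteq> 0\<^sub>v n"
  shows "\<exists>W c. is_unitary n W \<and> (\<forall>i<n. W $$ (i, 0) = c * v $ i)"
proof -
  interpret cof_vec_space n "TYPE(complex)" .
  have n: "n > 0" using v by (cases n) auto
  define b where "b = basis_completion v"
  define ws where "ws = gram_schmidt n b"
  from basis_completion[OF v, folded b_def]
  have dist_b: "distinct b" and indep: "\<not> lin_dep (set b)" and b: "set b \<subseteq> carrier_vec n"
    and hdb: "hd b = v" and len_b: "length b = n" by auto
  then obtain vs where bv: "b = v # vs" using n by (cases b) auto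
  from gram_schmidt_result[OF b dist_b indep ws_def]
  have ws: "set ws \<subseteq> carrier_vec n" "corthogonal ws" "length ws = n"
    by (auto simp: len_b)
  have "hd ws = v" using gram_schmidt_hd[OF v(1), of vs] bv ws_def by simp
  hence ws0: "ws ! 0 = v" using ws(3) n by (cases ws) auto
  have wsc: "ws ! j \<in> carrier_vec n" if "j < n" for j using ws that by auto
  define q where "q j = sqrt (\<Sum>k<n. (cmod (ws ! j $ k))\<^sup>2)" for j
  have sp: "(\<Sum>k<n. ws ! i $ k * cnj (ws ! j $ k)) = ws ! i \<bullet>c ws ! j" if "i < n" "j < n" for i j
    using wsc[OF that(2)] that by (auto simp: scalar_prod_def atLeast0LessThan)
  have qq: "(\<Sum>k<n. ws ! j $ k * cnj (ws ! j $ k)) = of_real ((q j)\<^sup>2)" for j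
    by (simp add: q_def complex_norm_square[symmetric] sum_nonneg)
  have q0: "q j \<noteq> 0" if "j < n" for j
    using corthogonalD[OF ws(2), of j j] ws(3) that sp[OF that that] qq[of j] by auto
  define W where "W = mat n n (\<lambda>(i, j). ws ! j $ i / of_real (q j))"
  have W: "W \<in> carrier_mat n n" unfolding W_def by simp
  have "mat_adjoint W * W = 1\<^sub>m n"
  proof (rule eq_matI)
    fix i j assume "i < dim_row (1\<^sub>m n)" "j < dim_col (1\<^sub>m n)"
    hence ij: "i < n" "j < n" by auto
    have "(mat_adjoint W * W) $$ (i, j) = (\<Sum>k<n. cnj (W $$ (k, i)) * W $$ (k, j))"
      using ij W by (simp add: mat_mult_index[of _ n n _ n] mat_adjoint_index[of _ n])
    also have "\<dots> = (\<Sum>k<n. ws ! j $ k * cnj (ws ! i $ k)) / (of_real (q i) * of_real (q j))"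
      unfolding sum_divide_distrib using ij by (intro sum.cong) (auto simp: W_def)
    also have "\<dots> = (if i = j then 1 else 0)"
    proof (cases "i = j")
      case True
      thus ?thesis using qq[of i] q0[of i] ij by (simp add: power2_eq_square)
    next
      case False
      thus ?thesis using sp[of j i] ij corthogonalD[OF ws(2), of j i] ws(3) by simp
    qed
    finally show "(mat_adjoint W * W) $$ (i, j) = 1\<^sub>m n $$ (i, j)" using ij by simp
  qed (use W mat_adjoint_carrier[OF W] in auto)
  hence "is_unitary n W" using W by (intro is_unitaryI)
  moreover have "\<forall>i<n. W $$ (i, 0) = (1 / of_real (q 0)) * v $ i"
    using n ws0 by (simp add: W_def)
  ultimately show ?thesis by blast
qed

text \<open>Spectral theorem by deflation, with induction on the linear factors of the
  characteristic polynomial. Fixing the list \<open>es\<close> retains multiplicities, so the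
  diagonal can be matched with the roots that define \<open>trace_norm\<close>.\<close>

lemma hermitian_diagonalization:
  fixes B :: "complex mat"
  assumes "B \<in> carrier_mat n n" "mat_adjoint B = B" "char_poly B = (\<Prod>e\<leftarrow>es. [:- e, 1:])"
  shows "\<exists>U. is_unitary n U \<and> mat_adjoint U * B * U = mat_diag n (\<lambda>i. es ! i)"
  using assms
proof (induction es arbitrary: n B)
  case Nil
  hence "n = 0" using degree_monic_char_poly[of B n] by auto
  thus ?case using Nil 
    by (intro exI[of _ "1\<^sub>m 0"]) (auto intro!: is_unitaryI eq_matI simp: mat_diag_def)
next
  case (Cons e es n B)
  note B[simp] = Cons.prems(1)
  have cp: "char_poly B = [:-e, 1:] * (\<Prod>e\<leftarrow>es. [:- e, 1:])" using Cons.prems by simp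
  have mon: "monic (\<Prod>e\<leftarrow>es. [:- e, 1:])" by (rule monic_prod_list, auto)
  have deg: "degree (char_poly B) = Suc (degree (\<Prod>e\<leftarrow>es. [:- e, 1:]))" unfolding cp
    by (subst degree_mult_eq, insert mon, auto)
  with degree_monic_char_poly[OF B] obtain m where n: "n = Suc m" by (cases n) auto
  hence n0: "0 < n" by simp
  have "eigenvalue B e" unfolding eigenvalue_root_char_poly[OF B] cp by simp
  then obtain v where v: "v \<in> carrier_vec n" "v \<noteq> 0\<^sub>v n" and ev: "B *\<^sub>v v = e \<cdot>\<^sub>v v"
    unfolding eigenvalue_def eigenvector_def using B by auto
  have ev': "(\<Sum>k<n. B $$ (i, k) * v $ k) = e * v $ i" if "i < n" for i
  proof -
    have "(B *\<^sub>v v) $ i = (\<Sum>k<n. B $$ (i, k) * v $ k)"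
      using that v carrier_matD[OF B] by (simp add: scalar_prod_def atLeast0LessThan)
    thus ?thesis using ev that v by simp
  qed
  obtain W c where W: "is_unitary n W" and Wc: "\<And>i. i < n \<Longrightarrow> W $$ (i, 0) = c * v $ i"
    using unitary_completion[OF v] by blast
  have Wm[simp]: "W \<in> carrier_mat n n" and WW: "W * mat_adjoint W = 1\<^sub>m n" "mat_adjoint W * W = 1\<^sub>m n"
    using W unfolding is_unitary_def by auto
  define B' where "B' = mat_adjoint W * B * W"
  have B'c[simp]: "B' \<in> carrier_mat n n" unfolding B'_def by simp
  have herm: "mat_adjoint B' = B'"
    unfolding B'_def by (simp add: mat_adjoint_mult[of _ n] mat_adjoint_adjoint[of _ n] Cons.prems
      assoc_mult_mat[of _ n n _ n _ n])
  \<comment> \<open>Column \<open>0\<close> of \<open>W\<close> is a multiple of the eigenvector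
    \<open>v\<close>: \<open>B\<close> scales it by \<open>e\<close>, and unitarity of
    \<open>W\<close> leaves \<open>e\<close> times the first basis vector.\<close>
  have col0: "B' $$ (i, 0) = (if i = 0 then e else 0)" if i: "i < n" for i
  proof -
    have "(B * W) $$ (l, 0) = e * W $$ (l, 0)" if "l < n" for l
    proof -
      have "(B * W) $$ (l, 0) = (\<Sum>k<n. B $$ (l, k) * (c * v $ k))"
        using that n0 Wc by (simp add: mat_mult_index[of _ n n _ n])
      also have "\<dots> = c * (\<Sum>k<n. B $$ (l, k) * v $ k)"
        by (simp add: sum_distrib_left mult_ac)
      finally show ?thesis using ev'[OF that] Wc[OF that] by simp
    qed
    hence "B' $$ (i, 0) = e * (mat_adjoint W * W) $$ (i, 0)"
      unfolding B'_def using i n0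
      by (simp add: assoc_mult_mat[of _ n n _ n _ n] mat_mult_index[of _ n n _ n] sum_distrib_left
          mult_ac)
    thus ?thesis using WW i n0 by simp
  qed
  \<comment> \<open>The zeros of column \<open>0\<close> pass to row \<open>0\<close> because
    \<open>B'\<close> is Hermitian, so \<open>e\<close> splits off as a block of size
    \<open>1\<close>.\<close>
  have row0: "B' $$ (0, j) = (if j = 0 then e else 0)" if j: "j < n" for j
  proof (cases "j = 0")
    case True thus ?thesis using col0[of 0] n0 by simp
  next
    case False
    have "B' $$ (0, j) = cnj (B' $$ (j, 0))"
      using mat_adjoint_index[OF B'c, of 0 j] herm j n0 by simp
    thus ?thesis using False col0[OF j] by simp
  qed
  define B3 where "B3 = mat m m (\<lambda>(i, j). B' $$ (Suc i, Suc j))"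
  have B3[simp]: "B3 \<in> carrier_mat m m" unfolding B3_def by simp
  define E where "E = mat 1 1 (\<lambda>_. e)"
  have E[simp]: "E \<in> carrier_mat (Suc 0) (Suc 0)" unfolding E_def by simp
  have blk: "B' = four_block_mat E (0\<^sub>m 1 m) (0\<^sub>m m 1) B3"
    by (rule eq_matI) (use B'c n row0 col0 in \<open>auto simp: B3_def E_def less_Suc_eq_0_disj\<close>)
  have "similar_mat B' B"
    unfolding similar_mat_def
    by (intro exI[of _ "mat_adjoint W"] exI[of _ W] similar_mat_witI[of _ _ n]) (use WW in \<open>auto simp: B'_def\<close>)
  hence "char_poly B' = char_poly B" by (rule char_poly_similar)
  moreover have "char_poly B' = char_poly E * char_poly B3"
    unfolding blk by (rule char_poly_four_block_zeros_col) auto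
  moreover have "char_poly E = [:-e, 1:]"
    by (subst char_poly_upper_triangular[of E 1]) (auto simp: diag_mat_def E_def)
  ultimately have "char_poly B3 = (\<Prod>e\<leftarrow>es. [:- e, 1:])"
    using cp by (metis mult_cancel_left pCons_eq_0_iff one_neq_zero)
  moreover have "mat_adjoint B3 = B3"
  proof (rule eq_matI)
    fix i j assume "i < dim_row B3" "j < dim_col B3"
    hence ij: "i < m" "j < m" by (auto simp: B3_def)
    have "mat_adjoint B' $$ (Suc i, Suc j) = cnj (B' $$ (Suc j, Suc i))"
      by (rule mat_adjoint_index[OF B'c]) (use ij n in auto)
    thus "mat_adjoint B3 $$ (i, j) = B3 $$ (i, j)" using ij herm
      by (simp add: mat_adjoint_index[OF B3]) (simp add: B3_def)
  qed (use carrier_matD[OF B3] in simp_all)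
  ultimately obtain U3 where U3: "is_unitary m U3" and D3: "mat_adjoint U3 * B3 * U3 = mat_diag m (\<lambda>i. es ! i)"
    using Cons.IH[OF B3] by blast
  have U3c[simp]: "U3 \<in> carrier_mat m m" and U3u: "mat_adjoint U3 * U3 = 1\<^sub>m m"
    using U3 unfolding is_unitary_def by auto
  define V where "V = four_block_mat (1\<^sub>m 1) (0\<^sub>m 1 m) (0\<^sub>m m 1) U3"
  have V[simp]: "V \<in> carrier_mat n n" unfolding V_def n by (metis U3c four_block_carrier_mat one_carrier_mat plus_1_eq_Suc)
  have Va: "mat_adjoint V = four_block_mat (1\<^sub>m 1) (0\<^sub>m 1 m) (0\<^sub>m m 1) (mat_adjoint U3)" (is "_ = ?Va")
  proof (rule eq_matI)
    have d: "dim_row U3 = m" "dim_col U3 = m" by (use carrier_matD[OF U3c] in auto)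
    fix i j assume "i < dim_row ?Va" "j < dim_col ?Va"
    hence ij: "i < n" "j < n" using d n by auto
    show "mat_adjoint V $$ (i, j) = ?Va $$ (i, j)"
      unfolding mat_adjoint_index[OF V ij] using ij d n unfolding V_def
      by (cases i; cases j) (auto simp: mat_adjoint_index[OF U3c])
  qed (use carrier_matD[OF V] carrier_matD[OF U3c] n in auto)
  have zs: "M * 0\<^sub>m m k = 0\<^sub>m m k" "0\<^sub>m k m * M = 0\<^sub>m k m" if "M \<in> carrier_mat m m" for M :: "complex mat" and k
    using that by auto
  have Vu: "mat_adjoint V * V = 1\<^sub>m n"
    unfolding Va unfolding V_def
    by (subst mult_four_block_mat[of _ 1 1 _ m _ m _ _ 1 _ m])
       (simp_all add: U3u n zs four_block_one_mat[of 1 m, simplified])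
  hence Vunit: "is_unitary n V" by (intro is_unitaryI) auto
  have VBV: "mat_adjoint V * B' * V = mat_diag n (\<lambda>i. (e # es) ! i)"
  proof -
    have Ez: "1\<^sub>m (Suc 0) * E = E" "E * 1\<^sub>m (Suc 0) = E" "0\<^sub>m m (Suc 0) * E = 0\<^sub>m m (Suc 0)" "E * 0\<^sub>m (Suc 0) m = 0\<^sub>m (Suc 0) m"
      by (rule left_mult_one_mat[OF E], rule right_mult_one_mat[OF E], rule left_mult_zero_mat[OF E],
          rule right_mult_zero_mat[OF E])
    have "mat_adjoint V * B' = four_block_mat E (0\<^sub>m 1 m) (0\<^sub>m m 1) (mat_adjoint U3 * B3)"
      unfolding Va blk by (subst mult_four_block_mat[of _ 1 1 _ m _ m _ _ 1 _ m]) (simp_all add: zs Ez)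
    also have "\<dots> * V = four_block_mat E (0\<^sub>m 1 m) (0\<^sub>m m 1) (mat_adjoint U3 * B3 * U3)"
      unfolding V_def by (subst mult_four_block_mat[of _ 1 1 _ m _ m _ _ 1 _ m]) (simp_all add: zs Ez)
    also have "\<dots> = mat_diag n (\<lambda>i. (e # es) ! i)"
      unfolding D3 by (rule eq_matI) (auto simp: mat_diag_def E_def n nth_Cons')
    finally show ?thesis .
  qed
  show ?case
  proof (intro exI[of _ "W * V"] conjI)
    show "is_unitary n (W * V)" by (rule is_unitary_mult[OF W Vunit])
    have "mat_adjoint (W * V) * B * (W * V) = mat_adjoint V * B' * V"
      unfolding B'_def by (simp add: mat_adjoint_mult[of _ n] assoc_mult_mat[of _ n n _ n _ n])
    thus "mat_adjoint (W * V) * B * (W * V) = mat_diag n (\<lambda>i. (e # es) ! i)" using VBV by simp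
  qed
qed

lemma proots_prod_linear: "proots (\<Prod>e\<leftarrow>es. [:- e, 1:]) = mset (es :: complex list)"
proof (induction es)
  case (Cons e es)
  have "(\<Prod>e\<leftarrow>es. [:- e, 1:]) \<noteq> 0" by (auto simp: prod_list_zero_iff)
  thus ?case using Cons by (simp add: proots_mult proots_linear_factor del: mult_pCons_left)
qed simp

lemma sum_mset_mset_nth: "(\<Sum>x\<in>#mset xs. f x) = (\<Sum>i<length xs. f (xs ! i))"
  by (induction xs) (simp_all add: sum.lessThan_Suc_shift del: sum.lessThan_Suc)

text \<open>Duality with diagonal contractions: the left-hand side is the modulus of the trace of
  \<open>A\<close> multiplied by the diagonal matrix of \<open>w\<close>. A diagonalisation of
  \<open>mat_adjoint A * A\<close> by \<open>U\<close> replaces the polar decomposition: column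
  \<open>j\<close> of \<open>A * U\<close> has the \<open>j\<close>-th singular value as its norm,
  column \<open>j\<close> of \<open>U\<close> has norm \<open>1\<close>, and Cauchy-Schwarz is
  applied for each \<open>j\<close>.\<close>

lemma trace_norm_ge:
  fixes A :: "complex mat" and w :: "nat \<Rightarrow> real"
  assumes A: "A \<in> carrier_mat n n" and w: "\<And>i. i < n \<Longrightarrow> \<bar>w i\<bar> \<le> 1"
  shows "cmod (\<Sum>i<n. of_real (w i) * A $$ (i, i)) \<le> trace_norm A"
proof -
  note A[simp]
  let ?B = "mat_adjoint A * A"
  have B[simp]: "?B \<in> carrier_mat n n" by simp
  obtain es where cp: "char_poly ?B = (\<Prod>a\<leftarrow>es. [:- a, 1:])" and len: "length es = n"
    using char_poly_factorized[OF B] by blast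
  obtain U where U: "is_unitary n U" and D: "mat_adjoint U * ?B * U = mat_diag n (\<lambda>i. es ! i)"
    using hermitian_diagonalization[OF B _ cp] mat_adjoint_mult[of "mat_adjoint A" n A] mat_adjoint_adjoint[of A n]
    by auto
  have Uc[simp]: "U \<in> carrier_mat n n" and Uu: "mat_adjoint U * U = 1\<^sub>m n" "U * mat_adjoint U = 1\<^sub>m n"
    using U unfolding is_unitary_def by auto
  define C where "C = A * U"
  have C[simp]: "C \<in> carrier_mat n n" unfolding C_def by simp
  have CC: "mat_adjoint C * C = mat_diag n (\<lambda>i. es ! i)"
    unfolding C_def D[symmetric] 
    by (simp add: mat_adjoint_mult[of _ n] assoc_mult_mat[of _ n n _ n _ n])
  have nrm: "(\<Sum>i<n. (cmod (M $$ (i, j)))\<^sup>2) = Re ((mat_adjoint M * M) $$ (j, j))"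
    if [simp]: "M \<in> carrier_mat n n" and "j < n" for M j
    using that(2) by (simp add: mat_mult_index[of _ n n _ n] mat_adjoint_index[of _ n] cmod_power2 sum.distrib) (simp add: power2_eq_square)
  have C2: "(\<Sum>i<n. (cmod (C $$ (i, j)))\<^sup>2) = Re (es ! j)" if "j < n" for j
    using nrm[OF C that] that unfolding CC by (simp add: mat_diag_def)
  have U2: "(\<Sum>i<n. (cmod (U $$ (i, j)))\<^sup>2) = 1" if "j < n" for j
    using nrm[OF Uc that] that unfolding Uu by simp
  have Adiag: "A $$ (i, i) = (\<Sum>j<n. C $$ (i, j) * cnj (U $$ (i, j)))" if "i < n" for i
  proof -
    have "A = C * mat_adjoint U" 
      unfolding C_def by (simp add: assoc_mult_mat[of _ n n _ n _ n] Uu right_mult_one_mat[of _ n n])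
    hence "A $$ (i, i) = (C * mat_adjoint U) $$ (i, i)" by simp
    also have "\<dots> = (\<Sum>j<n. C $$ (i, j) * cnj (U $$ (i, j)))"
      using that by (simp add: mat_mult_index[of _ n n _ n] mat_adjoint_index[of _ n])
    finally show ?thesis .
  qed
  have "(\<Sum>i<n. of_real (w i) * A $$ (i, i)) = (\<Sum>i<n. \<Sum>j<n. of_real (w i) * (C $$ (i, j) * cnj (U $$ (i, j))))"
    by (intro sum.cong refl) (simp add: Adiag sum_distrib_left)
  also have "\<dots> = (\<Sum>j<n. \<Sum>i<n. of_real (w i) * (C $$ (i, j) * cnj (U $$ (i, j))))"
    by (rule sum.swap)
  also have "cmod \<dots> \<le> (\<Sum>j<n. sqrt (Re (es ! j)))"
  proof (rule sum_norm_le)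
    fix j assume "j \<in> {..<n}"
    hence j: "j < n" by simp
    have "cmod (\<Sum>i<n. of_real (w i) * (C $$ (i, j) * cnj (U $$ (i, j))))
      \<le> (\<Sum>i<n. \<bar>cmod (C $$ (i, j))\<bar> * \<bar>cmod (U $$ (i, j))\<bar>)"
      using w by (intro sum_norm_le) (auto simp: norm_mult intro!: mult_left_le_one_le)
    also have "\<dots> \<le> L2_set (\<lambda>i. cmod (C $$ (i, j))) {..<n} * L2_set (\<lambda>i. cmod (U $$ (i, j))) {..<n}"
      by (rule L2_set_mult_ineq)
    also have "\<dots> = sqrt (Re (es ! j))" by (simp add: L2_set_def C2[OF j] U2[OF j])
    finally show "cmod (\<Sum>i<n. of_real (w i) * (C $$ (i, j) * cnj (U $$ (i, j)))) \<le> sqrt (Re (es ! j))" .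
  qed
  also have "\<dots> = trace_norm A"
    unfolding trace_norm_def cp proots_prod_linear sum_mset_mset_nth len ..
  finally show ?thesis .
qed

lemma trace_norm_diag:
  "trace_norm (mat_diag n (\<lambda>i. complex_of_real (f i))) = (\<Sum>i<n. \<bar>f i\<bar>)"
proof -
  let ?A = "mat_diag n (\<lambda>i. complex_of_real (f i))"
  have "mat_adjoint ?A = ?A"
    by (rule eq_matI) (use mat_adjoint_carrier[of ?A n] in \<open>auto simp: mat_adjoint_index[of _ n] mat_diag_def\<close>)
  hence eq: "mat_adjoint ?A * ?A = mat_diag n (\<lambda>i. complex_of_real ((f i)\<^sup>2))" (is "_ = ?D")
    by (simp add: power2_eq_square)
  have "char_poly ?D = (\<Prod>a\<leftarrow>diag_mat ?D. [:- a, 1:])"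
    by (rule char_poly_upper_triangular[of _ n]) (auto simp: mat_diag_def)
  thus ?thesis unfolding trace_norm_def eq 
    by (simp only: proots_prod_linear sum_mset_mset_nth) (simp add: diag_mat_def mat_diag_def)
qed

section \<open>Equilibrating operations as stochastic matrices\<close>

lemma sum_mult_index:
  fixes f :: "nat \<Rightarrow> 'a::comm_monoid_add"
  shows "(\<Sum>k<a*b. f k) = (\<Sum>i<a. \<Sum>j<b. f (i * b + j))"
proof (induction a)
  case (Suc a)
  have "(\<Sum>k<Suc a * b. f k) = (\<Sum>k<a*b. f k) + (\<Sum>k=a*b..<a*b+b. f k)"
    by (metis add.commute mult_Suc sum.atLeastLessThan_concat atLeast0LessThan le_add1 zero_le)
  also have "(\<Sum>k=a*b..<a*b+b. f k) = (\<Sum>j<b. f (a * b + j))"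
    using sum.shift_bounds_nat_ivl[of f 0 "a*b" b] by (simp add: atLeast0LessThan add.commute)
  finally show ?case using Suc by simp
qed simp

lemma index_mult_less:
  fixes i j a b :: nat
  assumes "i < a" "j < b"
  shows "i * b + j < a * b"
proof -
  have "i * b + j < Suc i * b" using assms by simp
  also have "\<dots> \<le> a * b" using assms by (intro mult_le_mono1) simp
  finally show ?thesis .
qed

section \<open>Boltzmann and Gibbs weights of composite systems\<close>

definition boltzmann :: "real \<Rightarrow> real \<Rightarrow> system \<Rightarrow> nat \<Rightarrow> real" where
  "boltzmann \<beta> \<mu> S i = exp (- \<beta> * (energy S i - \<mu> * number S i))"

definition partition_function :: "real \<Rightarrow> real \<Rightarrow> system \<Rightarrow> real" where
  "partition_function \<beta> \<mu> S = (\<Sum>i<hdim S. boltzmann \<beta> \<mu> S i)"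

lemma gibbs_eq: "gibbs \<beta> \<mu> S i = boltzmann \<beta> \<mu> S i / partition_function \<beta> \<mu> S"
  unfolding gibbs_def boltzmann_def partition_function_def ..

lemma boltzmann_pos [simp]: "0 < boltzmann \<beta> \<mu> S i"
  unfolding boltzmann_def by simp

lemma partition_function_pos: "0 < hdim S \<Longrightarrow> 0 < partition_function \<beta> \<mu> S"
  unfolding partition_function_def by (intro sum_pos) auto

lemma gibbs_pos: "0 < hdim S \<Longrightarrow> 0 < gibbs \<beta> \<mu> S i"
  unfolding gibbs_eq by (simp add: partition_function_pos)

lemma sum_gibbs: "0 < hdim S \<Longrightarrow> (\<Sum>i<hdim S. gibbs \<beta> \<mu> S i) = 1"
  using partition_function_pos[of S \<beta> \<mu>]
  unfolding gibbs_eq sum_divide_distrib[symmetric] partition_function_def[symmetric] by simp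

lemma hdim_sys_comp [simp]: "hdim (S \<oplus>\<^sub>s T) = hdim S * hdim T"
  unfolding sys_comp_def by simp

lemma sys_state_comp [simp]: "sys (R \<boxplus> S) = sys R \<oplus>\<^sub>s sys S"
  unfolding state_comp_def by simp

lemma weight_state_comp:
  "weight (R \<boxplus> S) k = weight R (k div hdim (sys S)) * weight S (k mod hdim (sys S))"
  unfolding state_comp_def by simp

lemma sys_equilibrium [simp]: "sys (equilibrium \<beta> \<mu> S) = S"
  and weight_equilibrium [simp]: "weight (equilibrium \<beta> \<mu> S) = gibbs \<beta> \<mu> S"
  unfolding equilibrium_def by simp_all

lemma boltzmann_sys_comp:
  "boltzmann \<beta> \<mu> (S \<oplus>\<^sub>s T) k = boltzmann \<beta> \<mu> S (k div hdim T) * boltzmann \<beta> \<mu> T (k mod hdim T)"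
  unfolding boltzmann_def sys_comp_def by (simp add: exp_add[symmetric] algebra_simps)

lemma partition_function_sys_comp:
  "partition_function \<beta> \<mu> (S \<oplus>\<^sub>s T) = partition_function \<beta> \<mu> S * partition_function \<beta> \<mu> T"
  unfolding partition_function_def hdim_sys_comp sum_mult_index boltzmann_sys_comp sum_product
  by (intro sum.cong refl) auto

lemma gibbs_sys_comp:
  "gibbs \<beta> \<mu> (S \<oplus>\<^sub>s T) k = gibbs \<beta> \<mu> S (k div hdim T) * gibbs \<beta> \<mu> T (k mod hdim T)"
  unfolding gibbs_eq partition_function_sys_comp boltzmann_sys_comp by simp

lemma is_state_equilibrium: "0 < hdim S \<Longrightarrow> is_state (equilibrium \<beta> \<mu> S)"
  unfolding is_state_def by (simp add: less_imp_le gibbs_pos sum_gibbs)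

lemma is_state_comp:
  assumes "is_state R" "is_state S"
  shows "is_state (R \<boxplus> S)"
proof -
  have *: "hdim (sys R) > 0" "hdim (sys S) > 0" using assms unfolding is_state_def by auto
  have "(\<Sum>k<hdim (sys (R \<boxplus> S)). weight (R \<boxplus> S) k) = (\<Sum>i<hdim (sys R). \<Sum>j<hdim (sys S). weight R i * weight S j)"
    by (simp add: sum_mult_index weight_state_comp)
  also have "\<dots> = 1" using assms unfolding sum_product[symmetric] is_state_def by simp
  finally show ?thesis using * assms unfolding is_state_def
    by (auto simp: weight_state_comp less_mult_imp_div_less)
qed

text \<open>\<open>V\<close> maps eigenspaces of \<open>f\<close> to eigenspaces of \<open>g\<close>
  with the same eigenvalue. Applied to \<open>H\<close> and to \<open>N\<close>, this turns
  conservation of the operators into equality of Boltzmann weights along every transition of nonzero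
  amplitude.\<close>

lemma unitary_intertwines_diag_imp:
  assumes V: "is_unitary d V"
    and V': "V * mat_diag d f * mat_adjoint V = mat_diag d g"
    and ij: "i < d" "j < d" "V $$ (i, j) \<noteq> 0"
  shows "f j = g i"
proof -
  have [simp]: "V \<in> carrier_mat d d" and u: "mat_adjoint V * V = 1\<^sub>m d"
    using V unfolding is_unitary_def by auto
  have "mat_diag d g * V = V * mat_diag d f * (mat_adjoint V * V)"
    unfolding V'[symmetric] by (simp add: assoc_mult_mat[of _ d d _ d _ d])
  hence "mat_diag d g * V = V * mat_diag d f" by (simp add: u right_mult_one_mat[of _ d d])
  hence "(mat_diag d g * V) $$ (i, j) = (V * mat_diag d f) $$ (i, j)" by simp
  thus ?thesis using ij
    by (simp add: mat_diag_mult_left[of _ d d] mat_diag_mult_right[of _ d d])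
qed

text \<open>On diagonals the conjugation acts as the unistochastic matrix of squared moduli, so
  phases of \<open>V\<close> do not enter the converse.\<close>

lemma unitary_conj_diag_index:
  fixes f :: "nat \<Rightarrow> real"
  assumes V: "V \<in> carrier_mat d d" and a: "a < d"
  shows "(V * mat_diag d (\<lambda>i. complex_of_real (f i)) * mat_adjoint V) $$ (a, a)
    = of_real (\<Sum>b<d. (cmod (V $$ (a, b)))\<^sup>2 * f b)"
proof -
  note V[simp]
  have "(V * mat_diag d (\<lambda>i. complex_of_real (f i)) * mat_adjoint V) $$ (a, a)
     = (\<Sum>b<d. V $$ (a, b) * of_real (f b) * cnj (V $$ (a, b)))"
    using a by (subst mat_mult_index[of _ d d _ d])
      (simp_all add: mat_diag_mult_right[of _ d d] mat_adjoint_index[of _ d])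
  also have "\<dots> = of_real (\<Sum>b<d. (cmod (V $$ (a, b)))\<^sup>2 * f b)"
    unfolding of_real_sum by (intro sum.cong refl) (simp add: complex_norm_square[symmetric] mult_ac)
  finally show ?thesis .
qed

lemma is_unitary_one: "is_unitary d (1\<^sub>m d)"
proof -
  have "mat_adjoint (1\<^sub>m d) = (1\<^sub>m d :: complex mat)"
    by (rule eq_matI) (auto simp: mat_adjoint_index[of _ d])
  thus ?thesis unfolding is_unitary_def by simp
qed

text \<open>As \<open>U\<close> commutes with both total operators, \<open>J * U\<close> carries
  them to the same images as \<open>J\<close> alone. Dynamics and identification of subsystems thus
  merge into one unitary \<open>V\<close>.\<close>

lemma equilibratesE:
  assumes "equilibrates \<beta> \<mu> X S \<sigma>"
  obtains G T V where "0 < hdim G" "hdim S * hdim T = hdim (sys X) * hdim G"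
    "is_unitary (hdim (sys X) * hdim G) V"
    "V * hamiltonian (sys X \<oplus>\<^sub>s G) * mat_adjoint V = hamiltonian (S \<oplus>\<^sub>s T)"
    "V * number_op (sys X \<oplus>\<^sub>s G) * mat_adjoint V = number_op (S \<oplus>\<^sub>s T)"
    "\<sigma> = partial_trace (hdim S) (hdim T) (V * density (X \<boxplus> equilibrium \<beta> \<mu> G) * mat_adjoint V)"
proof -
  obtain G T U J where G: "0 < hdim G" "hdim S * hdim T = hdim (sys X) * hdim G"
    and U: "is_unitary (hdim (sys X) * hdim G) U" and J: "is_unitary (hdim (sys X) * hdim G) J"
    and UH: "U * hamiltonian (sys X \<oplus>\<^sub>s G) = hamiltonian (sys X \<oplus>\<^sub>s G) * U"
    and UN: "U * number_op (sys X \<oplus>\<^sub>s G) = number_op (sys X \<oplus>\<^sub>s G) * U"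
    and JH: "J * hamiltonian (sys X \<oplus>\<^sub>s G) * mat_adjoint J = hamiltonian (S \<oplus>\<^sub>s T)"
    and JN: "J * number_op (sys X \<oplus>\<^sub>s G) * mat_adjoint J = number_op (S \<oplus>\<^sub>s T)"
    and s: "\<sigma> = partial_trace (hdim S) (hdim T)
       (J * (U * density (X \<boxplus> equilibrium \<beta> \<mu> G) * mat_adjoint U) * mat_adjoint J)"
    using assms unfolding equilibrates_def Let_def by auto
  let ?d = "hdim (sys X) * hdim G"
  have [simp]: "U \<in> carrier_mat ?d ?d" "J \<in> carrier_mat ?d ?d"
    "hamiltonian (sys X \<oplus>\<^sub>s G) \<in> carrier_mat ?d ?d" "number_op (sys X \<oplus>\<^sub>s G) \<in> carrier_mat ?d ?d"
    "density (X \<boxplus> equilibrium \<beta> \<mu> G) \<in> carrier_mat ?d ?d" and UU: "U * mat_adjoint U = 1\<^sub>m ?d"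
    using U J unfolding is_unitary_def hamiltonian_def number_op_def density_def by auto
  have *: "J * U * M * mat_adjoint (J * U) = J * (U * M * mat_adjoint U) * mat_adjoint J"
    if [simp]: "M \<in> carrier_mat ?d ?d" for M
    by (simp add: mat_adjoint_mult[of _ ?d] assoc_mult_mat[of _ ?d ?d _ ?d _ ?d])
  have **: "U * M * mat_adjoint U = M" if [simp]: "M \<in> carrier_mat ?d ?d" and "U * M = M * U" for M
    unfolding that(2) by (simp add: assoc_mult_mat[of _ ?d ?d _ ?d _ ?d] UU right_mult_one_mat[of _ ?d ?d])
  show ?thesis
    by (rule that[OF G is_unitary_mult[OF J U]]) (simp_all add: * **[OF _ UH] **[OF _ UN] JH JN s)
qed

text \<open>Necessary half of equimajorization. Squared moduli of a unitary are doubly stochastic,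
  and transitions link only equal energies and numbers, so total Gibbs weights are preserved.
  Averaging over the bath and summing over the discarded system keeps stochasticity and Gibbs
  preservation. Nothing is claimed about off-diagonal entries of \<open>\<sigma>\<close>.\<close>

lemma equilibrates_stochastic:
  assumes eq: "equilibrates \<beta> \<mu> X S \<sigma>" and X: "0 < hdim (sys X)"
  obtains M where "\<And>s x. 0 \<le> M s x"
    "\<And>x. x < hdim (sys X) \<Longrightarrow> (\<Sum>s<hdim S. M s x) = 1"
    "\<And>s. s < hdim S \<Longrightarrow> (\<Sum>x<hdim (sys X). M s x * gibbs \<beta> \<mu> (sys X) x) = gibbs \<beta> \<mu> S s"
    "\<And>s. s < hdim S \<Longrightarrow> \<sigma> $$ (s, s) = of_real (\<Sum>x<hdim (sys X). M s x * weight X x)"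
    "\<sigma> \<in> carrier_mat (hdim S) (hdim S)"
proof -
  obtain G T V where G: "0 < hdim G" and dd: "hdim S * hdim T = hdim (sys X) * hdim G"
    and V: "is_unitary (hdim (sys X) * hdim G) V"
    and H: "V * hamiltonian (sys X \<oplus>\<^sub>s G) * mat_adjoint V = hamiltonian (S \<oplus>\<^sub>s T)"
    and N: "V * number_op (sys X \<oplus>\<^sub>s G) * mat_adjoint V = number_op (S \<oplus>\<^sub>s T)"
    and \<sigma>: "\<sigma> = partial_trace (hdim S) (hdim T) (V * density (X \<boxplus> equilibrium \<beta> \<mu> G) * mat_adjoint V)"
    using equilibratesE[OF eq] .
  let ?d = "hdim (sys X) * hdim G"
  have T: "hdim T > 0" and S: "hdim S > 0" using dd X G by (metis nat_0_less_mult_iff)+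
  define P where "P a b = (cmod (V $$ (a, b)))\<^sup>2" for a b
  have P0: "0 \<le> P a b" for a b unfolding P_def by simp
  have [simp]: "V \<in> carrier_mat ?d ?d" and u: "mat_adjoint V * V = 1\<^sub>m ?d" "V * mat_adjoint V = 1\<^sub>m ?d"
    using V unfolding is_unitary_def by auto
  have row: "(\<Sum>b<?d. P a b) = 1" if "a < ?d" for a
    using unitary_conj_diag_index[of V ?d a "\<lambda>_. 1"] that u(2) 
    by (simp add: P_def right_mult_one_mat[of _ ?d ?d] flip: of_real_sum)
  have col: "(\<Sum>a<?d. P a b) = 1" if "b < ?d" for b
    using unitary_conj_diag_index[of "mat_adjoint V" ?d b "\<lambda>_. 1"] that u(1) 
    by (simp add: P_def right_mult_one_mat[of _ ?d ?d] mat_adjoint_adjoint[of _ ?d] mat_adjoint_index[of _ ?d] flip: of_real_sum)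
  let ?w = "boltzmann \<beta> \<mu> (sys X \<oplus>\<^sub>s G)" and ?w' = "boltzmann \<beta> \<mu> (S \<oplus>\<^sub>s T)"
  have cons: "P a b * ?w b = P a b * ?w' a" if "a < ?d" "b < ?d" for a b
  proof (cases "V $$ (a, b) = 0")
    case False
    have "energy (sys X \<oplus>\<^sub>s G) b = energy (S \<oplus>\<^sub>s T) a"
      using unitary_intertwines_diag_imp[OF V _ that False] H unfolding hamiltonian_def hdim_sys_comp dd
      by (metis of_real_eq_iff)
    moreover have "number (sys X \<oplus>\<^sub>s G) b = number (S \<oplus>\<^sub>s T) a"
      using unitary_intertwines_diag_imp[OF V _ that False] N unfolding number_op_def hdim_sys_comp dd
      by (metis of_real_eq_iff)
    ultimately show ?thesis unfolding boltzmann_def by simp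
  qed (simp add: P_def)
  \<comment> \<open>The total system is split differently before and after, so equality of the two
    partition functions has to be proved; it follows from double stochasticity of \<open>P\<close>
    together with \<open>cons\<close>.\<close>
  have "partition_function \<beta> \<mu> (sys X \<oplus>\<^sub>s G) = (\<Sum>b<?d. (\<Sum>a<?d. P a b) * ?w b)"
    unfolding partition_function_def by (auto intro!: sum.cong simp: col)
  also have "\<dots> = (\<Sum>b<?d. \<Sum>a<?d. P a b * ?w' a)"
    unfolding sum_distrib_right by (auto intro!: sum.cong simp: cons)
  also have "\<dots> = (\<Sum>a<?d. (\<Sum>b<?d. P a b) * ?w' a)"
    by (subst sum.swap) (simp add: sum_distrib_right)
  also have "\<dots> = partition_function \<beta> \<mu> (S \<oplus>\<^sub>s T)"
    unfolding partition_function_def by (auto intro!: sum.cong simp: row dd)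
  finally have Z: "partition_function \<beta> \<mu> (sys X \<oplus>\<^sub>s G) = partition_function \<beta> \<mu> (S \<oplus>\<^sub>s T)" .
  have gpres: "(\<Sum>b<?d. P a b * gibbs \<beta> \<mu> (sys X \<oplus>\<^sub>s G) b) = gibbs \<beta> \<mu> (S \<oplus>\<^sub>s T) a" if a: "a < ?d" for a
  proof -
    have "(\<Sum>b<?d. P a b * gibbs \<beta> \<mu> (sys X \<oplus>\<^sub>s G) b) = (\<Sum>b<?d. P a b * gibbs \<beta> \<mu> (S \<oplus>\<^sub>s T) a)"
      using cons[OF a] by (intro sum.cong refl) (simp add: gibbs_eq Z)
    thus ?thesis using row[OF a] by (simp add: sum_distrib_right[symmetric])
  qed
  \<comment> \<open>Bath levels \<open>g\<close> of the input enter with their Gibbs weights,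
    discarded levels \<open>t\<close> of the output are summed over.\<close>
  define M where "M s x = (\<Sum>t<hdim T. \<Sum>g<hdim G. P (s * hdim T + t) (x * hdim G + g) * gibbs \<beta> \<mu> G g)" for s x
  have idx: "s * hdim T + t < ?d" if "s < hdim S" "t < hdim T" for s t
    using index_mult_less[OF that] dd by simp
  have key: "(\<Sum>x<hdim (sys X). M s x * p x)
     = (\<Sum>t<hdim T. \<Sum>b<?d. P (s * hdim T + t) b * (p (b div hdim G) * gibbs \<beta> \<mu> G (b mod hdim G)))" for s p
  proof -
    have "(\<Sum>x<hdim (sys X). M s x * p x) = (\<Sum>t<hdim T. \<Sum>x<hdim (sys X). \<Sum>g<hdim G.
         P (s * hdim T + t) (x * hdim G + g) * gibbs \<beta> \<mu> G g * p x)"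
      unfolding M_def sum_distrib_right by (rule sum.swap)
    also have "\<dots> = (\<Sum>t<hdim T. \<Sum>b<?d. P (s * hdim T + t) b * (p (b div hdim G) * gibbs \<beta> \<mu> G (b mod hdim G)))"
      unfolding sum_mult_index using G by (intro sum.cong refl) (simp add: mult_ac)
    finally show ?thesis .
  qed
  show ?thesis
  proof (rule that[of M])
    show "0 \<le> M s x" for s x unfolding M_def using gibbs_pos[OF G] P0 
      by (intro sum_nonneg mult_nonneg_nonneg) (auto simp: less_imp_le)
    fix x assume x: "x < hdim (sys X)"
    have "(\<Sum>s<hdim S. M s x) = (\<Sum>a<?d. \<Sum>g<hdim G. P a (x * hdim G + g) * gibbs \<beta> \<mu> G g)"
      unfolding dd[symmetric] sum_mult_index M_def ..
    also have "\<dots> = (\<Sum>g<hdim G. \<Sum>a<?d. P a (x * hdim G + g) * gibbs \<beta> \<mu> G g)"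
      by (rule sum.swap)
    also have "\<dots> = (\<Sum>g<hdim G. gibbs \<beta> \<mu> G g)"
      unfolding sum_distrib_right[symmetric] using col index_mult_less[OF x] by (intro sum.cong) auto
    finally show "(\<Sum>s<hdim S. M s x) = 1" using sum_gibbs[OF G] by simp
  next
    fix s assume s: "s < hdim S"
    have "(\<Sum>x<hdim (sys X). M s x * gibbs \<beta> \<mu> (sys X) x) = (\<Sum>t<hdim T. gibbs \<beta> \<mu> (S \<oplus>\<^sub>s T) (s * hdim T + t))"
      unfolding key gibbs_sys_comp[symmetric] using gpres idx[OF s] by (intro sum.cong) auto
    also have "\<dots> = gibbs \<beta> \<mu> S s"
      using T by (simp add: gibbs_sys_comp sum_distrib_left[symmetric] sum_gibbs)
    finally show "(\<Sum>x<hdim (sys X). M s x * gibbs \<beta> \<mu> (sys X) x) = gibbs \<beta> \<mu> S s" .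
    have "\<sigma> $$ (s, s) = (\<Sum>t<hdim T. of_real (\<Sum>b<?d. P (s * hdim T + t) b * weight (X \<boxplus> equilibrium \<beta> \<mu> G) b))"
      unfolding \<sigma> partial_trace_def using s idx[OF s]
      by (simp add: density_def unitary_conj_diag_index P_def del: of_real_sum)
    also have "\<dots> = of_real (\<Sum>x<hdim (sys X). M s x * weight X x)"
      unfolding key by (simp add: weight_state_comp)
    finally show "\<sigma> $$ (s, s) = of_real (\<Sum>x<hdim (sys X). M s x * weight X x)" .
  qed (simp add: \<sigma> partial_trace_def)
qed

text \<open>The trace norm is tested against the signs \<open>1\<close> on \<open>P\<close> and
  \<open>-1\<close> off \<open>P\<close>. Both diagonals sum to \<open>1\<close>, so the signed sum
  is twice the deviation on \<open>P\<close>, which matches the factor \<open>1/2\<close> in the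
  trace distance.\<close>

lemma equilibrates_approx_stochastic:
  assumes eq: "equilibrates_approx \<beta> \<mu> \<epsilon> X Y" and X: "is_state X" and Y: "is_state Y"
  obtains M where "\<And>s x. 0 \<le> M s x"
    "\<And>x. x < hdim (sys X) \<Longrightarrow> (\<Sum>s<hdim (sys Y). M s x) = 1"
    "\<And>s. s < hdim (sys Y) \<Longrightarrow> (\<Sum>x<hdim (sys X). M s x * gibbs \<beta> \<mu> (sys X) x) = gibbs \<beta> \<mu> (sys Y) s"
    "\<And>P. P \<subseteq> {..<hdim (sys Y)} \<Longrightarrow>
       (\<Sum>s\<in>P. weight Y s) - \<epsilon> \<le> (\<Sum>s\<in>P. \<Sum>x<hdim (sys X). M s x * weight X x)"
proof -
  let ?d = "hdim (sys Y)"
  obtain \<sigma> where e: "equilibrates \<beta> \<mu> X (sys Y) \<sigma>" and tn: "trace_norm (\<sigma> - density Y) / 2 \<le> \<epsilon>"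
    using eq unfolding equilibrates_approx_def by blast
  have "0 < hdim (sys X)" using X unfolding is_state_def by simp
  then obtain M where M: "\<And>s x. 0 \<le> M s x"
    "\<And>x. x < hdim (sys X) \<Longrightarrow> (\<Sum>s<?d. M s x) = 1"
    "\<And>s. s < ?d \<Longrightarrow> (\<Sum>x<hdim (sys X). M s x * gibbs \<beta> \<mu> (sys X) x) = gibbs \<beta> \<mu> (sys Y) s"
    and \<sigma>: "\<And>s. s < ?d \<Longrightarrow> \<sigma> $$ (s, s) = of_real (\<Sum>x<hdim (sys X). M s x * weight X x)"
    and \<sigma>c: "\<sigma> \<in> carrier_mat ?d ?d"
    using equilibrates_stochastic[OF e] by blast
  define f where "f s = (\<Sum>x<hdim (sys X). M s x * weight X x) - weight Y s" for s
  have fs: "(\<sigma> - density Y) $$ (s, s) = of_real (f s)" if "s < ?d" for s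
    using that \<sigma>[OF that] \<sigma>c by (simp add: f_def density_def mat_diag_def)
  have "(\<Sum>s<?d. \<Sum>x<hdim (sys X). M s x * weight X x) = (\<Sum>x<hdim (sys X). (\<Sum>s<?d. M s x) * weight X x)"
    by (subst sum.swap) (simp add: sum_distrib_right)
  also have "\<dots> = 1" using M(2) X unfolding is_state_def by simp
  finally have f0: "(\<Sum>s<?d. f s) = 0" using Y unfolding f_def is_state_def by (simp add: sum_subtractf)
  show ?thesis
  proof (rule that[OF M])
    fix P assume P: "P \<subseteq> {..<?d}"
    define w :: "nat \<Rightarrow> real" where "w s = (if s \<in> P then 1 else -1)" for s
    have "cmod (\<Sum>s<?d. of_real (w s) * (\<sigma> - density Y) $$ (s, s)) \<le> trace_norm (\<sigma> - density Y)"
      using \<sigma>c by (intro trace_norm_ge minus_carrier_mat) (auto simp: density_def w_def)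
    also have "(\<Sum>s<?d. of_real (w s) * (\<sigma> - density Y) $$ (s, s)) = of_real (\<Sum>s<?d. w s * f s)"
      unfolding of_real_sum by (intro sum.cong) (simp_all add: fs)
    also have "(\<Sum>s<?d. w s * f s) = (\<Sum>s<?d. 2 * (if s \<in> P then f s else 0) - f s)"
      by (intro sum.cong) (auto simp: w_def)
    also have "\<dots> = 2 * (\<Sum>s\<in>P. f s)"
      using P f0 by (simp add: sum_subtractf sum_distrib_left[symmetric] sum.If_cases Int_absorb1)
    finally have "2 * \<bar>\<Sum>s\<in>P. f s\<bar> \<le> 2 * \<epsilon>" using tn by (simp del: of_real_sum)
    hence "- (\<Sum>s\<in>P. f s) \<le> \<epsilon>" by (simp add: abs_le_iff)
    thus "(\<Sum>s\<in>P. weight Y s) - \<epsilon> \<le> (\<Sum>s\<in>P. \<Sum>x<hdim (sys X). M s x * weight X x)"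
      unfolding f_def sum_subtractf by (simp add: algebra_simps)
  qed
qed

section \<open>Converse bounds from hypothesis testing\<close>

lemma sys_battery_state [simp]: "sys (battery_state B j) = B"
  unfolding battery_state_def by simp

lemma weight_battery_state: "weight (battery_state B j) i = (if i = j then 1 else 0)"
  unfolding battery_state_def by simp

lemma is_state_battery: "j < hdim B \<Longrightarrow> is_state (battery_state B j)"
  unfolding is_state_def by (auto simp: weight_battery_state)

text \<open>\<open>is_battery\<close> makes the Gibbs weights depend on the energy alone, and the
  battery's partition function cancels in the ratio of two levels.\<close>

lemma gibbs_battery_levels:
  assumes "battery_levels \<beta> \<mu> \<kappa> \<delta> B j k W"
  shows "gibbs \<beta> \<mu> B k = gibbs \<beta> \<mu> B j * exp (- \<beta> * W)"
  using assms unfolding battery_levels_def is_battery_def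
  by (simp add: exp_add[symmetric] algebra_simps)

lemma sum_battery_comp:
  assumes "j < hdim B"
  shows "(\<Sum>x<hdim (sys R) * hdim B. h x * weight (R \<boxplus> battery_state B j) x)
    = (\<Sum>i<hdim (sys R). h (i * hdim B + j) * weight R i)"
  unfolding sum_mult_index
proof (intro sum.cong refl)
  fix i
  have "(\<Sum>l<hdim B. h (i * hdim B + l) * weight (R \<boxplus> battery_state B j) (i * hdim B + l))
    = (\<Sum>l<hdim B. if l = j then h (i * hdim B + j) * weight R i else 0)"
    using assms by (intro sum.cong) (auto simp: weight_state_comp weight_battery_state)
  thus "(\<Sum>l<hdim B. h (i * hdim B + l) * weight (R \<boxplus> battery_state B j) (i * hdim B + l))
    = h (i * hdim B + j) * weight R i" using assms by simp
qed

text \<open>Neyman-Pearson argument. The probability \<open>m i\<close> of reaching battery level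
  \<open>k\<close> from level \<open>i\<close> of \<open>R\<close> with battery level
  \<open>j\<close> is a test: it accepts the weights of \<open>R\<close> with probability at least
  \<open>1 - \<epsilon>\<close> and the Gibbs weights with probability at most
  \<open>exp (- \<beta> * W)\<close>. The two are compared at a free likelihood threshold
  \<open>exp K\<close>.\<close>

lemma gain_converse:
  assumes R: "is_state R" and B: "battery_levels \<beta> \<mu> \<kappa> \<delta> B j k W"
    and eq: "equilibrates_approx \<beta> \<mu> \<epsilon> (R \<boxplus> battery_state B j) (battery_state B k)"
  shows "1 - \<epsilon> \<le> (\<Sum>i | i < hdim (sys R) \<and> exp K * gibbs \<beta> \<mu> (sys R) i < weight R i. weight R i)
    + exp (K - \<beta> * W)"
proof -
  have j: "j < hdim B" and k: "k < hdim B" using B unfolding battery_levels_def by auto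
  let ?d = "hdim (sys R)" and ?b = "hdim B" and ?g = "gibbs \<beta> \<mu> (sys R)"
  have d: "0 < ?d" using R unfolding is_state_def by simp
  obtain M where M: "\<And>s x. 0 \<le> M s x"
    "\<And>x. x < ?d * ?b \<Longrightarrow> (\<Sum>s<?b. M s x) = 1"
    "\<And>s. s < ?b \<Longrightarrow> (\<Sum>x<?d * ?b. M s x * gibbs \<beta> \<mu> (sys R \<oplus>\<^sub>s B) x) = gibbs \<beta> \<mu> B s"
    "\<And>P. P \<subseteq> {..<?b} \<Longrightarrow> (\<Sum>s\<in>P. weight (battery_state B k) s) - \<epsilon>
       \<le> (\<Sum>s\<in>P. \<Sum>x<?d * ?b. M s x * weight (R \<boxplus> battery_state B j) x)"
    using equilibrates_approx_stochastic[OF eq is_state_comp[OF R is_state_battery[OF j]] is_state_battery[OF k]]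
    by auto
  define m where "m i = M k (i * ?b + j)" for i
  have m0: "0 \<le> m i" for i unfolding m_def by (rule M)
  have m1: "m i \<le> 1" if "i < ?d" for i
    using M(2)[OF index_mult_less[OF that j]] k member_le_sum[of k "{..<?b}" "\<lambda>s. M s (i * ?b + j)"] M(1)
    by (simp add: m_def)
  have gj: "0 < gibbs \<beta> \<mu> B j" using j by (intro gibbs_pos) simp
  \<comment> \<open>Of the nonnegative contributions to the Gibbs weight of output level
    \<open>k\<close>, only those from battery level \<open>j\<close> are kept.\<close>
  have "(\<Sum>i<?d. m i * ?g i) * gibbs \<beta> \<mu> B j = (\<Sum>i<?d. M k (i * ?b + j) * gibbs \<beta> \<mu> (sys R \<oplus>\<^sub>s B) (i * ?b + j))"
    unfolding sum_distrib_right using j by (intro sum.cong refl) (simp add: m_def gibbs_sys_comp mult_ac)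
  also have "\<dots> \<le> (\<Sum>i<?d. \<Sum>l<?b. M k (i * ?b + l) * gibbs \<beta> \<mu> (sys R \<oplus>\<^sub>s B) (i * ?b + l))"
    using j d by (intro sum_mono member_le_sum[of j "{..<?b}"]) (auto intro!: mult_nonneg_nonneg M(1) less_imp_le[OF gibbs_pos])
  also have "\<dots> = gibbs \<beta> \<mu> B j * exp (- \<beta> * W)"
    using M(3)[OF k] gibbs_battery_levels[OF B] unfolding sum_mult_index by simp
  finally have mg: "(\<Sum>i<?d. m i * ?g i) \<le> exp (- \<beta> * W)" using gj by (simp add: mult.commute)
  have "1 - \<epsilon> \<le> (\<Sum>i<?d. m i * weight R i)"
    using M(4)[of "{k}"] k sum_battery_comp[OF j, of "M k" R] by (simp add: weight_battery_state m_def)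
  \<comment> \<open>Above the threshold \<open>m i\<close> is bounded by \<open>1\<close>; below it
    the weight is bounded by \<open>exp K\<close> times the Gibbs weight.\<close>
  also have "\<dots> \<le> (\<Sum>i<?d. (if exp K * ?g i < weight R i then weight R i else 0) + exp K * (m i * ?g i))"
  proof (rule sum_mono)
    fix i assume "i \<in> {..<?d}"
    hence i: "i < ?d" by simp
    have r0: "0 \<le> weight R i" using R i unfolding is_state_def by simp
    show "m i * weight R i \<le> (if exp K * ?g i < weight R i then weight R i else 0) + exp K * (m i * ?g i)"
    proof (cases "exp K * ?g i < weight R i")
      case True
      have "m i * weight R i \<le> weight R i" using m1[OF i] m0 r0 by (simp add: mult_left_le_one_le)
      moreover have "0 \<le> exp K * (m i * ?g i)" using m0 gibbs_pos[OF d] by (simp add: less_imp_le)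
      ultimately show ?thesis using True by simp
    next
      case False
      thus ?thesis using mult_left_mono[of "weight R i" "exp K * ?g i" "m i"] m0 by (simp add: mult_ac)
    qed
  qed
  also have "\<dots> = (\<Sum>i | i < ?d \<and> exp K * ?g i < weight R i. weight R i) + exp K * (\<Sum>i<?d. m i * ?g i)"
    using sum.inter_filter[of "{..<?d}" "weight R" "\<lambda>i. exp K * ?g i < weight R i"]
    by (simp add: sum.distrib sum_distrib_left[symmetric])
  also have "\<dots> \<le> (\<Sum>i | i < ?d \<and> exp K * ?g i < weight R i. weight R i) + exp (K - \<beta> * W)"
    using mult_left_mono[OF mg, of "exp K"] by (simp add: exp_diff exp_minus field_simps)
  finally show ?thesis .
qed

text \<open>Dual to the gain bound. A single term of Gibbs preservation already shows that column
  \<open>k\<close> of \<open>M\<close>, at the indices with battery level \<open>j\<close>, is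
  dominated by \<open>exp (\<beta> * W)\<close> times the Gibbs weights of \<open>R\<close>. On the
  set of large likelihood ratio it thus has at most weight \<open>exp (\<beta> * W - K)\<close>,
  whereas the target requires the weight of that set up to \<open>\<epsilon>\<close>.\<close>

lemma cost_converse:
  assumes R: "is_state R" and B: "battery_levels \<beta> \<mu> \<kappa> \<delta> B j k W"
    and eq: "equilibrates_approx \<beta> \<mu> \<epsilon> (battery_state B k) (R \<boxplus> battery_state B j)"
  shows "(\<Sum>i | i < hdim (sys R) \<and> exp K * gibbs \<beta> \<mu> (sys R) i \<le> weight R i. weight R i)
    - \<epsilon> \<le> exp (\<beta> * W - K)"
proof -
  have j: "j < hdim B" and k: "k < hdim B" using B unfolding battery_levels_def by auto
  let ?d = "hdim (sys R)" and ?b = "hdim B" and ?g = "gibbs \<beta> \<mu> (sys R)"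
  have d: "0 < ?d" using R unfolding is_state_def by simp
  obtain M where M: "\<And>s x. 0 \<le> M s x"
    "\<And>x. x < ?b \<Longrightarrow> (\<Sum>s<?d * ?b. M s x) = 1"
    "\<And>s. s < ?d * ?b \<Longrightarrow> (\<Sum>x<?b. M s x * gibbs \<beta> \<mu> B x) = gibbs \<beta> \<mu> (sys R \<oplus>\<^sub>s B) s"
    "\<And>P. P \<subseteq> {..<?d * ?b} \<Longrightarrow> (\<Sum>s\<in>P. weight (R \<boxplus> battery_state B j) s) - \<epsilon>
       \<le> (\<Sum>s\<in>P. \<Sum>x<?b. M s x * weight (battery_state B k) x)"
    using equilibrates_approx_stochastic[OF eq is_state_battery[OF k] is_state_comp[OF R is_state_battery[OF j]]]
    by auto
  define I where "I = {i. i < ?d \<and> exp K * ?g i \<le> weight R i}"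
  define P where "P = (\<lambda>i. i * ?b + j) ` I"
  have inj: "inj_on (\<lambda>i. i * ?b + j) I" using j by (intro inj_onI) auto
  have P: "P \<subseteq> {..<?d * ?b}" unfolding P_def I_def using index_mult_less j by auto
  have gj: "0 < gibbs \<beta> \<mu> B j" using j by (intro gibbs_pos) simp
  have gk: "gibbs \<beta> \<mu> B k = gibbs \<beta> \<mu> B j * exp (- \<beta> * W)" by (rule gibbs_battery_levels[OF B])
  have Mk: "M (i * ?b + j) k \<le> ?g i * exp (\<beta> * W)" if "i < ?d" for i
  proof -
    have "M (i * ?b + j) k * gibbs \<beta> \<mu> B k \<le> (\<Sum>x<?b. M (i * ?b + j) x * gibbs \<beta> \<mu> B x)"
      using k by (intro member_le_sum[of k "{..<?b}"]) (auto intro!: mult_nonneg_nonneg M(1) less_imp_le[OF gibbs_pos])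
    also have "\<dots> = ?g i * gibbs \<beta> \<mu> B j"
      using M(3)[OF index_mult_less[OF that j]] j by (simp add: gibbs_sys_comp)
    finally show ?thesis using gj unfolding gk by (simp add: exp_minus field_simps)
  qed
  have "(\<Sum>i\<in>I. weight R i) - \<epsilon> \<le> (\<Sum>i\<in>I. M (i * ?b + j) k)"
    using M(4)[OF P] j k unfolding P_def sum.reindex[OF inj] o_def
    by (simp add: weight_state_comp weight_battery_state if_distrib[of "\<lambda>x. _ * x"] cong: if_cong)
  also have "\<dots> \<le> (\<Sum>i\<in>I. exp (\<beta> * W - K) * weight R i)"
  proof (rule sum_mono)
    fix i assume "i \<in> I"
    hence i: "i < ?d" "exp K * ?g i \<le> weight R i" unfolding I_def by auto
    have "?g i \<le> exp (- K) * weight R i" using i(2) by (simp add: exp_minus field_simps)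
    hence "?g i * exp (\<beta> * W) \<le> exp (- K) * weight R i * exp (\<beta> * W)" by (rule mult_right_mono) simp
    also have "\<dots> = exp (\<beta> * W - K) * weight R i" by (simp add: exp_diff exp_minus field_simps)
    finally show "M (i * ?b + j) k \<le> exp (\<beta> * W - K) * weight R i" using Mk[OF i(1)] by simp
  qed
  also have "\<dots> \<le> exp (\<beta> * W - K) * (\<Sum>i<?d. weight R i)"
    unfolding sum_distrib_left[symmetric] using R
    by (intro mult_left_mono sum_mono2) (auto simp: I_def is_state_def)
  also have "\<dots> = exp (\<beta> * W - K)" using R unfolding is_state_def by simp
  finally show ?thesis unfolding I_def .
qed

section \<open>Realising stochastic matrices by a finite bath\<close>

lemma fiberwise_injection:
  assumes "finite S" "finite T"
    and "\<And>x. x \<in> S \<Longrightarrow> card {z \<in> S. c z = c x} \<le> card {y \<in> T. c' y = c x}"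
  obtains f where "inj_on f S" "f ` S \<subseteq> T" "\<And>x. x \<in> S \<Longrightarrow> c' (f x) = c x"
proof -
  have "\<exists>h. inj_on h {z \<in> S. c z = v} \<and> h ` {z \<in> S. c z = v} \<subseteq> {y \<in> T. c' y = v}" if v: "v \<in> c ` S" for v
  proof -
    obtain x where x: "x \<in> S" "v = c x" using v by blast
    have "finite {z \<in> S. c z = v}" "finite {y \<in> T. c' y = v}" using assms(1,2) by simp_all
    from card_le_inj[OF this] assms(3)[OF x(1)] x(2)
    show ?thesis by blast
  qed
  then obtain h where h: "\<And>v. v \<in> c ` S \<Longrightarrow> inj_on (h v) {z \<in> S. c z = v}"
    "\<And>v. v \<in> c ` S \<Longrightarrow> h v ` {z \<in> S. c z = v} \<subseteq> {y \<in> T. c' y = v}"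
    using bchoice[of "c ` S" "\<lambda>v h. inj_on h {z \<in> S. c z = v} \<and> h ` {z \<in> S. c z = v} \<subseteq> {y \<in> T. c' y = v}"] by blast
  have m: "h (c x) x \<in> T" "c' (h (c x) x) = c x" if "x \<in> S" for x
    using h(2)[of "c x"] that by auto
  show ?thesis
  proof (rule that[of "\<lambda>x. h (c x) x"])
    show "inj_on (\<lambda>x. h (c x) x) S"
    proof (rule inj_onI)
      fix x y assume xy: "x \<in> S" "y \<in> S" "h (c x) x = h (c y) y"
      hence "c x = c y" using m(2) by metis
      thus "x = y" using xy inj_onD[OF h(1)[of "c x"], of x y] by simp
    qed
  qed (use m in auto)
qed

text \<open>Deleting \<open>D\<close> and its image removes equally many points from every class of
  \<open>c\<close>, so the remainders can be matched class by class. An operation may therefore be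
  prescribed on \<open>D\<close> only and still be reversible.\<close>

lemma extend_injection_to_permutation:
  assumes fin: "finite \<Omega>" and D: "D \<subseteq> \<Omega>" and f: "inj_on f D" "f ` D \<subseteq> \<Omega>"
    and c: "\<And>x. x \<in> D \<Longrightarrow> c (f x) = c x"
  obtains p where "bij_betw p \<Omega> \<Omega>" "\<And>x. x \<in> D \<Longrightarrow> p x = f x" "\<And>x. x \<in> \<Omega> \<Longrightarrow> c (p x) = c x"
proof -
  have "card {z \<in> \<Omega> - D. c z = v} = card {y \<in> \<Omega> - f ` D. c y = v}" for v
  proof -
    have e: "{z \<in> \<Omega> - D. c z = v} = {z \<in> \<Omega>. c z = v} - {z \<in> D. c z = v}"
      "{y \<in> \<Omega> - f ` D. c y = v} = {z \<in> \<Omega>. c z = v} - f ` {z \<in> D. c z = v}" using c by auto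
    have "card (f ` {z \<in> D. c z = v}) = card {z \<in> D. c z = v}"
      by (rule card_image) (use f in \<open>auto simp: inj_on_def\<close>)
    moreover have "f ` {z \<in> D. c z = v} \<subseteq> {z \<in> \<Omega>. c z = v}" using f c by auto
    moreover have "{z \<in> D. c z = v} \<subseteq> {z \<in> \<Omega>. c z = v}" using D by auto
    ultimately show ?thesis unfolding e using fin
      by (simp add: card_Diff_subset finite_subset[of _ "{z \<in> \<Omega>. c z = v}"])
  qed
  then obtain h where h: "inj_on h (\<Omega> - D)" "h ` (\<Omega> - D) \<subseteq> \<Omega> - f ` D" "\<And>x. x \<in> \<Omega> - D \<Longrightarrow> c (h x) = c x"
    using fiberwise_injection[of "\<Omega> - D" "\<Omega> - f ` D" c c] fin by auto
  define p where "p x = (if x \<in> D then f x else h x)" for x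
  have "inj_on p \<Omega>"
  proof (rule inj_onI)
    fix x y assume "x \<in> \<Omega>" "y \<in> \<Omega>" "p x = p y"
    moreover have "h z \<notin> f ` D" if "z \<in> \<Omega>" "z \<notin> D" for z using h(2) that by blast
    ultimately show "x = y" using inj_onD[OF h(1), of x y] inj_onD[OF f(1), of x y] unfolding p_def
      by (cases "x \<in> D"; cases "y \<in> D") (simp_all, metis imageI, metis imageI)
  qed
  moreover have "p ` \<Omega> \<subseteq> \<Omega>" using h(2) f(2) unfolding p_def by auto
  ultimately have "bij_betw p \<Omega> \<Omega>" using endo_inj_surj[OF fin] unfolding bij_betw_def by auto
  thus ?thesis using that[of p] h(3) c unfolding p_def by auto
qed

lemma bij_betw_triple_index:
  fixes a b c :: nat
  assumes bk: "bij_betw bk {..<c} K"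
  shows "bij_betw (\<lambda>n. (n div (b*c), n mod (b*c) div c, bk (n mod (b*c) mod c))) {..<a*(b*c)} ({..<a} \<times> {..<b} \<times> K)"
    (is "bij_betw ?f _ _")
proof (rule bij_betw_imageI)
  show "inj_on ?f {..<a*(b*c)}"
  proof (rule inj_onI)
    fix m n assume m: "m \<in> {..<a*(b*c)}" and "?f m = ?f n"
    hence e: "m div (b*c) = n div (b*c)" "m mod (b*c) div c = n mod (b*c) div c"
      "bk (m mod (b*c) mod c) = bk (n mod (b*c) mod c)" by auto
    have "0 < c" using m by (cases c) auto
    hence "m mod (b*c) mod c = n mod (b*c) mod c"
      using e(3) inj_onD[OF bij_betw_imp_inj_on[OF bk]] by (metis lessThan_iff mod_less_divisor)
    thus "m = n" using e by (metis mult_div_mod_eq)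
  qed
  show "?f ` {..<a*(b*c)} = {..<a} \<times> {..<b} \<times> K"
  proof (intro equalityI subsetI)
    fix z assume "z \<in> ?f ` {..<a*(b*c)}"
    then obtain n where n: "n < a*(b*c)" "z = ?f n" by auto
    hence "0 < b" "0 < c" by (cases b; cases c; simp)+
    hence "n div (b*c) < a" "n mod (b*c) div c < b" "n mod (b*c) mod c < c"
      using n(1) by (auto simp: less_mult_imp_div_less)
    thus "z \<in> {..<a} \<times> {..<b} \<times> K" using n(2) bk by (auto simp: bij_betw_def)
  next
    fix z assume "z \<in> {..<a} \<times> {..<b} \<times> K"
    then obtain i j l where z: "z = (i, j, bk l)" and l: "i < a" "j < b" "l < c"
      using bk by (auto simp: bij_betw_def)
    have jl: "j * c + l < b * c" using index_mult_less l by blast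
    have "z = ?f (i * (b*c) + (j * c + l))" using jl l z by simp
    moreover have "i * (b*c) + (j * c + l) < a * (b*c)" using index_mult_less l jl by blast
    ultimately show "z \<in> ?f ` {..<a*(b*c)}" by blast
  qed
qed

section \<open>Permutations of basis states as equilibrating operations\<close>

definition perm_mat :: "nat \<Rightarrow> (nat \<Rightarrow> nat) \<Rightarrow> complex mat" where
  "perm_mat d p = mat d d (\<lambda>(a, b). if a = p b then 1 else 0)"

lemma perm_mat_conj_diag:
  assumes p: "bij_betw p {..<d} {..<d}" and g: "\<And>b. b < d \<Longrightarrow> g (p b) = f b"
  shows "perm_mat d p * mat_diag d f * mat_adjoint (perm_mat d p) = mat_diag d g"
proof (rule eq_matI)
  have J[simp]: "perm_mat d p \<in> carrier_mat d d" unfolding perm_mat_def by simp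
  fix a a' assume "a < dim_row (mat_diag d g)" "a' < dim_col (mat_diag d g)"
  hence a: "a < d" "a' < d" by (auto simp: mat_diag_def)
  have "(perm_mat d p * mat_diag d f * mat_adjoint (perm_mat d p)) $$ (a, a')
    = (\<Sum>b<d. (perm_mat d p * mat_diag d f) $$ (a, b) * mat_adjoint (perm_mat d p) $$ (b, a'))"
    by (rule mat_mult_index[of _ d d _ d]) (use a in auto)
  also have "\<dots> = (\<Sum>b<d. (\<lambda>e. if e = a then if a = a' then g a else 0 else 0) (p b))"
  proof (intro sum.cong refl)
    fix b assume "b \<in> {..<d}"
    hence b: "b < d" by simp
    have "(perm_mat d p * mat_diag d f) $$ (a, b) * mat_adjoint (perm_mat d p) $$ (b, a')
      = perm_mat d p $$ (a, b) * f b * cnj (perm_mat d p $$ (a', b))"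
      using a b by (simp add: mat_diag_mult_right[of _ d d] mat_adjoint_index[of _ d])
    thus "(perm_mat d p * mat_diag d f) $$ (a, b) * mat_adjoint (perm_mat d p) $$ (b, a')
      = (\<lambda>e. if e = a then if a = a' then g a else 0 else 0) (p b)"
      using a b g[OF b] by (auto simp: perm_mat_def)
  qed
  also have "\<dots> = (\<Sum>e<d. if e = a then if a = a' then g a else 0 else 0)"
    by (rule sum.reindex_bij_betw[OF p])
  finally show "(perm_mat d p * mat_diag d f * mat_adjoint (perm_mat d p)) $$ (a, a') = mat_diag d g $$ (a, a')"
    using a by (simp add: mat_diag_def)
qed (auto simp: perm_mat_def mat_diag_def)

lemma is_unitary_perm_mat:
  assumes p: "bij_betw p {..<d} {..<d}"
  shows "is_unitary d (perm_mat d p)"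
proof -
  have J[simp]: "perm_mat d p \<in> carrier_mat d d" unfolding perm_mat_def by simp
  have "perm_mat d p * mat_adjoint (perm_mat d p) = 1\<^sub>m d"
    using perm_mat_conj_diag[OF p, of "\<lambda>_. 1" "\<lambda>_. 1"] by (simp add: right_mult_one_mat[of _ d d])
  thus ?thesis using mat_mult_left_right_inverse[of "perm_mat d p" d] unfolding is_unitary_def by auto
qed

text \<open>The bath is a Gibbs copy of the output system \<open>S\<close> together with the
  register \<open>K\<close>. After \<open>p\<close> the \<open>S\<close> component is kept, while
  the \<open>X\<close> and \<open>K\<close> components are discarded. The identification
  \<open>J\<close> may be any unitary that matches the total operators, so \<open>p\<close> is put
  into \<open>J\<close> along with the reordering of factors, and \<open>U\<close> is the
  identity.\<close>

lemma equilibrates_permutation: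
  fixes K :: "'k set" and eK nK :: "'k \<Rightarrow> real" and \<beta> \<mu> :: real
  assumes X: "0 < hdim (sys X)" and S: "0 < hdim S" and K: "finite K" "K \<noteq> {}"
  defines "\<Omega> \<equiv> {..<hdim (sys X)} \<times> {..<hdim S} \<times> K"
  defines "g \<equiv> \<lambda>k. exp (- \<beta> * (eK k - \<mu> * nK k)) / (\<Sum>k\<in>K. exp (- \<beta> * (eK k - \<mu> * nK k)))"
  assumes p: "bij_betw p \<Omega> \<Omega>"
    and en: "\<And>x s k x' s' k'. (x, s, k) \<in> \<Omega> \<Longrightarrow> p (x, s, k) = (x', s', k') \<Longrightarrow>
      energy (sys X) x + energy S s + eK k = energy (sys X) x' + energy S s' + eK k' \<and>
      number (sys X) x + number S s + nK k = number (sys X) x' + number S s' + nK k'"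
  shows "equilibrates \<beta> \<mu> X S (mat_diag (hdim S) (\<lambda>t. complex_of_real
    (\<Sum>(x, s, k)\<in>{\<omega>\<in>\<Omega>. fst (snd (p \<omega>)) = t}. weight X x * gibbs \<beta> \<mu> S s * g k)))"
proof -
  let ?dX = "hdim (sys X)" and ?dS = "hdim S"
  define dK where "dK = card K"
  have dK: "0 < dK" unfolding dK_def using K by (simp add: card_gt_0_iff)
  obtain bk where bk: "bij_betw bk {..<dK} K"
    using ex_bij_betw_nat_finite[OF K(1)] unfolding dK_def atLeast0LessThan by blast
  define KS where "KS = \<lparr>hdim = dK, energy = eK \<circ> bk, number = nK \<circ> bk\<rparr>"
  have hK[simp]: "hdim KS = dK" unfolding KS_def by simp
  define G where "G = S \<oplus>\<^sub>s KS"
  define T where "T = sys X \<oplus>\<^sub>s KS"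
  define A where "A = X \<boxplus> equilibrium \<beta> \<mu> G"
  define d where "d = hdim (sys A)"
  have d1: "d = ?dX * (?dS * dK)" and d2: "d = ?dS * (?dX * dK)"
    unfolding d_def A_def G_def by simp_all
  have hT[simp]: "hdim T = ?dX * dK" unfolding T_def by simp
  define dec1 where "dec1 n = (n div (?dS*dK), n mod (?dS*dK) div dK, bk (n mod (?dS*dK) mod dK))" for n
  define dec2 where "dec2 n = (n div (?dX*dK), n mod (?dX*dK) div dK, bk (n mod (?dX*dK) mod dK))" for n
  have b1: "bij_betw dec1 {..<d} \<Omega>" unfolding dec1_def d1 \<Omega>_def by (rule bij_betw_triple_index[OF bk])
  have b2: "bij_betw dec2 {..<d} ({..<?dS} \<times> {..<?dX} \<times> K)"
    unfolding dec2_def d2 by (rule bij_betw_triple_index[OF bk])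
  define sw :: "nat \<times> nat \<times> 'k \<Rightarrow> nat \<times> nat \<times> 'k" where "sw = (\<lambda>(x, s, k). (s, x, k))"
  have bs: "bij_betw sw \<Omega> ({..<?dS} \<times> {..<?dX} \<times> K)"
    unfolding \<Omega>_def by (auto simp: sw_def bij_betw_def inj_on_def image_iff)
  \<comment> \<open>\<open>dec1\<close> reads an index in the input order \<open>X\<close>,
    \<open>S\<close>, \<open>K\<close>, and \<open>dec2\<close> in the output order
    \<open>S\<close>, \<open>X\<close>, \<open>K\<close>; \<open>\<phi>\<close> is \<open>p\<close>
    expressed between these two coordinates.\<close>
  define \<phi> where "\<phi> = inv_into {..<d} dec2 \<circ> (sw \<circ> (p \<circ> dec1))"
  have b\<phi>: "bij_betw \<phi> {..<d} {..<d}" unfolding \<phi>_def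
    by (rule bij_betw_trans[OF bij_betw_trans[OF bij_betw_trans[OF b1 p] bs] bij_betw_inv_into[OF b2]])
  have dec\<phi>: "dec2 (\<phi> b) = sw (p (dec1 b))" if "b < d" for b
  proof -
    have "sw (p (dec1 b)) \<in> {..<?dS} \<times> {..<?dX} \<times> K"
      using that b1 p bs by (auto simp: bij_betw_def)
    thus ?thesis unfolding \<phi>_def using b2 by (simp add: bij_betw_inv_into_right)
  qed
  have eA: "energy (sys A) b = (case dec1 b of (x, s, k) \<Rightarrow> energy (sys X) x + energy S s + eK k)"
    "number (sys A) b = (case dec1 b of (x, s, k) \<Rightarrow> number (sys X) x + number S s + nK k)" for b
    unfolding A_def G_def dec1_def KS_def by (simp_all add: sys_comp_def)
  have eT: "energy (S \<oplus>\<^sub>s T) b = (case dec2 b of (s, x, k) \<Rightarrow> energy (sys X) x + energy S s + eK k)"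
    "number (S \<oplus>\<^sub>s T) b = (case dec2 b of (s, x, k) \<Rightarrow> number (sys X) x + number S s + nK k)" for b
    unfolding T_def dec2_def KS_def by (simp_all add: sys_comp_def)
  have cons: "energy (S \<oplus>\<^sub>s T) (\<phi> b) = energy (sys A) b" "number (S \<oplus>\<^sub>s T) (\<phi> b) = number (sys A) b"
    if b: "b < d" for b
  proof -
    obtain x s k where o: "dec1 b = (x, s, k)" by (cases "dec1 b")
    obtain x' s' k' where o': "p (x, s, k) = (x', s', k')" by (cases "p (x, s, k)")
    have "(x, s, k) \<in> \<Omega>" using b1 b o by (metis bij_betwE lessThan_iff)
    from en[OF this o'] show "energy (S \<oplus>\<^sub>s T) (\<phi> b) = energy (sys A) b" "number (S \<oplus>\<^sub>s T) (\<phi> b) = number (sys A) b"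
      unfolding eA eT dec\<phi>[OF b] o by (simp_all add: o' sw_def)
  qed
  have gK: "gibbs \<beta> \<mu> KS (n mod dK) = g (bk (n mod dK))" for n
  proof -
    have "(\<Sum>k<dK. exp (- \<beta> * (eK (bk k) - \<mu> * nK (bk k)))) = (\<Sum>k\<in>K. exp (- \<beta> * (eK k - \<mu> * nK k)))"
      by (rule sum.reindex_bij_betw[OF bk])
    thus ?thesis unfolding gibbs_def g_def by (simp add: KS_def)
  qed
  define w where "w = (\<lambda>(x, s, k). weight X x * gibbs \<beta> \<mu> S s * g k)"
  have wA: "weight A b = w (dec1 b)" for b
    unfolding A_def G_def w_def dec1_def by (simp add: weight_state_comp gibbs_sys_comp gK)
  define J where "J = perm_mat d \<phi>"
  have J: "is_unitary d J" unfolding J_def by (rule is_unitary_perm_mat[OF b\<phi>])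
  have JH: "J * hamiltonian (sys A) * mat_adjoint J = hamiltonian (S \<oplus>\<^sub>s T)"
    and JN: "J * number_op (sys A) * mat_adjoint J = number_op (S \<oplus>\<^sub>s T)"
    unfolding J_def hamiltonian_def number_op_def d_def[symmetric] hdim_sys_comp hT d2[symmetric]
    by (intro perm_mat_conj_diag[OF b\<phi>]; simp add: cons)+
  define q where "q a = w (dec1 (inv_into {..<d} \<phi> a))" for a
  have q: "q (\<phi> b) = w (dec1 b)" if "b < d" for b
    unfolding q_def using b\<phi> that by (simp add: bij_betw_inv_into_left)
  have J\<rho>: "J * density A * mat_adjoint J = mat_diag d (\<lambda>a. complex_of_real (q a))"
    unfolding J_def density_def d_def[symmetric] by (intro perm_mat_conj_diag[OF b\<phi>]) (simp add: q wA)
  \<comment> \<open>The indices with kept level \<open>t\<close> form the block of quotient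
    \<open>t\<close>; pulled back along \<open>\<phi>\<close> and \<open>dec1\<close>, the block
    becomes a set of triples determined by \<open>p\<close>.\<close>
  have out: "(\<Sum>k<?dX*dK. q (t * (?dX*dK) + k)) = (\<Sum>\<omega>\<in>{\<omega>\<in>\<Omega>. fst (snd (p \<omega>)) = t}. w \<omega>)" if t: "t < ?dS" for t
  proof -
    have "(\<Sum>k<?dX*dK. q (t * (?dX*dK) + k))
      = (\<Sum>i<?dS. if i = t then \<Sum>k<?dX*dK. q (i * (?dX*dK) + k) else 0)" using t by simp
    also have "\<dots> = (\<Sum>a<d. if a div (?dX*dK) = t then q a else 0)"
      unfolding d2 sum_mult_index[of _ ?dS]
    proof (intro sum.cong refl)
      fix i
      have "(i * n + k) div n = i" if "k < n" for n k :: nat using that by simp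
      from this[of _ "?dX*dK"] show "(if i = t then \<Sum>k<?dX*dK. q (i * (?dX*dK) + k) else 0)
        = (\<Sum>k<?dX*dK. if (i * (?dX*dK) + k) div (?dX*dK) = t then q (i * (?dX*dK) + k) else 0)"
        by (auto intro!: sum.cong sum.neutral[symmetric])
    qed
    also have "\<dots> = (\<Sum>b<d. if \<phi> b div (?dX*dK) = t then q (\<phi> b) else 0)"
      by (rule sum.reindex_bij_betw[OF b\<phi>, symmetric])
    also have "\<dots> = (\<Sum>b<d. (\<lambda>\<omega>. if fst (snd (p \<omega>)) = t then w \<omega> else 0) (dec1 b))"
    proof (intro sum.cong refl)
      fix b assume "b \<in> {..<d}"
      hence b: "b < d" by simp
      have "\<phi> b div (?dX*dK) = fst (snd (p (dec1 b)))"
        using dec\<phi>[OF b] unfolding dec2_def sw_def by (auto split: prod.splits)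
      thus "(if \<phi> b div (?dX*dK) = t then q (\<phi> b) else 0) = (\<lambda>\<omega>. if fst (snd (p \<omega>)) = t then w \<omega> else 0) (dec1 b)"
        using q[OF b] by simp
    qed
    also have "\<dots> = (\<Sum>\<omega>\<in>\<Omega>. if fst (snd (p \<omega>)) = t then w \<omega> else 0)"
      by (rule sum.reindex_bij_betw[OF b1])
    also have "\<dots> = (\<Sum>\<omega>\<in>{\<omega>\<in>\<Omega>. fst (snd (p \<omega>)) = t}. w \<omega>)"
      using K by (intro sum.inter_filter[symmetric]) (simp add: \<Omega>_def)
    finally show ?thesis .
  qed
  have pt: "mat_diag ?dS (\<lambda>t. complex_of_real (\<Sum>\<omega>\<in>{\<omega>\<in>\<Omega>. fst (snd (p \<omega>)) = t}. w \<omega>))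
    = partial_trace ?dS (hdim T) (mat_diag d (\<lambda>a. complex_of_real (q a)))"
  proof (rule eq_matI)
    fix i j assume "i < dim_row (partial_trace ?dS (hdim T) (mat_diag d (\<lambda>a. complex_of_real (q a))))"
      "j < dim_col (partial_trace ?dS (hdim T) (mat_diag d (\<lambda>a. complex_of_real (q a))))"
    hence ij: "i < ?dS" "j < ?dS" by (auto simp: partial_trace_def)
    have lt: "t * (?dX*dK) + k < d" if "t < ?dS" "k < ?dX*dK" for t k
      unfolding d2 by (rule index_mult_less[OF that])
    have "partial_trace ?dS (hdim T) (mat_diag d (\<lambda>a. complex_of_real (q a))) $$ (i, j)
      = (\<Sum>k<?dX*dK. if i = j then complex_of_real (q (i * (?dX*dK) + k)) else 0)"
      using ij lt X dK by (auto simp: partial_trace_def mat_diag_def intro!: sum.cong)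
    also have "\<dots> = (if i = j then complex_of_real (\<Sum>k<?dX*dK. q (i * (?dX*dK) + k)) else 0)" by simp
    finally show "mat_diag ?dS (\<lambda>t. complex_of_real (\<Sum>\<omega>\<in>{\<omega>\<in>\<Omega>. fst (snd (p \<omega>)) = t}. w \<omega>)) $$ (i, j)
      = partial_trace ?dS (hdim T) (mat_diag d (\<lambda>a. complex_of_real (q a))) $$ (i, j)"
      using ij out by (simp add: mat_diag_def del: of_real_sum)
  qed (auto simp: partial_trace_def mat_diag_def)
  have one: "mat_adjoint (1\<^sub>m d) = (1\<^sub>m d :: complex mat)"
    by (rule eq_matI) (auto simp: mat_adjoint_index[of _ d])
  have c: "density A \<in> carrier_mat d d" "hamiltonian (sys A) \<in> carrier_mat d d" "number_op (sys A) \<in> carrier_mat d d"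
    unfolding density_def hamiltonian_def number_op_def d_def by auto
  show ?thesis unfolding equilibrates_def Let_def w_def[symmetric]
  proof (rule exI[of _ G], rule exI[of _ T], rule exI[of _ "1\<^sub>m d"], rule exI[of _ J], fold A_def d_def, intro conjI)
    show "0 < hdim G" unfolding G_def using S dK by simp
    show "?dS * hdim T = d" using d2 by simp
    show "mat_diag ?dS (\<lambda>t. complex_of_real (sum w {\<omega> \<in> \<Omega>. fst (snd (p \<omega>)) = t})) =
      partial_trace ?dS (hdim T) (J * (1\<^sub>m d * density A * mat_adjoint (1\<^sub>m d)) * mat_adjoint J)"
      unfolding pt J\<rho>[symmetric] one using c by (simp add: right_mult_one_mat[of _ d d] left_mult_one_mat[of _ d d])
  qed (use c J JH JN is_unitary_one in \<open>auto simp: right_mult_one_mat[of _ d d] left_mult_one_mat[of _ d d]\<close>)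
qed

text \<open>Rounding \<open>a s * n\<close> down gives block sizes \<open>N s\<close>; the blocks
  fit disjointly into \<open>n\<close> slots because the frequencies sum to at most
  \<open>1\<close>. The label \<open>None\<close> marks the slots left over by rounding and by a
  deficit of that sum.\<close>

lemma labelling_with_frequencies:
  fixes a :: "nat \<Rightarrow> real" and n d :: nat
  assumes "\<And>s. s < d \<Longrightarrow> 0 \<le> a s" "(\<Sum>s<d. a s) \<le> 1"
  shows "\<exists>h :: nat \<Rightarrow> nat option. (\<forall>s<d. real (card {u. u < n \<and> h u = Some s}) \<le> a s * n \<and>
    a s * n - 1 \<le> real (card {u. u < n \<and> h u = Some s})) \<and> (\<forall>u s. h u = Some s \<longrightarrow> s < d)"
proof -
  define N where "N s = nat \<lfloor>a s * n\<rfloor>" for s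
  have N: "real (N s) \<le> a s * n" "a s * n - 1 \<le> real (N s)" if "s < d" for s
    using assms(1)[OF that] unfolding N_def by (simp, linarith)
  let ?S = "SIGMA s:{..<d}. {..<N s}"
  have "real (card ?S) \<le> (\<Sum>s<d. a s * n)"
    using N(1) by (auto simp: card_SigmaI of_nat_sum intro!: sum_mono)
  also have "\<dots> \<le> 1 * real n" unfolding sum_distrib_right[symmetric] by (rule mult_right_mono[OF assms(2)]) simp
  finally have "real (card ?S) \<le> real n" by simp
  hence "card ?S \<le> card {..<n}" by (simp only: of_nat_le_iff card_lessThan)
  then obtain f where f: "f ` ?S \<subseteq> {..<n}" "inj_on f ?S"
    using card_le_inj[of ?S "{..<n}"] by auto
  define h where "h u = (if u \<in> f ` ?S then Some (fst (the_inv_into ?S f u)) else None)" for u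
  have hf: "h (f z) = Some (fst z)" if "z \<in> ?S" for z
    using that the_inv_into_f_f[OF f(2) that] unfolding h_def by simp
  have "{u. u < n \<and> h u = Some s} = f ` ({s} \<times> {..<N s})" if "s < d" for s
  proof (intro equalityI subsetI)
    fix u assume "u \<in> {u. u < n \<and> h u = Some s}"
    hence u: "h u = Some s" by simp
    then obtain z where z: "z \<in> ?S" "u = f z" unfolding h_def by (auto split: if_splits)
    hence "fst z = s" using hf u by simp
    thus "u \<in> f ` ({s} \<times> {..<N s})" using z by auto
  next
    fix u assume "u \<in> f ` ({s} \<times> {..<N s})"
    then obtain b where "b < N s" "u = f (s, b)" by auto
    moreover from this have "(s, b) \<in> ?S" using that by simp
    ultimately show "u \<in> {u. u < n \<and> h u = Some s}" using hf[of "(s, b)"] f(1) by auto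
  qed
  moreover have "card (f ` ({s} \<times> {..<N s})) = N s" if "s < d" for s
    using that by (subst card_image) (auto intro: inj_on_subset[OF f(2)])
  ultimately have c: "card {u. u < n \<and> h u = Some s} = N s" if "s < d" for s using that by simp
  have "s < d" if "h u = Some s" for u s
  proof -
    have "u \<in> f ` ?S" using that unfolding h_def by (metis option.distinct(1))
    then obtain z where z: "z \<in> ?S" "u = f z" by blast
    thus ?thesis using hf[OF z(1)] that by auto
  qed
  thus ?thesis using c N by (intro exI[of _ h]) auto
qed

text \<open>Bernoulli's inequality for the power \<open>card Q\<close> of \<open>1 - 2 / L\<close>:
  trimming one value at each end of every coordinate loses at most the fraction
  \<open>2 * card Q / L\<close>.\<close>

lemma card_inner_box_ge:
  fixes L :: nat
  assumes "finite Q" "3 \<le> L"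
  shows "(1 - 2 * real (card Q) / L) * real (card (PiE Q (\<lambda>_. {..<L}))) \<le> real (card (PiE Q (\<lambda>_. {1..<L-1})))"
proof -
  have "1 + real (card Q) * (- 2 / L) \<le> (1 + (- 2 / real L)) ^ card Q"
    using assms(2) by (intro Bernoulli_inequality) (simp add: field_simps)
  hence "(1 - 2 * real (card Q) / L) * real L ^ card Q \<le> (1 + (- 2 / real L)) ^ card Q * real L ^ card Q"
    by (intro mult_right_mono) (simp_all add: mult.commute)
  also have "\<dots> = ((1 + (- 2 / real L)) * real L) ^ card Q" by (rule power_mult_distrib[symmetric])
  also have "(1 + (- 2 / real L)) * real L = real (L - 2)" using assms(2) by (simp add: field_simps of_nat_diff)
  finally show ?thesis using assms by (simp add: card_PiE)
qed

text \<open>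
  The bath has a level \<open>(m, y, u)\<close> for every occupation \<open>m\<close> of the levels of \<open>X\<close> and \<open>S\<close>, with
  energy and particle number the sums over the occupied levels. The degeneracy index \<open>y < D m\<close> makes
  all occupations equally likely up to a factor \<open>2\<close>, so that within a sector of fixed total
  occupation the states containing the level \<open>x\<close> of \<open>X\<close> form a fraction of order \<open>g\<^sub>X x\<close>. The
  register \<open>u\<close> decides, through \<open>h x u\<close>, to which level of \<open>S\<close> the level \<open>x\<close> is sent. Only
  occupations at the boundary of the box are lost.
\<close>

locale bath =
  fixes \<beta> \<mu> :: real and X :: state and S :: system and L n :: nat and h :: "nat \<Rightarrow> nat \<Rightarrow> nat option"
  assumes X: "is_state X" and S: "0 < hdim S" and L: "3 \<le> L" and n: "0 < n"
    and h: "\<And>x u s. h x u = Some s \<Longrightarrow> s < hdim S"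
begin

abbreviation "dX \<equiv> hdim (sys X)"
abbreviation "dS \<equiv> hdim S"
abbreviation "wX \<equiv> boltzmann \<beta> \<mu> (sys X)"
abbreviation "wS \<equiv> boltzmann \<beta> \<mu> S"

definition "Q = {..<dX} <+> {..<dS}"
definition "eQ = case_sum (energy (sys X)) (energy S)"
definition "nQ = case_sum (number (sys X)) (number S)"
definition om :: "(nat + nat \<Rightarrow> nat) \<Rightarrow> real" where
  "om c = exp (- \<beta> * ((\<Sum>q\<in>Q. real (c q) * eQ q) - \<mu> * (\<Sum>q\<in>Q. real (c q) * nQ q)))"
definition "Box = PiE Q (\<lambda>_. {..<L})"
text \<open>One unit of room at each end of every mode, so that a quantum can be added or removed
  without leaving \<open>Box\<close>.\<close>

definition "Good = PiE Q (\<lambda>_. {1..<L-1})"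
text \<open>Any common upper bound of the \<open>om m\<close> would serve: it makes
  \<open>C / om m\<close> at least \<open>1\<close>, so rounding up at most doubles it and
  \<open>D m * om m\<close> lies between \<open>C\<close> and \<open>2 * C\<close>.\<close>

definition "C = (\<Sum>m\<in>Box. om m)"
definition "D m = nat \<lceil>C / om m\<rceil>"
definition "K = (SIGMA m:Box. {..<D m} \<times> {..<n})"
definition "eK k = (\<Sum>q\<in>Q. real (fst k q) * eQ q)" for k :: "(nat + nat \<Rightarrow> nat) \<times> nat \<times> nat"
definition "nK k = (\<Sum>q\<in>Q. real (fst k q) * nQ q)" for k :: "(nat + nat \<Rightarrow> nat) \<times> nat \<times> nat"
text \<open>A level \<open>x\<close> of \<open>X\<close> and a level \<open>s\<close> of
  \<open>S\<close> count as one further quantum in the modes \<open>Inl x\<close> and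
  \<open>Inr s\<close>; the result is the total occupation of the composite, the conserved quantity
  behind \<open>F\<close>.\<close>

definition shift :: "(nat + nat \<Rightarrow> nat) \<Rightarrow> nat \<Rightarrow> nat \<Rightarrow> nat + nat \<Rightarrow> nat" where
  "shift m x s = (\<lambda>q. m q + (if q = Inl x then 1 else 0) + (if q = Inr s then 1 else 0))"
definition unshift :: "(nat + nat \<Rightarrow> nat) \<Rightarrow> nat \<Rightarrow> nat \<Rightarrow> nat + nat \<Rightarrow> nat" where
  "unshift c x s = (\<lambda>q. c q - (if q = Inl x then 1 else 0) - (if q = Inr s then 1 else 0))"
definition "\<Omega> = {..<dX} \<times> {..<dS} \<times> K"
definition "F = (\<lambda>(x, s, k :: (nat + nat \<Rightarrow> nat) \<times> nat \<times> nat). shift (fst k) x s)"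
text \<open>The level of \<open>S\<close> that the register \<open>u\<close> prescribes. The value
  of \<open>the None\<close> is harmless because \<open>lab\<close> is evaluated on
  \<open>Dom\<close> only.\<close>

definition "lab = (\<lambda>(x, s :: nat, k :: (nat + nat \<Rightarrow> nat) \<times> nat \<times> nat). the (h x (snd (snd k))))"
definition "Dom = {(x, s, k) \<in> \<Omega>. fst k \<in> Good \<and> h x (snd (snd k)) \<noteq> None}"

section \<open>Boltzmann weights and degeneracies of the occupation bath\<close>

lemma finQ [simp]: "finite Q" unfolding Q_def by simp

lemma finBox [simp]: "finite Box" unfolding Box_def by (intro finite_PiE) auto

lemma Good_Box: "Good \<subseteq> Box" unfolding Good_def Box_def by (intro PiE_mono) auto

lemma finK [simp]: "finite K" unfolding K_def by auto

lemma fin\<Omega> [simp]: "finite \<Omega>" unfolding \<Omega>_def by auto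

lemma om_pos [simp]: "0 < om m" unfolding om_def by simp

lemma om_le_C: "m \<in> Box \<Longrightarrow> om m \<le> C"
  unfolding C_def by (intro member_le_sum) (auto simp: less_imp_le)

lemma Box_nonempty: "Box \<noteq> {}" unfolding Box_def using L by (auto simp: PiE_eq_empty_iff lessThan_empty_iff)

lemma C_pos: "0 < C"
  using Box_nonempty om_le_C om_pos by (meson all_not_in_conv less_le_trans)

lemma D_lower: "C / om m \<le> D m"
  unfolding D_def by (simp add: real_nat_ceiling_ge)

lemma D_upper:
  assumes "m \<in> Box"
  shows "D m \<le> 2 * C / om m"
proof -
  have "1 \<le> C / om m" using om_le_C[OF assms] by simp
  moreover have "real (D m) \<le> C / om m + 1"
    unfolding D_def using C_pos by (simp add: of_nat_ceiling less_imp_le)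
  moreover have "2 * C / om m = C / om m + C / om m" by simp
  ultimately show ?thesis by linarith
qed

lemma sum_shift:
  assumes "x < dX" "s < dS"
  shows "(\<Sum>q\<in>Q. real (shift m x s q) * f q) = (\<Sum>q\<in>Q. real (m q) * f q) + f (Inl x) + f (Inr s)"
proof -
  have "(\<Sum>q\<in>Q. real (shift m x s q) * f q) = (\<Sum>q\<in>Q. real (m q) * f q + (if q = Inl x then f q else 0) + (if q = Inr s then f q else 0))"
    by (intro sum.cong) (auto simp: shift_def algebra_simps)
  also have "\<dots> = (\<Sum>q\<in>Q. real (m q) * f q) + f (Inl x) + f (Inr s)"
    using assms by (simp add: sum.distrib, auto simp: Q_def)
  finally show ?thesis .
qed

lemma om_shift:
  assumes "x < dX" "s < dS"
  shows "om (shift m x s) = om m * wX x * wS s"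
  unfolding om_def sum_shift[OF assms] boltzmann_def by (simp add: exp_add[symmetric] algebra_simps eQ_def nQ_def)

lemma exp_K: "exp (- \<beta> * (eK k - \<mu> * nK k)) = om (fst k)"
  unfolding eK_def nK_def om_def ..

lemma K_nonempty: "K \<noteq> {}"
proof -
  obtain m where m: "m \<in> Box" using Box_nonempty by auto
  have "0 < real (D m)" using D_lower[of m] C_pos om_pos[of m] by (meson divide_pos_pos less_le_trans)
  thus ?thesis using m n unfolding K_def by auto
qed

text \<open>Energy and particle number are linear functions of the total occupation. Conserving
  \<open>F\<close> conserves both exactly, even if the eigenvalues satisfy no arithmetic
  relation.\<close>

lemma F_conserves:
  assumes "(x, s, k) \<in> \<Omega>" "(x', s', k') \<in> \<Omega>" "F (x', s', k') = F (x, s, k)"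
  shows "energy (sys X) x + energy S s + eK k = energy (sys X) x' + energy S s' + eK k'"
    "number (sys X) x + number S s + nK k = number (sys X) x' + number S s' + nK k'"
proof -
  have *: "x < dX" "s < dS" "x' < dX" "s' < dS" using assms unfolding \<Omega>_def by auto
  have "shift (fst k') x' s' = shift (fst k) x s" using assms unfolding F_def by simp
  with sum_shift[OF *(1,2), of "fst k"] sum_shift[OF *(3,4), of "fst k'"]
  have "(\<Sum>q\<in>Q. real (fst k q) * f q) + f (Inl x) + f (Inr s) = (\<Sum>q\<in>Q. real (fst k' q) * f q) + f (Inl x') + f (Inr s')"
    for f by metis
  from this[of eQ] this[of nQ]
  show "energy (sys X) x + energy S s + eK k = energy (sys X) x' + energy S s' + eK k'"
    "number (sys X) x + number S s + nK k = number (sys X) x' + number S s' + nK k'"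
    unfolding eK_def nK_def eQ_def nQ_def by simp_all
qed

section \<open>Counting states of fixed total occupation\<close>

lemma unshift_shift: "unshift (shift m x s) x s = m"
  unfolding shift_def unshift_def by auto

text \<open>For every \<open>x\<close>, removing one quantum each from \<open>Inl x\<close> and
  \<open>Inr t\<close> leaves a bath occupation in \<open>Box\<close>, whose degeneracy is inversely
  proportional to its Boltzmann weight; summing the resulting factors \<open>wX x\<close> gives the
  partition function. The witness \<open>\<omega>0\<close> keeps \<open>c\<close> away from the
  boundary, so that all these removals are possible.\<close>

lemma card_target_ge:
  assumes c: "c = F \<omega>0" and \<omega>0: "\<omega>0 \<in> Dom" and t: "t < dS"
  shows "C / om c * n * (wS t * partition_function \<beta> \<mu> (sys X)) \<le> card {\<omega> \<in> \<Omega>. F \<omega> = c \<and> fst (snd \<omega>) = t}"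
proof -
  obtain x0 s0 m0 y0 u0 where o: "\<omega>0 = (x0, s0, m0, y0, u0)" by (cases \<omega>0) auto
  have x0: "x0 < dX" "s0 < dS" "m0 \<in> Good" and c0: "c = shift m0 x0 s0"
    using \<omega>0 c unfolding o Dom_def \<Omega>_def F_def by auto
  \<comment> \<open>The margins of \<open>Good\<close> are spent here. \<open>Inl x0\<close> and
    \<open>Inr s0\<close> are different modes, so no coordinate grows by more than
    \<open>1\<close>.\<close>
  have cq: "1 \<le> c q" "c q < L" if "q \<in> Q" for q
    using that x0(3) unfolding c0 shift_def Good_def by (auto dest!: PiE_mem[of _ _ _ q])
  \<comment> \<open>Elements of \<open>PiE\<close> are \<open>undefined\<close> off
    \<open>Q\<close>; this value has to survive shifting and unshifting for membership in
    \<open>Box\<close>.\<close>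
  have cu: "c q = undefined" if "q \<notin> Q" for q
    using that x0 unfolding c0 shift_def Good_def by (auto dest!: PiE_arb[of _ _ _ q] simp: Q_def)
  have un: "unshift c x t \<in> Box" "shift (unshift c x t) x t = c" if x: "x < dX" for x
  proof -
    have xq: "Inl x \<in> Q" "Inr t \<in> Q" using x t unfolding Q_def by auto
    show "shift (unshift c x t) x t = c"
      using cq(1)[OF xq(1)] cq(1)[OF xq(2)] unfolding shift_def unshift_def by auto
    show "unshift c x t \<in> Box" unfolding Box_def
    proof (rule PiE_I)
      fix q assume "q \<in> Q"
      thus "unshift c x t q \<in> {..<L}" using cq(2)[of q] unfolding unshift_def by auto
    next
      fix q assume q: "q \<notin> Q"
      hence "q \<noteq> Inl x" "q \<noteq> Inr t" using xq by auto
      thus "unshift c x t q = undefined" using cu[OF q] unfolding unshift_def by simp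
    qed
  qed
  let ?Z = "SIGMA x:{..<dX}. {..<D (unshift c x t)} \<times> {..<n}"
  let ?f = "\<lambda>(x, y, u). (x, t, unshift c x t, y, u)"
  have "?f ` ?Z \<subseteq> {\<omega> \<in> \<Omega>. F \<omega> = c \<and> fst (snd \<omega>) = t}"
    using un t unfolding \<Omega>_def K_def F_def by auto
  hence "card (?f ` ?Z) \<le> card {\<omega> \<in> \<Omega>. F \<omega> = c \<and> fst (snd \<omega>) = t}" by (intro card_mono) auto
  moreover have "card (?f ` ?Z) = card ?Z" by (rule card_image) (auto simp: inj_on_def)
  moreover have "card ?Z = (\<Sum>x<dX. D (unshift c x t) * n)" by (simp add: card_SigmaI)
  moreover have "C / om c * n * (wS t * partition_function \<beta> \<mu> (sys X)) = (\<Sum>x<dX. C / om (unshift c x t) * n)"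
    unfolding partition_function_def sum_distrib_left
  proof (intro sum.cong refl)
    fix x assume "x \<in> {..<dX}"
    hence x: "x < dX" by simp
    have "om c = om (unshift c x t) * wX x * wS t" using om_shift[OF x t, of "unshift c x t"] un[OF x] by simp
    thus "C / om c * n * (wS t * wX x) = C / om (unshift c x t) * n"
      using boltzmann_pos[of \<beta> \<mu> "sys X" x] boltzmann_pos[of \<beta> \<mu> S t]
      by (simp add: field_simps del: boltzmann_pos)
  qed
  moreover have "\<dots> \<le> (\<Sum>x<dX. real (D (unshift c x t)) * n)"
    by (intro sum_mono mult_right_mono D_lower) auto
  moreover have "(\<Sum>x<dX. real (D (unshift c x t)) * n) = real (\<Sum>x<dX. D (unshift c x t) * n)" by simp
  ultimately show ?thesis by linarith
qed

text \<open>At fixed total occupation, \<open>x\<close> and \<open>s\<close> determine the bath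
  occupation; what remains is its degeneracy index and a fraction at most \<open>M x\<close> of the
  registers. The factor \<open>2\<close> comes from rounding up in \<open>D\<close>, and the factor
  \<open>2\<close> assumed between the Gibbs weights in \<open>bath_process\<close> pays for
  it.\<close>

lemma card_source_le:
  fixes M :: "nat \<Rightarrow> real"
  assumes M: "\<And>x. x < dX \<Longrightarrow> real (card {u. u < n \<and> h x u = Some t}) \<le> M x * n"
  shows "card {\<omega> \<in> Dom. F \<omega> = c \<and> lab \<omega> = t}
    \<le> 2 * C / om c * n * (partition_function \<beta> \<mu> S * (\<Sum>x<dX. M x * wX x))"
proof -
  define A where "A x s = (if unshift c x s \<in> Box \<and> shift (unshift c x s) x s = c
    then (\<lambda>(y, u). (x, s, unshift c x s, y, u)) ` ({..<D (unshift c x s)} \<times> {u. u < n \<and> h x u = Some t}) else {})" for x s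
  have sub: "{\<omega> \<in> Dom. F \<omega> = c \<and> lab \<omega> = t} \<subseteq> (\<Union>x<dX. \<Union>s<dS. A x s)"
  proof
    fix \<omega> assume a: "\<omega> \<in> {\<omega> \<in> Dom. F \<omega> = c \<and> lab \<omega> = t}"
    obtain x s m y u where o: "\<omega> = (x, s, m, y, u)" by (cases \<omega>) auto
    have *: "x < dX" "s < dS" "m \<in> Box" "y < D m" "u < n" "h x u = Some t" "c = shift m x s"
      using a unfolding o Dom_def \<Omega>_def F_def lab_def K_def by auto
    hence "\<omega> \<in> A x s" unfolding A_def o using unshift_shift by auto
    thus "\<omega> \<in> (\<Union>x<dX. \<Union>s<dS. A x s)" using *(1,2) by auto
  qed
  have fin: "finite (A x s)" for x s unfolding A_def by auto
  have cardA: "card (A x s) \<le> 2 * C / om c * n * (wS s * (M x * wX x))" if xs: "x < dX" "s < dS" for x s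
  proof (cases "unshift c x s \<in> Box \<and> shift (unshift c x s) x s = c")
    case True
    have "card (A x s) \<le> D (unshift c x s) * card {u. u < n \<and> h x u = Some t}"
      using True card_image_le[of "{..<D (unshift c x s)} \<times> {u. u < n \<and> h x u = Some t}"] unfolding A_def
      by (simp add: card_cartesian_product)
    hence "real (card (A x s)) \<le> D (unshift c x s) * real (card {u. u < n \<and> h x u = Some t})"
      by (metis of_nat_le_iff of_nat_mult)
    also have "\<dots> \<le> (2 * C / om (unshift c x s)) * (M x * n)"
      using True D_upper M[OF xs(1)] C_pos by (intro mult_mono) (auto simp: less_imp_le)
    also have "\<dots> = 2 * C / om c * n * (wS s * (M x * wX x))"
    proof -
      have "om c = om (unshift c x s) * wX x * wS s" using om_shift[OF xs, of "unshift c x s"] True by simp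
      thus ?thesis using boltzmann_pos[of \<beta> \<mu> "sys X" x] boltzmann_pos[of \<beta> \<mu> S s]
        by (simp add: field_simps del: boltzmann_pos)
    qed
    finally show ?thesis .
  next
    case False
    have "0 \<le> M x * n" using M[OF xs(1)] by (meson of_nat_0_le_iff order_trans)
    hence "0 \<le> M x" using n by (simp add: zero_le_mult_iff)
    hence "0 \<le> 2 * C / om c * n * (wS s * (M x * wX x))"
      using C_pos by (intro mult_nonneg_nonneg divide_nonneg_pos) (auto simp: less_imp_le)
    moreover have "card (A x s) = 0" using False unfolding A_def by auto
    ultimately show ?thesis by simp
  qed
  have "card {\<omega> \<in> Dom. F \<omega> = c \<and> lab \<omega> = t} \<le> card (\<Union>x<dX. \<Union>s<dS. A x s)"
    using fin by (intro card_mono sub) auto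
  also have "\<dots> \<le> (\<Sum>x<dX. card (\<Union>s<dS. A x s))" by (rule card_UN_le) simp
  also have "\<dots> \<le> (\<Sum>x<dX. \<Sum>s<dS. card (A x s))" by (intro sum_mono card_UN_le) simp
  finally have "real (card {\<omega> \<in> Dom. F \<omega> = c \<and> lab \<omega> = t}) \<le> (\<Sum>x<dX. \<Sum>s<dS. real (card (A x s)))"
    by (metis (no_types, lifting) of_nat_le_iff of_nat_sum sum.cong)
  also have "\<dots> \<le> (\<Sum>x<dX. \<Sum>s<dS. 2 * C / om c * n * (wS s * (M x * wX x)))"
    using cardA by (intro sum_mono) auto
  also have "\<dots> = 2 * C / om c * n * (partition_function \<beta> \<mu> S * (\<Sum>x<dX. M x * wX x))"
    unfolding partition_function_def sum_product by (subst sum.swap) (simp add: sum_distrib_left)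
  finally show ?thesis .
qed

text \<open>Level of \<open>X\<close>, level of \<open>S\<close>, bath occupation, degeneracy index
  and register are chosen independently, and the Gibbs weights of the copy of \<open>S\<close> sum
  to \<open>1\<close>.\<close>

lemma sum_Dom:
  "(\<Sum>(x, s, k)\<in>{\<omega> \<in> Dom. lab \<omega> = t}. weight X x * gibbs \<beta> \<mu> S s * (om (fst k) / Z))
    = (\<Sum>x<dX. weight X x * (real (card {u. u < n \<and> h x u = Some t}) * (\<Sum>m\<in>Good. real (D m) * om m) / Z))"
proof -
  have fG: "finite Good" using Good_Box finBox finite_subset by blast
  have e: "{\<omega> \<in> Dom. lab \<omega> = t} = (SIGMA x:{..<dX}. SIGMA s:{..<dS}. SIGMA m:Good. {..<D m} \<times> {u. u < n \<and> h x u = Some t})"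
    unfolding Dom_def \<Omega>_def K_def lab_def using Good_Box by auto
  have inner: "(\<Sum>k\<in>(SIGMA m:Good. {..<D m} \<times> U). om (fst k) / Z) = card U * (\<Sum>m\<in>Good. real (D m) * om m) / Z"
    if "finite U" for U :: "nat set"
  proof -
    have "(\<Sum>k\<in>(SIGMA m:Good. {..<D m} \<times> U). om (fst k) / Z) = (\<Sum>m\<in>Good. \<Sum>_\<in>{..<D m} \<times> U. om m / Z)"
      using sum.Sigma[of Good "\<lambda>m. {..<D m} \<times> U" "\<lambda>m _. om m / Z"] fG that by (simp add: split_def)
    also have "\<dots> = card U * (\<Sum>m\<in>Good. real (D m) * om m) / Z"
      by (simp add: card_cartesian_product sum_distrib_left sum_divide_distrib mult_ac)
    finally show ?thesis .
  qed
  have fS: "finite (SIGMA m:Good. {..<D m} \<times> {u. u < n \<and> h x u = Some t})" for x using fG by auto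
  have "(\<Sum>(x, s, k)\<in>{\<omega> \<in> Dom. lab \<omega> = t}. weight X x * gibbs \<beta> \<mu> S s * (om (fst k) / Z))
    = (\<Sum>x<dX. \<Sum>s<dS. \<Sum>k\<in>(SIGMA m:Good. {..<D m} \<times> {u. u < n \<and> h x u = Some t}).
        weight X x * gibbs \<beta> \<mu> S s * (om (fst k) / Z))"
    unfolding e using fS by (simp add: sum.Sigma)
  also have "\<dots> = (\<Sum>x<dX. weight X x * (\<Sum>s<dS. gibbs \<beta> \<mu> S s)
      * (real (card {u. u < n \<and> h x u = Some t}) * (\<Sum>m\<in>Good. real (D m) * om m) / Z))"
    by (simp add: sum_distrib_left[symmetric] inner sum_distrib_right[symmetric] del: times_divide_eq_right)
  finally show ?thesis by (simp add: sum_gibbs[OF S])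
qed

text \<open>Every occupation carries a weight between \<open>C\<close> and \<open>2 * C\<close>, so
  the weight fraction outside \<open>Good\<close> is at most twice the counting fraction
  \<open>2 * card Q / L\<close>; this explains the \<open>4\<close>.\<close>

lemma good_fraction:
  fixes \<eta> :: real
  assumes "4 * real (card Q) \<le> \<eta> * L"
  shows "1 - \<eta> \<le> (\<Sum>m\<in>Good. real (D m) * om m) / (\<Sum>m\<in>Box. real (D m) * om m)"
proof -
  let ?G = "\<Sum>m\<in>Good. real (D m) * om m" and ?B = "\<Sum>m\<in>Box. real (D m) * om m"
  have bnd: "C \<le> real (D m) * om m" "m \<in> Box \<Longrightarrow> real (D m) * om m \<le> 2 * C" for m
    using D_lower[of m] D_upper[of m] by (simp_all add: field_simps)
  have B: "card Box * C \<le> ?B" using bnd(1) sum_mono[of Box "\<lambda>_. C"] by simp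
  have B0: "0 < ?B" using B C_pos Box_nonempty
    by (intro less_le_trans[OF _ B]) (simp add: card_gt_0_iff)
  have q: "(1 - 2 * real (card Q) / L) * real (card Box) \<le> card Good"
    using card_inner_box_ge[OF finQ L] unfolding Box_def Good_def by simp
  have fG: "finite Good" using Good_Box finBox finite_subset by blast
  have "?B - ?G = (\<Sum>m\<in>Box - Good. real (D m) * om m)"
    using sum.subset_diff[OF Good_Box finBox, of "\<lambda>m. real (D m) * om m"] by simp
  also have "\<dots> \<le> card (Box - Good) * (2 * C)"
    using bnd(2) sum_mono[of "Box - Good" _ "\<lambda>_. 2 * C"] by simp
  also have "real (card (Box - Good)) = real (card Box) - card Good"
    using Good_Box fG card_mono[OF finBox Good_Box] by (simp add: card_Diff_subset of_nat_diff)
  also have "(real (card Box) - card Good) * (2 * C) \<le> (2 * real (card Q) / L * card Box) * (2 * C)"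
    using q C_pos by (intro mult_right_mono) (simp_all add: algebra_simps)
  also have "\<dots> = (4 * real (card Q) / L) * (card Box * C)" by simp
  also have "\<dots> \<le> \<eta> * (card Box * C)"
    using assms L C_pos by (intro mult_right_mono) (simp_all add: field_simps)
  also have "\<dots> \<le> \<eta> * ?B"
  proof (rule mult_left_mono[OF B])
    have "0 \<le> \<eta> * L" using assms by (meson of_nat_0_le_iff order_trans mult_nonneg_nonneg zero_le_numeral)
    thus "0 \<le> \<eta>" using L by (simp add: zero_le_mult_iff)
  qed
  finally show ?thesis using B0 by (simp add: field_simps)
qed

text \<open>In each sector of fixed total occupation, the source states labelled \<open>t\<close>
  are at most as many as the states with \<open>S\<close> in level \<open>t\<close>. They can be
  sent there injectively, and the map extends to a conserving permutation. The error
  \<open>\<eta>\<close> is split evenly between rounding in the register and the boundary of the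
  box.\<close>

lemma bath_process:
  fixes M :: "nat \<Rightarrow> nat \<Rightarrow> real" and \<eta> :: real
  assumes M0: "\<And>s x. 0 \<le> M s x" and M1: "\<And>x. x < dX \<Longrightarrow> (\<Sum>s<dS. M s x) \<le> 1"
    and Mg: "\<And>s. s < dS \<Longrightarrow> 2 * (\<Sum>x<dX. M s x * gibbs \<beta> \<mu> (sys X) x) \<le> gibbs \<beta> \<mu> S s"
    and hM: "\<And>x s. x < dX \<Longrightarrow> s < dS \<Longrightarrow> real (card {u. u < n \<and> h x u = Some s}) \<le> M s x * n"
      "\<And>x s. x < dX \<Longrightarrow> s < dS \<Longrightarrow> M s x * n - 1 \<le> real (card {u. u < n \<and> h x u = Some s})"
    and nL: "2 \<le> \<eta> * n" "8 * real (card Q) \<le> \<eta> * L"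
  shows "\<exists>r. equilibrates \<beta> \<mu> X S (mat_diag dS (\<lambda>s. complex_of_real (r s)))
    \<and> (\<forall>s<dS. 0 \<le> r s \<and> (\<Sum>x<dX. M s x * weight X x) - \<eta> \<le> r s)"
proof -
  have dX: "0 < dX" using X unfolding is_state_def by simp
  let ?ZX = "partition_function \<beta> \<mu> (sys X)" and ?ZS = "partition_function \<beta> \<mu> S"
  have ZX: "0 < ?ZX" and ZS: "0 < ?ZS" using dX S by (simp_all add: partition_function_pos)
  have Mw: "2 * (?ZS * (\<Sum>x<dX. M s x * wX x)) \<le> wS s * ?ZX" if "s < dS" for s
    using Mg[OF that] ZX ZS unfolding gibbs_eq times_divide_eq_right sum_divide_distrib[symmetric]
    by (simp add: field_simps)
  have fib: "card {z \<in> Dom. (F z, lab z) = (F \<omega>, lab \<omega>)} \<le> card {y \<in> \<Omega>. (F y, fst (snd y)) = (F \<omega>, lab \<omega>)}"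
    if \<omega>: "\<omega> \<in> Dom" for \<omega>
  proof -
    have t: "lab \<omega> < dS" using \<omega> h unfolding Dom_def lab_def by auto
    have "real (card {z \<in> Dom. F z = F \<omega> \<and> lab z = lab \<omega>})
      \<le> 2 * C / om (F \<omega>) * n * (?ZS * (\<Sum>x<dX. M (lab \<omega>) x * wX x))"
      using hM(1) t by (intro card_source_le) auto
    also have "\<dots> = C / om (F \<omega>) * n * (2 * (?ZS * (\<Sum>x<dX. M (lab \<omega>) x * wX x)))" by simp
    also have "\<dots> \<le> C / om (F \<omega>) * n * (wS (lab \<omega>) * ?ZX)"
      using Mw[OF t] C_pos by (intro mult_left_mono) (simp_all add: less_imp_le)
    also have "\<dots> \<le> card {y \<in> \<Omega>. F y = F \<omega> \<and> fst (snd y) = lab \<omega>}"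
      by (rule card_target_ge[OF refl \<omega> t])
    finally show ?thesis by simp
  qed
  have Dom\<Omega>: "Dom \<subseteq> \<Omega>" unfolding Dom_def by auto
  have fD: "finite Dom" using Dom\<Omega> fin\<Omega> finite_subset by blast
  obtain f where f: "inj_on f Dom" "f ` Dom \<subseteq> \<Omega>"
    and fk: "\<And>z. z \<in> Dom \<Longrightarrow> (F (f z), fst (snd (f z))) = (F z, lab z)"
    using fiberwise_injection[OF fD fin\<Omega> fib] by blast
  obtain p where p: "bij_betw p \<Omega> \<Omega>" and pf: "\<And>z. z \<in> Dom \<Longrightarrow> p z = f z"
    and pF: "\<And>z. z \<in> \<Omega> \<Longrightarrow> F (p z) = F z"
    using extend_injection_to_permutation[OF fin\<Omega> Dom\<Omega> f, of F] fk by blast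
  define Z where "Z = (\<Sum>k\<in>K. exp (- \<beta> * (eK k - \<mu> * nK k)))"
  define w where "w = (\<lambda>(x, s, k). weight X x * gibbs \<beta> \<mu> S s * (exp (- \<beta> * (eK k - \<mu> * nK k)) / Z))"
  define r where "r t = (\<Sum>\<omega>\<in>{\<omega>\<in>\<Omega>. fst (snd (p \<omega>)) = t}. w \<omega>)" for t
  have eq: "equilibrates \<beta> \<mu> X S (mat_diag dS (\<lambda>s. complex_of_real (r s)))"
    unfolding r_def w_def Z_def \<Omega>_def
  proof (rule equilibrates_permutation[OF dX S finK K_nonempty])
    show "bij_betw p ({..<dX} \<times> {..<dS} \<times> K) ({..<dX} \<times> {..<dS} \<times> K)" using p unfolding \<Omega>_def .
    fix x s k x' s' k'
    assume o: "(x, s, k) \<in> {..<dX} \<times> {..<dS} \<times> K" "p (x, s, k) = (x', s', k')"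
    hence o1: "(x, s, k) \<in> \<Omega>" unfolding \<Omega>_def by simp
    have o2: "(x', s', k') \<in> \<Omega>" using o(2) o1 p by (metis bij_betwE)
    show "energy (sys X) x + energy S s + eK k = energy (sys X) x' + energy S s' + eK k' \<and>
      number (sys X) x + number S s + nK k = number (sys X) x' + number S s' + nK k'"
      using F_conserves[OF o1 o2] pF[OF o1] o(2) by simp
  qed
  have ZK: "Z = n * (\<Sum>m\<in>Box. real (D m) * om m)"
    unfolding Z_def exp_K K_def
    using sum.Sigma[of Box "\<lambda>m. {..<D m} \<times> {..<n}" "\<lambda>m _. om m"]
    by (simp add: split_def card_cartesian_product sum_distrib_left mult_ac)
  define PG where "PG = (\<Sum>m\<in>Good. real (D m) * om m) / (\<Sum>m\<in>Box. real (D m) * om m)"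
  have PG: "1 - \<eta> / 2 \<le> PG" unfolding PG_def by (rule good_fraction) (use nL in simp)
  have w0: "0 \<le> w z" if "z \<in> \<Omega>" for z
  proof -
    have "0 \<le> Z" unfolding Z_def by (intro sum_nonneg) simp
    thus ?thesis using that X S unfolding w_def \<Omega>_def is_state_def by (auto simp: less_imp_le[OF gibbs_pos])
  qed
  have "(\<Sum>x<dX. M t x * weight X x) - \<eta> \<le> r t" if t: "t < dS" for t
  proof -
    \<comment> \<open>All prescribed states labelled \<open>t\<close> end in level \<open>t\<close>;
      whatever else the permutation brings there has nonnegative weight.\<close>
    have "{\<omega> \<in> Dom. lab \<omega> = t} \<subseteq> {\<omega>\<in>\<Omega>. fst (snd (p \<omega>)) = t}" using Dom\<Omega> pf fk by auto
    hence le: "(\<Sum>\<omega>\<in>{\<omega> \<in> Dom. lab \<omega> = t}. w \<omega>) \<le> r t"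
      unfolding r_def using w0 by (intro sum_mono2) auto
    have "(\<Sum>\<omega>\<in>{\<omega> \<in> Dom. lab \<omega> = t}. w \<omega>)
      = (\<Sum>x<dX. weight X x * (real (card {u. u < n \<and> h x u = Some t}) / n * PG))"
      unfolding w_def exp_K sum_Dom by (simp add: ZK PG_def)
    also have "\<dots> \<ge> (\<Sum>x<dX. weight X x * (M t x - \<eta>))"
    proof (rule sum_mono)
      fix x assume "x \<in> {..<dX}"
      hence x: "x < dX" by simp
      let ?N = "real (card {u. u < n \<and> h x u = Some t}) / n"
      have "M t x \<le> 1" using M1[OF x] member_le_sum[of t "{..<dS}" "\<lambda>s. M s x"] t M0 by simp
      moreover have "?N \<le> M t x" using hM(1)[OF x t] n by (simp add: field_simps)
      ultimately have N1: "?N \<le> 1" by linarith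
      have "(M t x * n - 1) / n \<le> ?N" using hM(2)[OF x t] by (rule divide_right_mono) simp
      moreover have "(M t x * n - 1) / n = M t x - 1 / n" using n by (simp add: field_simps)
      moreover have "1 / n \<le> \<eta> / 2" using nL(1) n by (simp add: field_simps)
      ultimately have N2: "M t x - \<eta> / 2 \<le> ?N" by linarith
      have \<eta>: "0 \<le> \<eta>" using nL(1) n by (metis mult_neg_pos not_le of_nat_0_less_iff order_trans zero_le_numeral)
      have "?N - \<eta> / 2 \<le> ?N - ?N * (\<eta> / 2)" using N1 \<eta> mult_right_mono[OF N1, of "\<eta> / 2"] by simp
      also have "\<dots> = ?N * (1 - \<eta> / 2)" by (simp only: right_diff_distrib mult_1_right)
      also have "\<dots> \<le> ?N * PG" by (rule mult_left_mono[OF PG]) simp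
      finally have "M t x - \<eta> \<le> ?N * PG" using N2 by linarith
      thus "weight X x * (M t x - \<eta>) \<le> weight X x * (?N * PG)"
        using X x by (intro mult_left_mono) (auto simp: is_state_def)
    qed
    moreover have "(\<Sum>x<dX. weight X x * (M t x - \<eta>)) = (\<Sum>x<dX. M t x * weight X x) - \<eta> * (\<Sum>x<dX. weight X x)"
      by (simp add: algebra_simps sum_subtractf sum_distrib_left)
    ultimately show ?thesis using le X by (simp add: is_state_def)
  qed
  moreover have "0 \<le> r t" for t unfolding r_def using w0 by (intro sum_nonneg) auto
  ultimately show ?thesis using eq by blast
qed

end

text \<open>Approximate sufficient half of equimajorization, with a factor \<open>2\<close> of
  slack. A column of \<open>M\<close> may sum to less than \<open>1\<close>; the missing weight ends
  up in an uncontrolled place, which is why output weights are bounded from below only.\<close>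

lemma equilibrates_almost:
  fixes M :: "nat \<Rightarrow> nat \<Rightarrow> real" and \<eta> :: real
  assumes X: "is_state X" and S: "0 < hdim S" and \<eta>: "0 < \<eta>"
    and M0: "\<And>s x. 0 \<le> M s x" and M1: "\<And>x. x < hdim (sys X) \<Longrightarrow> (\<Sum>s<hdim S. M s x) \<le> 1"
    and Mg: "\<And>s. s < hdim S \<Longrightarrow> 2 * (\<Sum>x<hdim (sys X). M s x * gibbs \<beta> \<mu> (sys X) x) \<le> gibbs \<beta> \<mu> S s"
  shows "\<exists>r. equilibrates \<beta> \<mu> X S (mat_diag (hdim S) (\<lambda>s. complex_of_real (r s)))
    \<and> (\<forall>s<hdim S. 0 \<le> r s \<and> (\<Sum>x<hdim (sys X). M s x * weight X x) - \<eta> \<le> r s)"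
proof -
  define q where "q = card ({..<hdim (sys X)} <+> {..<hdim S})"
  \<comment> \<open>With \<open>2 / \<eta>\<close> the register rounding \<open>1 / n\<close> is at
    most \<open>\<eta> / 2\<close>; with \<open>8 * q / \<eta>\<close> below, the same holds for the
    boundary loss \<open>4 * q / L\<close>.\<close>
  define n where "n = nat \<lceil>2 / \<eta>\<rceil>"
  define L where "L = max 3 (nat \<lceil>8 * q / \<eta>\<rceil>)"
  have n2: "2 / \<eta> \<le> n" unfolding n_def by (rule real_nat_ceiling_ge)
  have L2: "8 * q / \<eta> \<le> L" unfolding L_def using real_nat_ceiling_ge[of "8 * q / \<eta>"] by simp
  have n0: "0 < n" using n2 \<eta> by (metis divide_pos_pos less_le_trans of_nat_0_less_iff zero_less_numeral)
  define lbl where "lbl x h \<longleftrightarrow> (\<forall>s<hdim S. real (card {u. u < n \<and> h u = Some s}) \<le> M s x * n \<and>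
      M s x * n - 1 \<le> real (card {u. u < n \<and> h u = Some s})) \<and> (\<forall>u s. h u = Some s \<longrightarrow> s < hdim S)" for x h
  have "\<exists>h. lbl x h" if x: "x < hdim (sys X)" for x
    unfolding lbl_def by (rule labelling_with_frequencies[of "hdim S" "\<lambda>s. M s x" n, OF M0 M1[OF x]])
  hence lbl: "lbl x (SOME h. lbl x h)" if "x < hdim (sys X)" for x using that by (simp add: someI_ex)
  define h0 where "h0 x = (SOME h. lbl x h)" for x
  have h0: "\<And>x s. x < hdim (sys X) \<Longrightarrow> s < hdim S \<Longrightarrow> real (card {u. u < n \<and> h0 x u = Some s}) \<le> M s x * n"
      "\<And>x s. x < hdim (sys X) \<Longrightarrow> s < hdim S \<Longrightarrow> M s x * n - 1 \<le> real (card {u. u < n \<and> h0 x u = Some s})"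
      "\<And>x u s. x < hdim (sys X) \<Longrightarrow> h0 x u = Some s \<Longrightarrow> s < hdim S"
    using lbl unfolding h0_def[symmetric] unfolding lbl_def by auto
  define h where "h x = (if x < hdim (sys X) then h0 x else (\<lambda>_. None))" for x
  interpret bath \<beta> \<mu> X S L n h
    by unfold_locales (use X S n0 h0(3) in \<open>auto simp: L_def h_def split: if_splits\<close>)
  show ?thesis
  proof (rule bath_process[OF M0 M1 Mg])
    show "2 \<le> \<eta> * n" using n2 \<eta> by (simp add: field_simps)
    show "8 * real (card Q) \<le> \<eta> * L" using L2 \<eta> unfolding Q_def q_def[symmetric] by (simp add: field_simps)
  qed (use h0 in \<open>auto simp: h_def\<close>)
qed

section \<open>Achievability of work gain and work cost\<close>

text \<open>An equally spaced ladder from \<open>\<kappa> / \<beta>\<close> to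
  \<open>\<kappa> / \<beta> + W\<close>, descending if \<open>W\<close> is negative. Particle number
  zero gives its Gibbs weights the form demanded by \<open>is_battery\<close>.\<close>

lemma battery_exists:
  fixes \<beta> \<mu> \<kappa> \<delta> W :: real
  assumes \<beta>: "\<beta> > 0" and \<delta>: "\<delta> > 0"
  obtains B j k where "battery_levels \<beta> \<mu> \<kappa> \<delta> B j k W"
proof -
  \<comment> \<open>The \<open>+ 1\<close> keeps \<open>N\<close> positive when
    \<open>W = 0\<close>.\<close>
  define N where "N = nat \<lceil>\<bar>W\<bar> / \<delta>\<rceil> + 1"
  have N0: "0 < real N" unfolding N_def by simp
  have "\<bar>W\<bar> / \<delta> \<le> N" unfolding N_def using real_nat_ceiling_ge[of "\<bar>W\<bar> / \<delta>"] by simp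
  hence step: "\<bar>W\<bar> / N \<le> \<delta>" using \<delta> N0 by (simp add: field_simps)
  define B where "B = \<lparr>hdim = Suc N, energy = (\<lambda>i. \<kappa> / \<beta> + W * (i / N)), number = (\<lambda>_. 0)\<rparr>"
  have fine: "\<exists>i<hdim B. \<bar>energy B i - x\<bar> \<le> \<delta>"
    if x: "min (energy B 0) (energy B N) \<le> x" "x \<le> max (energy B 0) (energy B N)" for x
  proof (cases "W = 0")
    case True
    hence "x = energy B 0" using x unfolding B_def by simp
    thus ?thesis using \<delta> by (intro exI[of _ 0]) (simp add: B_def)
  next
    case False
    \<comment> \<open>Position of \<open>x\<close> in units of the ladder spacing; its floor is the
      index of a level at most one spacing away.\<close>
    define t where "t = (x - \<kappa> / \<beta>) / W * N"
    have xt: "x = \<kappa> / \<beta> + W * (t / N)" using False N0 unfolding t_def by simp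
    have b: "min 0 W \<le> x - \<kappa> / \<beta>" "x - \<kappa> / \<beta> \<le> max 0 W" using x N0 unfolding B_def by (auto simp: min_def max_def split: if_splits)
    have "0 \<le> (x - \<kappa> / \<beta>) / W" "(x - \<kappa> / \<beta>) / W \<le> 1" using b False
      by (auto simp: min_def max_def divide_simps split: if_splits)
    hence t: "0 \<le> t" "t \<le> N" unfolding t_def using mult_right_mono[of "(x - \<kappa> / \<beta>) / W" 1 "real N"]
      mult_nonneg_nonneg[of "(x - \<kappa> / \<beta>) / W" "real N"] by simp_all
    have fl: "real (nat \<lfloor>t\<rfloor>) = of_int \<lfloor>t\<rfloor>" using t by simp
    have "energy B (nat \<lfloor>t\<rfloor>) - x = W / N * (of_int \<lfloor>t\<rfloor> - t)"
      using N0 unfolding xt by (simp add: B_def fl field_simps)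
    hence "\<bar>energy B (nat \<lfloor>t\<rfloor>) - x\<bar> = \<bar>W\<bar> / N * \<bar>of_int \<lfloor>t\<rfloor> - t\<bar>"
      by (simp add: abs_mult)
    also have "\<dots> \<le> \<bar>W\<bar> / N * 1"
    proof (rule mult_left_mono)
      show "\<bar>of_int \<lfloor>t\<rfloor> - t\<bar> \<le> 1" by linarith
    qed simp
    finally have "\<bar>energy B (nat \<lfloor>t\<rfloor>) - x\<bar> \<le> \<delta>" using step by simp
    moreover have "nat \<lfloor>t\<rfloor> < hdim B" using t fl unfolding B_def by (simp add: le_floor_iff less_Suc_eq_le floor_le_iff nat_le_iff)
    ultimately show ?thesis by blast
  qed
  have "battery_levels \<beta> \<mu> \<kappa> \<delta> B 0 N W"
    unfolding battery_levels_def finely_spaced_def is_battery_def gibbs_def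
    using fine N0 \<beta> by (auto simp: B_def)
  thus ?thesis by (rule that)
qed

text \<open>Between normalised vectors total excess equals total deficit, so the deficits alone give
  the trace distance and lower bounds on \<open>r\<close> are enough. That \<open>r\<close> is
  normalised is read off the stochastic matrix of the operation.\<close>

lemma equilibrates_approx_diag:
  assumes eq: "equilibrates \<beta> \<mu> X (sys Y) (mat_diag (hdim (sys Y)) (\<lambda>s. complex_of_real (r s)))"
    and X: "is_state X" and Y: "is_state Y"
    and le: "(\<Sum>s<hdim (sys Y). max 0 (weight Y s - r s)) \<le> \<epsilon>"
  shows "equilibrates_approx \<beta> \<mu> \<epsilon> X Y"
proof -
  let ?d = "hdim (sys Y)"
  have X0: "0 < hdim (sys X)" using X unfolding is_state_def by simp
  obtain M where "\<And>s x. 0 \<le> M s x" and M: "\<And>x. x < hdim (sys X) \<Longrightarrow> (\<Sum>s<?d. M s x) = 1"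
    and "\<And>s. s < ?d \<Longrightarrow> (\<Sum>x<hdim (sys X). M s x * gibbs \<beta> \<mu> (sys X) x) = gibbs \<beta> \<mu> (sys Y) s"
    and r': "\<And>s. s < ?d \<Longrightarrow> mat_diag ?d (\<lambda>s. complex_of_real (r s)) $$ (s, s) = of_real (\<Sum>x<hdim (sys X). M s x * weight X x)"
    and "mat_diag ?d (\<lambda>s. complex_of_real (r s)) \<in> carrier_mat ?d ?d"
    using equilibrates_stochastic[OF eq X0] by blast
  have r: "r s = (\<Sum>x<hdim (sys X). M s x * weight X x)" if "s < ?d" for s
    using r'[OF that] that by (simp add: mat_diag_def del: of_real_sum)
  have "(\<Sum>s<?d. r s) = (\<Sum>s<?d. \<Sum>x<hdim (sys X). M s x * weight X x)" by (simp add: r)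
  also have "\<dots> = (\<Sum>x<hdim (sys X). (\<Sum>s<?d. M s x) * weight X x)"
    by (subst sum.swap) (simp add: sum_distrib_right)
  finally have "(\<Sum>s<?d. r s) = 1" using M X by (simp add: is_state_def)
  hence d0: "(\<Sum>s<?d. r s - weight Y s) = 0" using Y by (simp add: sum_subtractf is_state_def)
  have "mat_diag ?d (\<lambda>s. complex_of_real (r s)) - density Y = mat_diag ?d (\<lambda>s. complex_of_real (r s - weight Y s))"
    unfolding density_def by (rule eq_matI) (auto simp: mat_diag_def)
  hence "trace_norm (mat_diag ?d (\<lambda>s. complex_of_real (r s)) - density Y) = (\<Sum>s<?d. \<bar>r s - weight Y s\<bar>)"
    by (simp only: trace_norm_diag)
  also have "\<dots> = (\<Sum>s<?d. (r s - weight Y s) + 2 * max 0 (weight Y s - r s))"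
    by (intro sum.cong) (auto simp: max_def)
  also have "\<dots> = 2 * (\<Sum>s<?d. max 0 (weight Y s - r s))"
    using d0 by (simp add: sum.distrib sum_distrib_left)
  finally show ?thesis using eq le unfolding equilibrates_approx_def by auto
qed

text \<open>Membership in \<open>A\<close> serves as a deterministic test, and acceptance moves the
  battery from \<open>j\<close> to \<open>k\<close>. The strict inequality for the accepted weight
  leaves a positive \<open>\<eta>\<close> for the finite bath.\<close>

lemma gain_achievable:
  assumes R: "is_state R" and B: "battery_levels \<beta> \<mu> \<kappa> \<delta> B j k W"
    and A: "A \<subseteq> {..<hdim (sys R)}" and gA: "2 * (\<Sum>i\<in>A. gibbs \<beta> \<mu> (sys R) i) \<le> exp (- \<beta> * W)"
    and rA: "1 - \<epsilon> < (\<Sum>i\<in>A. weight R i)" and \<epsilon>: "0 < \<epsilon>"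
  shows "equilibrates_approx \<beta> \<mu> \<epsilon> (R \<boxplus> battery_state B j) (battery_state B k)"
proof -
  have j: "j < hdim B" and k: "k < hdim B" using B unfolding battery_levels_def by auto
  let ?d = "hdim (sys R)" and ?b = "hdim B" and ?X = "R \<boxplus> battery_state B j"
  have X: "is_state ?X" by (rule is_state_comp[OF R is_state_battery[OF j]])
  have dX: "hdim (sys ?X) = ?d * ?b" by simp
  have gj: "0 < gibbs \<beta> \<mu> B j" using j by (intro gibbs_pos) simp
  define M :: "nat \<Rightarrow> nat \<Rightarrow> real" where
    "M s x = (if s = k \<and> x mod ?b = j \<and> x div ?b \<in> A then 1 else 0)" for s x
  have iA: "(\<Sum>i<?d. if i \<in> A then f i else 0) = (\<Sum>i\<in>A. f i)" for f :: "nat \<Rightarrow> real"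
    using A by (simp add: sum.If_cases Int_absorb1)
  have sumM: "(\<Sum>x<?d * ?b. M k x * p (x div ?b) * q (x mod ?b)) = (\<Sum>i\<in>A. p i) * q j" for p q :: "nat \<Rightarrow> real"
  proof -
    have "(\<Sum>x<?d * ?b. M k x * p (x div ?b) * q (x mod ?b)) = (\<Sum>i<?d. \<Sum>l<?b. if l = j then (if i \<in> A then p i * q j else 0) else 0)"
      unfolding sum_mult_index by (intro sum.cong refl) (auto simp: M_def)
    also have "\<dots> = (\<Sum>i<?d. if i \<in> A then p i * q j else 0)" using j by simp
    finally show ?thesis by (simp add: iA sum_distrib_right)
  qed
  define \<eta> where "\<eta> = (\<Sum>i\<in>A. weight R i) - (1 - \<epsilon>)"
  have "\<exists>r. equilibrates \<beta> \<mu> ?X B (mat_diag ?b (\<lambda>s. complex_of_real (r s)))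
    \<and> (\<forall>s<?b. 0 \<le> r s \<and> (\<Sum>x<hdim (sys ?X). M s x * weight ?X x) - \<eta> \<le> r s)"
  proof (rule equilibrates_almost[OF X])
    show "0 < ?b" using j by simp
    show "0 < \<eta>" using rA unfolding \<eta>_def by simp
    show "0 \<le> M s x" for s x unfolding M_def by simp
    show "(\<Sum>s<?b. M s x) \<le> 1" for x
    proof -
      have "(\<Sum>s<?b. M s x) \<le> (\<Sum>s<?b. if s = k then 1 else 0)" by (intro sum_mono) (simp add: M_def)
      thus ?thesis using k by simp
    qed
    fix s assume s: "s < ?b"
    show "2 * (\<Sum>x<hdim (sys ?X). M s x * gibbs \<beta> \<mu> (sys ?X) x) \<le> gibbs \<beta> \<mu> B s"
    proof (cases "s = k")
      case True
      have "(\<Sum>x<hdim (sys ?X). M s x * gibbs \<beta> \<mu> (sys ?X) x) = (\<Sum>i\<in>A. gibbs \<beta> \<mu> (sys R) i) * gibbs \<beta> \<mu> B j"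
        using sumM[of "gibbs \<beta> \<mu> (sys R)" "gibbs \<beta> \<mu> B"] True by (simp add: gibbs_sys_comp mult.assoc)
      thus ?thesis using mult_right_mono[OF gA, of "gibbs \<beta> \<mu> B j"] gj gibbs_battery_levels[OF B] True
        by (simp add: mult_ac)
    next
      case False
      thus ?thesis using gibbs_pos[of B \<beta> \<mu> s] j by (simp add: M_def)
    qed
  qed
  then obtain r where r: "equilibrates \<beta> \<mu> ?X B (mat_diag ?b (\<lambda>s. complex_of_real (r s)))"
    "\<And>s. s < ?b \<Longrightarrow> 0 \<le> r s"
    "\<And>s. s < ?b \<Longrightarrow> (\<Sum>x<hdim (sys ?X). M s x * weight ?X x) - \<eta> \<le> r s" by blast
  have "(\<Sum>x<hdim (sys ?X). M k x * weight ?X x) = (\<Sum>i\<in>A. weight R i)"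
    using sumM[of "weight R" "weight (battery_state B j)"] by (simp add: weight_state_comp weight_battery_state mult.assoc)
  hence rk: "1 - \<epsilon> \<le> r k" using r(3)[OF k] unfolding \<eta>_def by simp
  have "(\<Sum>s<?b. max 0 (weight (battery_state B k) s - r s)) = (\<Sum>s<?b. if s = k then max 0 (1 - r k) else 0)"
    using r(2) by (intro sum.cong) (auto simp: weight_battery_state)
  also have "\<dots> \<le> \<epsilon>" using k rk \<epsilon> by simp
  finally show ?thesis
    by (intro equilibrates_approx_diag[OF _ X is_state_battery[OF k]]) (use r(1) in simp_all)
qed

text \<open>Battery level \<open>k\<close> is turned into the weights of \<open>R\<close> cut down
  to \<open>A\<close>, with the battery in \<open>j\<close>; \<open>gA\<close> is the domination by
  Gibbs weights that \<open>equilibrates_almost\<close> requires.\<close>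

lemma cost_achievable:
  assumes R: "is_state R" and B: "battery_levels \<beta> \<mu> \<kappa> \<delta> B j k W"
    and A: "A \<subseteq> {..<hdim (sys R)}"
    and gA: "\<And>i. i \<in> A \<Longrightarrow> 2 * weight R i \<le> exp (\<beta> * W) * gibbs \<beta> \<mu> (sys R) i"
    and rA: "1 - \<epsilon> < (\<Sum>i\<in>A. weight R i)"
  shows "equilibrates_approx \<beta> \<mu> \<epsilon> (battery_state B k) (R \<boxplus> battery_state B j)"
proof -
  have j: "j < hdim B" and k: "k < hdim B" using B unfolding battery_levels_def by auto
  let ?d = "hdim (sys R)" and ?b = "hdim B" and ?Y = "R \<boxplus> battery_state B j"
  have Y: "is_state ?Y" by (rule is_state_comp[OF R is_state_battery[OF j]])
  have d: "0 < ?d" using R unfolding is_state_def by simp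
  have r0: "0 \<le> weight R i" if "i < ?d" for i using R that unfolding is_state_def by simp
  define M :: "nat \<Rightarrow> nat \<Rightarrow> real" where
    "M s x = (if x = k \<and> s mod ?b = j \<and> s div ?b \<in> A then weight R (s div ?b) else 0)" for s x
  have M0: "0 \<le> M s x" for s x unfolding M_def using A r0 by auto
  have sumY: "(\<Sum>s<?d * ?b. if s mod ?b = j then f (s div ?b) else 0) = (\<Sum>i<?d. f i)" for f :: "nat \<Rightarrow> real"
  proof -
    have "(\<Sum>s<?d * ?b. if s mod ?b = j then f (s div ?b) else 0) = (\<Sum>i<?d. \<Sum>l<?b. if l = j then f i else 0)"
      unfolding sum_mult_index by (intro sum.cong refl) auto
    thus ?thesis using j by simp
  qed
  have iA: "(\<Sum>i<?d. if i \<in> A then f i else 0) = (\<Sum>i\<in>A. f i)" for f :: "nat \<Rightarrow> real"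
    using A by (simp add: sum.If_cases Int_absorb1)
  have rA1: "(\<Sum>i\<in>A. weight R i) \<le> 1"
    using sum_mono2[OF _ A, of "weight R"] r0 R by (simp add: is_state_def)
  \<comment> \<open>A loss of \<open>\<eta>\<close> may occur at each level of \<open>R\<close>, so
    the available slack is divided by their number.\<close>
  define \<eta> where "\<eta> = ((\<Sum>i\<in>A. weight R i) - (1 - \<epsilon>)) / ?d"
  have \<eta>0: "0 < \<eta>" using rA d unfolding \<eta>_def by simp
  have gj: "0 < gibbs \<beta> \<mu> B j" using j by (intro gibbs_pos) simp
  have Msum: "(\<Sum>x<?b. M s x * p x) = (if s mod ?b = j \<and> s div ?b \<in> A then weight R (s div ?b) else 0) * p k" for s p
  proof -
    have "(\<Sum>x<?b. M s x * p x) = (\<Sum>x<?b. if x = k then (if s mod ?b = j \<and> s div ?b \<in> A then weight R (s div ?b) else 0) * p k else 0)"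
      by (intro sum.cong) (auto simp: M_def)
    thus ?thesis using k by simp
  qed
  have "\<exists>r. equilibrates \<beta> \<mu> (battery_state B k) (sys R \<oplus>\<^sub>s B)
      (mat_diag (hdim (sys R \<oplus>\<^sub>s B)) (\<lambda>s. complex_of_real (r s)))
    \<and> (\<forall>s<hdim (sys R \<oplus>\<^sub>s B). 0 \<le> r s \<and>
        (\<Sum>x<hdim (sys (battery_state B k)). M s x * weight (battery_state B k) x) - \<eta> \<le> r s)"
  proof (rule equilibrates_almost[OF is_state_battery[OF k] _ \<eta>0])
    show "0 < hdim (sys R \<oplus>\<^sub>s B)" using j d by simp
    show "0 \<le> M s x" for s x by (rule M0)
    show "(\<Sum>s<hdim (sys R \<oplus>\<^sub>s B). M s x) \<le> 1" for x
    proof -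
      have "(\<Sum>s<?d * ?b. M s x) \<le> (\<Sum>s<?d * ?b. if s mod ?b = j then (if s div ?b \<in> A then weight R (s div ?b) else 0) else 0)"
        using r0 by (intro sum_mono) (auto simp: M_def less_mult_imp_div_less)
      thus ?thesis using rA1 unfolding sumY[of "\<lambda>i. if i \<in> A then weight R i else 0"] iA by simp
    qed
    fix s assume "s < hdim (sys R \<oplus>\<^sub>s B)"
    have g0: "0 < gibbs \<beta> \<mu> (sys R \<oplus>\<^sub>s B) s" using j d by (intro gibbs_pos) simp
    show "2 * (\<Sum>x<hdim (sys (battery_state B k)). M s x * gibbs \<beta> \<mu> (sys (battery_state B k)) x) \<le> gibbs \<beta> \<mu> (sys R \<oplus>\<^sub>s B) s"
    proof (cases "s mod ?b = j \<and> s div ?b \<in> A")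
      case True
      have "2 * weight R (s div ?b) * exp (- \<beta> * W) \<le> exp (\<beta> * W) * gibbs \<beta> \<mu> (sys R) (s div ?b) * exp (- \<beta> * W)"
        using gA True by (intro mult_right_mono) auto
      also have "\<dots> = gibbs \<beta> \<mu> (sys R) (s div ?b)" by (simp add: exp_minus)
      finally have "2 * weight R (s div ?b) * exp (- \<beta> * W) * gibbs \<beta> \<mu> B j \<le> gibbs \<beta> \<mu> (sys R) (s div ?b) * gibbs \<beta> \<mu> B j"
        using gj by (intro mult_right_mono) auto
      thus ?thesis using True unfolding sys_battery_state Msum gibbs_battery_levels[OF B] gibbs_sys_comp
        by (simp add: mult_ac)
    next
      case False
      thus ?thesis using g0 unfolding sys_battery_state Msum by auto
    qed
  qed
  then obtain r where r: "equilibrates \<beta> \<mu> (battery_state B k) (sys R \<oplus>\<^sub>s B) (mat_diag (?d * ?b) (\<lambda>s. complex_of_real (r s)))"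
    "\<And>s. s < ?d * ?b \<Longrightarrow> 0 \<le> r s"
    "\<And>s. s < ?d * ?b \<Longrightarrow> (\<Sum>x<?b. M s x * weight (battery_state B k) x) - \<eta> \<le> r s" unfolding hdim_sys_comp sys_battery_state by blast
  have "(\<Sum>s<?d * ?b. max 0 (weight ?Y s - r s))
    \<le> (\<Sum>s<?d * ?b. if s mod ?b = j then (if s div ?b \<in> A then 0 else weight R (s div ?b)) + \<eta> else 0)"
  proof (rule sum_mono)
    fix s assume "s \<in> {..<?d * ?b}"
    hence s: "s < ?d * ?b" by simp
    have "0 \<le> weight R (s div ?b)" using s by (intro r0) (simp add: less_mult_imp_div_less)
    thus "max 0 (weight ?Y s - r s) \<le> (if s mod ?b = j then (if s div ?b \<in> A then 0 else weight R (s div ?b)) + \<eta> else 0)"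
      using r(2)[OF s] r(3)[OF s] \<eta>0 unfolding Msum
      by (auto simp: weight_state_comp weight_battery_state)
  qed
  also have "\<dots> = (\<Sum>i<?d. (weight R i - (if i \<in> A then weight R i else 0)) + \<eta>)"
    unfolding sumY[of "\<lambda>i. (if i \<in> A then 0 else weight R i) + \<eta>"] by (intro sum.cong) auto
  also have "\<dots> = 1 - (\<Sum>i\<in>A. weight R i) + ?d * \<eta>"
    unfolding sum.distrib sum_subtractf iA using R by (simp add: is_state_def)
  also have "\<dots> = \<epsilon>" using d by (simp add: \<eta>_def)
  finally show ?thesis
    by (intro equilibrates_approx_diag[OF _ is_state_battery[OF k] Y]) (use r(1) in simp_all)
qed

section \<open>Many copies\<close>

definition log_ratio :: "real \<Rightarrow> real \<Rightarrow> state \<Rightarrow> nat \<Rightarrow> real" where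
  "log_ratio \<beta> \<mu> R i = ln (weight R i / gibbs \<beta> \<mu> (sys R) i)"

definition free_divergence :: "real \<Rightarrow> real \<Rightarrow> state \<Rightarrow> real" where
  "free_divergence \<beta> \<mu> R = rel_entropy (hdim (sys R)) (weight R) (gibbs \<beta> \<mu> (sys R))"

definition log_ratio_variance :: "real \<Rightarrow> real \<Rightarrow> state \<Rightarrow> real" where
  "log_ratio_variance \<beta> \<mu> R = (\<Sum>i<hdim (sys R). weight R i * (log_ratio \<beta> \<mu> R i - free_divergence \<beta> \<mu> R)\<^sup>2)"

lemma free_divergence_eq: "free_divergence \<beta> \<mu> R = (\<Sum>i<hdim (sys R). weight R i * log_ratio \<beta> \<mu> R i)"
  unfolding free_divergence_def rel_entropy_def log_ratio_def ..

lemma is_state_copies: "is_state R \<Longrightarrow> is_state (copies n R)"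
  by (induction n) (simp_all add: is_state_comp, simp add: is_state_def trivial_state_def)

text \<open>The convention \<open>ln 0 = 0\<close> breaks additivity at indices of weight zero,
  hence the restriction; such indices drop out of every expectation.\<close>

lemma log_ratio_comp:
  assumes "is_state R" "is_state S" "weight (R \<boxplus> S) k \<noteq> 0" "k < hdim (sys R) * hdim (sys S)"
  shows "log_ratio \<beta> \<mu> (R \<boxplus> S) k = log_ratio \<beta> \<mu> R (k div hdim (sys S)) + log_ratio \<beta> \<mu> S (k mod hdim (sys S))"
proof -
  have d: "0 < hdim (sys R)" "0 < hdim (sys S)" using assms unfolding is_state_def by auto
  have "0 \<le> weight R (k div hdim (sys S))" "0 \<le> weight S (k mod hdim (sys S))"
    using assms d unfolding is_state_def by (simp_all add: less_mult_imp_div_less)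
  hence "0 < weight R (k div hdim (sys S))" "0 < weight S (k mod hdim (sys S))"
    using assms(3) by (auto simp: weight_state_comp)
  moreover have "0 < gibbs \<beta> \<mu> (sys R) (k div hdim (sys S))" "0 < gibbs \<beta> \<mu> (sys S) (k mod hdim (sys S))"
    using d by (simp_all add: gibbs_pos)
  ultimately show ?thesis unfolding log_ratio_def
    by (simp add: weight_state_comp gibbs_sys_comp ln_mult ln_div)
qed

text \<open>Mean and variance of a sum of independent variables; the cross term of the variance
  vanishes because \<open>x\<close> is centred.\<close>

lemma log_ratio_moments_comp:
  assumes R: "is_state R" and S: "is_state S"
  shows "free_divergence \<beta> \<mu> (R \<boxplus> S) = free_divergence \<beta> \<mu> R + free_divergence \<beta> \<mu> S"
    and "log_ratio_variance \<beta> \<mu> (R \<boxplus> S) = log_ratio_variance \<beta> \<mu> R + log_ratio_variance \<beta> \<mu> S"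
proof -
  let ?a = "hdim (sys R)" and ?b = "hdim (sys S)"
  let ?x = "log_ratio \<beta> \<mu> R" and ?y = "log_ratio \<beta> \<mu> S"
  have sums: "(\<Sum>i<?a. weight R i) = 1" "(\<Sum>j<?b. weight S j) = 1" using R S unfolding is_state_def by auto
  have gen: "(\<Sum>k<?a * ?b. weight (R \<boxplus> S) k * f (log_ratio \<beta> \<mu> (R \<boxplus> S) k))
      = (\<Sum>i<?a. \<Sum>j<?b. weight R i * weight S j * f (?x i + ?y j))" for f
    unfolding sum_mult_index
  proof (intro sum.cong refl)
    fix i j assume ij: "i \<in> {..<?a}" "j \<in> {..<?b}"
    hence ij': "i * ?b + j < ?a * ?b" by (simp add: index_mult_less)
    show "weight (R \<boxplus> S) (i * ?b + j) * f (log_ratio \<beta> \<mu> (R \<boxplus> S) (i * ?b + j)) = weight R i * weight S j * f (?x i + ?y j)"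
      using log_ratio_comp[OF R S _ ij', of \<beta> \<mu>] ij by (cases "weight (R \<boxplus> S) (i * ?b + j) = 0") (auto simp: weight_state_comp)
  qed
  have "free_divergence \<beta> \<mu> (R \<boxplus> S) = (\<Sum>i<?a. \<Sum>j<?b. (weight R i * ?x i) * weight S j + weight R i * (weight S j * ?y j))"
    using gen[of "\<lambda>z. z"] unfolding free_divergence_eq by (simp add: algebra_simps)
  also have "\<dots> = free_divergence \<beta> \<mu> R + free_divergence \<beta> \<mu> S"
    unfolding sum.distrib sum_product[symmetric] sums free_divergence_eq by simp
  finally show D: "free_divergence \<beta> \<mu> (R \<boxplus> S) = free_divergence \<beta> \<mu> R + free_divergence \<beta> \<mu> S" .
  define x where "x i = ?x i - free_divergence \<beta> \<mu> R" for i
  define y where "y j = ?y j - free_divergence \<beta> \<mu> S" for j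
  have x0: "(\<Sum>i<?a. weight R i * x i) = 0"
    unfolding x_def right_diff_distrib sum_subtractf sum_distrib_right[symmetric] sums free_divergence_eq by simp
  have "log_ratio_variance \<beta> \<mu> (R \<boxplus> S) = (\<Sum>i<?a. \<Sum>j<?b. (weight R i * (x i)\<^sup>2) * weight S j
      + (weight R i * x i) * (2 * weight S j * y j) + weight R i * (weight S j * (y j)\<^sup>2))"
    using gen[of "\<lambda>z. (z - free_divergence \<beta> \<mu> (R \<boxplus> S))\<^sup>2"] unfolding log_ratio_variance_def sys_state_comp hdim_sys_comp
    by (simp add: D x_def y_def power2_eq_square algebra_simps)
  also have "\<dots> = log_ratio_variance \<beta> \<mu> R + log_ratio_variance \<beta> \<mu> S"
    unfolding sum.distrib sum_product[symmetric] sums x0 by (simp add: log_ratio_variance_def x_def y_def)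
  finally show "log_ratio_variance \<beta> \<mu> (R \<boxplus> S) = log_ratio_variance \<beta> \<mu> R + log_ratio_variance \<beta> \<mu> S" .
qed

lemma copies_log_ratio:
  assumes "is_state R"
  shows "free_divergence \<beta> \<mu> (copies n R) = n * free_divergence \<beta> \<mu> R" "log_ratio_variance \<beta> \<mu> (copies n R) = n * log_ratio_variance \<beta> \<mu> R"
proof -
  have l0: "log_ratio \<beta> \<mu> trivial_state 0 = 0" "hdim (sys trivial_state) = 1" "weight trivial_state 0 = 1"
    by (simp_all add: log_ratio_def trivial_state_def gibbs_def)
  show "free_divergence \<beta> \<mu> (copies n R) = n * free_divergence \<beta> \<mu> R"
  proof (induction n)
    case 0
    show ?case by (simp add: free_divergence_eq l0)
  next
    case (Suc n)
    thus ?case using log_ratio_moments_comp(1)[OF is_state_copies[OF assms] assms, of \<beta> \<mu> n]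
      by (simp add: algebra_simps)
  qed
  show "log_ratio_variance \<beta> \<mu> (copies n R) = n * log_ratio_variance \<beta> \<mu> R"
  proof (induction n)
    case 0
    show ?case by (simp add: log_ratio_variance_def free_divergence_eq l0)
  next
    case (Suc n)
    thus ?case using log_ratio_moments_comp(2)[OF is_state_copies[OF assms] assms, of \<beta> \<mu> n]
      by (simp add: algebra_simps)
  qed
qed

text \<open>Chebyshev's inequality. The deviation is demanded only at positive weight: elsewhere
  \<open>log_ratio\<close> is \<open>0\<close> by convention and says nothing about a likelihood
  threshold.\<close>

lemma atypical_weight_le:
  assumes R: "is_state R" and t: "0 < t"
    and I: "I \<subseteq> {..<hdim (sys R)}"
    and dev: "\<And>i. i \<in> I \<Longrightarrow> 0 < weight R i \<Longrightarrow> t \<le> \<bar>log_ratio \<beta> \<mu> R i - free_divergence \<beta> \<mu> R\<bar>"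
  shows "(\<Sum>i\<in>I. weight R i) \<le> log_ratio_variance \<beta> \<mu> R / t\<^sup>2"
proof -
  have r0: "0 \<le> weight R i" if "i < hdim (sys R)" for i using R that unfolding is_state_def by simp
  have "(\<Sum>i\<in>I. weight R i) * t\<^sup>2 = (\<Sum>i\<in>I. weight R i * t\<^sup>2)" by (simp add: sum_distrib_right)
  also have "\<dots> \<le> (\<Sum>i\<in>I. weight R i * (log_ratio \<beta> \<mu> R i - free_divergence \<beta> \<mu> R)\<^sup>2)"
  proof (rule sum_mono)
    fix i assume i: "i \<in> I"
    show "weight R i * t\<^sup>2 \<le> weight R i * (log_ratio \<beta> \<mu> R i - free_divergence \<beta> \<mu> R)\<^sup>2"
    proof (cases "weight R i = 0")
      case False
      hence "0 < weight R i" using r0[of i] i I by fastforce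
      hence "t\<^sup>2 \<le> (log_ratio \<beta> \<mu> R i - free_divergence \<beta> \<mu> R)\<^sup>2"
        using dev[OF i] t by (metis abs_le_square_iff abs_of_pos)
      thus ?thesis using \<open>0 < weight R i\<close> by simp
    qed simp
  qed
  also have "\<dots> \<le> log_ratio_variance \<beta> \<mu> R" unfolding log_ratio_variance_def
    using I r0 by (intro sum_mono2) auto
  finally show ?thesis using t by (simp add: pos_le_divide_eq)
qed

text \<open>Taking logarithms turns the likelihood thresholds into deviations by
  \<open>n * \<eta>\<close> of a variable whose variance is linear in \<open>n\<close>, so either
  tail is of order \<open>1 / n\<close>.\<close>

lemma aep:
  fixes \<beta> \<mu> \<eta> :: real
  assumes R: "is_state R" and \<eta>: "0 < \<eta>" and n: "0 < n"
  defines "T \<equiv> copies n R" and "D \<equiv> free_divergence \<beta> \<mu> R"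
  shows "(\<Sum>i | i < hdim (sys T) \<and> weight T i < exp (n * (D - \<eta>)) * gibbs \<beta> \<mu> (sys T) i. weight T i)
      \<le> log_ratio_variance \<beta> \<mu> R / (n * \<eta>\<^sup>2)"
    and "(\<Sum>i | i < hdim (sys T) \<and> exp (n * (D + \<eta>)) * gibbs \<beta> \<mu> (sys T) i < weight T i. weight T i)
      \<le> log_ratio_variance \<beta> \<mu> R / (n * \<eta>\<^sup>2)"
proof -
  have T: "is_state T" unfolding T_def by (rule is_state_copies[OF R])
  have t: "0 < n * \<eta>" using n \<eta> by simp
  have g: "0 < gibbs \<beta> \<mu> (sys T) i" for i using T by (intro gibbs_pos) (simp add: is_state_def)
  have DT: "free_divergence \<beta> \<mu> T = n * D" unfolding T_def D_def by (rule copies_log_ratio[OF R])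
  have V: "log_ratio_variance \<beta> \<mu> T / (n * \<eta>)\<^sup>2 = log_ratio_variance \<beta> \<mu> R / (n * \<eta>\<^sup>2)"
    unfolding T_def copies_log_ratio[OF R] using n by (simp add: power2_eq_square)
  show "(\<Sum>i | i < hdim (sys T) \<and> weight T i < exp (n * (D - \<eta>)) * gibbs \<beta> \<mu> (sys T) i. weight T i)
      \<le> log_ratio_variance \<beta> \<mu> R / (n * \<eta>\<^sup>2)"
    unfolding V[symmetric]
  proof (rule atypical_weight_le[OF T t])
    fix i assume i: "i \<in> {i. i < hdim (sys T) \<and> weight T i < exp (n * (D - \<eta>)) * gibbs \<beta> \<mu> (sys T) i}" "0 < weight T i"
    hence "weight T i / gibbs \<beta> \<mu> (sys T) i < exp (n * (D - \<eta>))" using g[of i] by (simp add: pos_divide_less_eq)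
    hence "log_ratio \<beta> \<mu> T i < n * (D - \<eta>)" unfolding log_ratio_def using i(2) g[of i]
      by (metis exp_less_cancel_iff divide_pos_pos exp_ln)
    thus "n * \<eta> \<le> \<bar>log_ratio \<beta> \<mu> T i - free_divergence \<beta> \<mu> T\<bar>" unfolding DT by (simp add: algebra_simps)
  qed auto
  show "(\<Sum>i | i < hdim (sys T) \<and> exp (n * (D + \<eta>)) * gibbs \<beta> \<mu> (sys T) i < weight T i. weight T i)
      \<le> log_ratio_variance \<beta> \<mu> R / (n * \<eta>\<^sup>2)"
    unfolding V[symmetric]
  proof (rule atypical_weight_le[OF T t])
    fix i assume i: "i \<in> {i. i < hdim (sys T) \<and> exp (n * (D + \<eta>)) * gibbs \<beta> \<mu> (sys T) i < weight T i}" "0 < weight T i"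
    hence "exp (n * (D + \<eta>)) < weight T i / gibbs \<beta> \<mu> (sys T) i" using g[of i] by (simp add: pos_less_divide_eq)
    hence "n * (D + \<eta>) < log_ratio \<beta> \<mu> T i" unfolding log_ratio_def using i(2) g[of i]
      by (metis exp_less_cancel_iff divide_pos_pos exp_ln)
    thus "n * \<eta> \<le> \<bar>log_ratio \<beta> \<mu> T i - free_divergence \<beta> \<mu> T\<bar>" unfolding DT by (simp add: algebra_simps)
  qed auto
qed

lemma sum_split_complement:
  assumes "is_state T"
  shows "(\<Sum>i | i < hdim (sys T) \<and> P i. weight T i) = 1 - (\<Sum>i | i < hdim (sys T) \<and> \<not> P i. weight T i)"
proof -
  have "{..<hdim (sys T)} = {i. i < hdim (sys T) \<and> P i} \<union> {i. i < hdim (sys T) \<and> \<not> P i}" by auto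
  hence "(\<Sum>i<hdim (sys T). weight T i) = (\<Sum>i | i < hdim (sys T) \<and> P i. weight T i) + (\<Sum>i | i < hdim (sys T) \<and> \<not> P i. weight T i)"
    by (simp add: sum.union_disjoint disjoint_iff)
  thus ?thesis using assms unfolding is_state_def by simp
qed

section \<open>Work bounds for a finite number of copies\<close>

lemma W_gain_upper:
  assumes \<beta>: "0 < \<beta>" and \<epsilon>: "\<epsilon> < 1" and R: "is_state R" and \<eta>: "0 < \<eta>" and n: "0 < n"
    and V: "log_ratio_variance \<beta> \<mu> R / (n * \<eta>\<^sup>2) \<le> (1 - \<epsilon>) / 2"
  shows "W_gain \<beta> \<mu> \<kappa> \<delta> \<epsilon> (copies n R) \<le> ereal ((n * (free_divergence \<beta> \<mu> R + \<eta>) + ln (2 / (1 - \<epsilon>))) / \<beta>)"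
  unfolding W_gain_def
proof (rule Sup_least, clarify)
  fix W B j k
  assume "battery_levels \<beta> \<mu> \<kappa> \<delta> B j k W"
    "equilibrates_approx \<beta> \<mu> \<epsilon> (copies n R \<boxplus> battery_state B j) (battery_state B k)"
  \<comment> \<open>With the threshold slightly above the mean, the atypical tail accounts for at
    most half of \<open>1 - \<epsilon>\<close>; the exponential term must supply the other
    half.\<close>
  from gain_converse[OF is_state_copies[OF R] this, of "n * (free_divergence \<beta> \<mu> R + \<eta>)"]
    aep(2)[OF R \<eta> n, of \<beta> \<mu>] V
  have "(1 - \<epsilon>) / 2 \<le> exp (n * (free_divergence \<beta> \<mu> R + \<eta>) - \<beta> * W)" by argo
  hence "ln ((1 - \<epsilon>) / 2) \<le> n * (free_divergence \<beta> \<mu> R + \<eta>) - \<beta> * W"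
    using \<epsilon> by (metis diff_gt_0_iff_gt exp_gt_zero half_gt_zero ln_exp ln_le_cancel_iff)
  moreover have "ln ((1 - \<epsilon>) / 2) = - ln (2 / (1 - \<epsilon>))" using \<epsilon> by (simp add: ln_div)
  ultimately show "ereal W \<le> ereal ((n * (free_divergence \<beta> \<mu> R + \<eta>) + ln (2 / (1 - \<epsilon>))) / \<beta>)"
    using \<beta> by (simp add: pos_le_divide_eq mult.commute)
qed

lemma W_cost_lower:
  assumes \<beta>: "0 < \<beta>" and \<epsilon>: "\<epsilon> < 1" and R: "is_state R" and \<eta>: "0 < \<eta>" and n: "0 < n"
    and V: "log_ratio_variance \<beta> \<mu> R / (n * \<eta>\<^sup>2) \<le> (1 - \<epsilon>) / 2"
  shows "ereal ((n * (free_divergence \<beta> \<mu> R - \<eta>) - ln (2 / (1 - \<epsilon>))) / \<beta>) \<le> W_cost \<beta> \<mu> \<kappa> \<delta> \<epsilon> (copies n R)"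
  unfolding W_cost_def
proof (rule Inf_greatest, clarify)
  fix W B j k
  assume bat: "battery_levels \<beta> \<mu> \<kappa> \<delta> B j k W"
    and op: "equilibrates_approx \<beta> \<mu> \<epsilon> (battery_state B k) (copies n R \<boxplus> battery_state B j)"
  define P where "P i \<longleftrightarrow> exp (n * (free_divergence \<beta> \<mu> R - \<eta>)) * gibbs \<beta> \<mu> (sys (copies n R)) i \<le> weight (copies n R) i" for i
  \<comment> \<open>With the threshold slightly below the mean, the selected set has weight at least
    \<open>1 - (1 - \<epsilon>) / 2\<close>, of which \<open>(1 - \<epsilon>) / 2\<close> survives
    the subtraction of \<open>\<epsilon>\<close>.\<close>
  from cost_converse[OF is_state_copies[OF R] bat op, of "n * (free_divergence \<beta> \<mu> R - \<eta>)"]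
    sum_split_complement[OF is_state_copies[OF R], of n P] aep(1)[OF R \<eta> n, of \<beta> \<mu>] V
  have "(1 - \<epsilon>) / 2 \<le> exp (\<beta> * W - n * (free_divergence \<beta> \<mu> R - \<eta>))"
    unfolding P_def not_le by argo
  hence "ln ((1 - \<epsilon>) / 2) \<le> \<beta> * W - n * (free_divergence \<beta> \<mu> R - \<eta>)"
    using \<epsilon> by (metis diff_gt_0_iff_gt exp_gt_zero half_gt_zero ln_exp ln_le_cancel_iff)
  moreover have "ln ((1 - \<epsilon>) / 2) = - ln (2 / (1 - \<epsilon>))" using \<epsilon> by (simp add: ln_div)
  ultimately show "ereal ((n * (free_divergence \<beta> \<mu> R - \<eta>) - ln (2 / (1 - \<epsilon>))) / \<beta>) \<le> ereal W"
    using \<beta> by (simp add: pos_divide_le_eq mult.commute)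
qed

lemma W_gain_lower:
  assumes \<beta>: "0 < \<beta>" and \<delta>: "0 < \<delta>" and \<epsilon>: "0 < \<epsilon>" and R: "is_state R" and \<eta>: "0 < \<eta>" and n: "0 < n"
    and V: "log_ratio_variance \<beta> \<mu> R / (n * \<eta>\<^sup>2) < \<epsilon>"
  shows "ereal ((n * (free_divergence \<beta> \<mu> R - \<eta>) - ln 2) / \<beta>) \<le> W_gain \<beta> \<mu> \<kappa> \<delta> \<epsilon> (copies n R)"
proof -
  \<comment> \<open>The subtracted \<open>ln 2\<close> pays for the factor \<open>2\<close> in
    \<open>gain_achievable\<close>.\<close>
  define W where "W = (n * (free_divergence \<beta> \<mu> R - \<eta>) - ln 2) / \<beta>"
  obtain B j k where B: "battery_levels \<beta> \<mu> \<kappa> \<delta> B j k W" using battery_exists[OF \<beta> \<delta>] .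
  let ?T = "copies n R" and ?e = "exp (n * (free_divergence \<beta> \<mu> R - \<eta>))"
  have T: "is_state ?T" by (rule is_state_copies[OF R])
  define A where "A = {i. i < hdim (sys ?T) \<and> ?e * gibbs \<beta> \<mu> (sys ?T) i \<le> weight ?T i}"
  have "equilibrates_approx \<beta> \<mu> \<epsilon> (?T \<boxplus> battery_state B j) (battery_state B k)"
  proof (rule gain_achievable[OF T B _ _ _ \<epsilon>])
    show A: "A \<subseteq> {..<hdim (sys ?T)}" unfolding A_def by auto
    \<comment> \<open>Change of measure: on \<open>A\<close> the Gibbs weights are at most
      \<open>1 / ?e\<close> times weights whose total is at most \<open>1\<close>.\<close>
    have "?e * (\<Sum>i\<in>A. gibbs \<beta> \<mu> (sys ?T) i) \<le> (\<Sum>i\<in>A. weight ?T i)"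
      unfolding sum_distrib_left by (intro sum_mono) (simp add: A_def)
    also have "\<dots> \<le> 1" using sum_mono2[OF _ A, of "weight ?T"] T by (simp add: is_state_def)
    finally have "(\<Sum>i\<in>A. gibbs \<beta> \<mu> (sys ?T) i) \<le> 1 / ?e" by (simp add: field_simps)
    moreover have "exp (- \<beta> * W) = 2 * (1 / ?e)"
    proof -
      have "- \<beta> * W = ln 2 - n * (free_divergence \<beta> \<mu> R - \<eta>)" using \<beta> unfolding W_def by simp
      thus ?thesis by (simp only: exp_diff) simp
    qed
    ultimately show "2 * (\<Sum>i\<in>A. gibbs \<beta> \<mu> (sys ?T) i) \<le> exp (- \<beta> * W)" by simp
    show "1 - \<epsilon> < (\<Sum>i\<in>A. weight ?T i)"
      using aep(1)[OF R \<eta> n, of \<beta> \<mu>] V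
        sum_split_complement[OF T, of "\<lambda>i. ?e * gibbs \<beta> \<mu> (sys ?T) i \<le> weight ?T i"]
      unfolding A_def not_le by linarith
  qed
  thus ?thesis unfolding W_gain_def W_def[symmetric] using B by (intro Sup_upper) blast
qed

lemma W_cost_upper:
  assumes \<beta>: "0 < \<beta>" and \<delta>: "0 < \<delta>" and R: "is_state R" and \<eta>: "0 < \<eta>" and n: "0 < n"
    and V: "log_ratio_variance \<beta> \<mu> R / (n * \<eta>\<^sup>2) < \<epsilon>"
  shows "W_cost \<beta> \<mu> \<kappa> \<delta> \<epsilon> (copies n R) \<le> ereal ((n * (free_divergence \<beta> \<mu> R + \<eta>) + ln 2) / \<beta>)"
proof -
  define W where "W = (n * (free_divergence \<beta> \<mu> R + \<eta>) + ln 2) / \<beta>"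
  obtain B j k where B: "battery_levels \<beta> \<mu> \<kappa> \<delta> B j k W" using battery_exists[OF \<beta> \<delta>] .
  let ?T = "copies n R" and ?e = "exp (n * (free_divergence \<beta> \<mu> R + \<eta>))"
  have T: "is_state ?T" by (rule is_state_copies[OF R])
  \<comment> \<open>Discarding the large likelihood ratios makes the remaining weights dominated by
    multiples of the Gibbs weights, and costs less than \<open>\<epsilon>\<close>.\<close>
  define A where "A = {i. i < hdim (sys ?T) \<and> weight ?T i \<le> ?e * gibbs \<beta> \<mu> (sys ?T) i}"
  have "equilibrates_approx \<beta> \<mu> \<epsilon> (battery_state B k) (?T \<boxplus> battery_state B j)"
  proof (rule cost_achievable[OF T B])
    show "A \<subseteq> {..<hdim (sys ?T)}" unfolding A_def by auto
    have e: "exp (\<beta> * W) = 2 * ?e"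
    proof -
      have "\<beta> * W = n * (free_divergence \<beta> \<mu> R + \<eta>) + ln 2" using \<beta> unfolding W_def by simp
      thus ?thesis by (simp only: exp_add) simp
    qed
    show "2 * weight ?T i \<le> exp (\<beta> * W) * gibbs \<beta> \<mu> (sys ?T) i" if "i \<in> A" for i
      using that unfolding A_def e by simp
    show "1 - \<epsilon> < (\<Sum>i\<in>A. weight ?T i)"
      using aep(2)[OF R \<eta> n, of \<beta> \<mu>] V
        sum_split_complement[OF T, of "\<lambda>i. weight ?T i \<le> ?e * gibbs \<beta> \<mu> (sys ?T) i"]
      unfolding A_def not_le by linarith
  qed
  thus ?thesis unfolding W_cost_def W_def[symmetric] using B by (intro Inf_lower) blast
qed

section \<open>Passage to the work rate\<close>

lemma tendsto_divide_n_ereal: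
  fixes w :: "nat \<Rightarrow> ereal" and D :: real
  assumes "\<And>\<eta>. 0 < \<eta> \<Longrightarrow> eventually (\<lambda>n. ereal (n * (D - \<eta>)) \<le> w n \<and> w n \<le> ereal (n * (D + \<eta>))) sequentially"
  shows "(\<lambda>n. w n / ereal (real n)) \<longlonglongrightarrow> ereal D"
proof -
  have *: "eventually (\<lambda>n. ereal (D - \<eta>) \<le> w n / ereal (real n) \<and> w n / ereal (real n) \<le> ereal (D + \<eta>)) sequentially"
    if "0 < \<eta>" for \<eta>
    using assms[OF that] eventually_gt_at_top[of 0]
  proof eventually_elim
    case (elim n)
    thus ?case by (cases "w n") (auto simp: field_simps)
  qed
  show ?thesis
  proof (rule order_tendstoI)
    fix a assume a: "a < ereal D"
    then obtain b where b: "a < ereal b" "ereal b < ereal D" using ereal_dense2[OF a] by blast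
    have "eventually (\<lambda>n. ereal (D - (D - b)) \<le> w n / ereal (real n) \<and> w n / ereal (real n) \<le> ereal (D + (D - b))) sequentially"
      using b by (intro *) simp
    thus "eventually (\<lambda>n. a < w n / ereal (real n)) sequentially"
      by eventually_elim (use b in \<open>auto intro: less_le_trans\<close>)
  next
    fix a assume a: "ereal D < a"
    then obtain b where b: "ereal D < ereal b" "ereal b < a" using ereal_dense2[OF a] by blast
    have "eventually (\<lambda>n. ereal (D - (b - D)) \<le> w n / ereal (real n) \<and> w n / ereal (real n) \<le> ereal (D + (b - D))) sequentially"
      using b by (intro *) simp
    thus "eventually (\<lambda>n. w n / ereal (real n) < a) sequentially"
      by eventually_elim (use b in \<open>auto intro: le_less_trans\<close>)
  qed
qed

lemma tendsto_work:
  fixes w :: "nat \<Rightarrow> ereal" and \<beta> \<tau> c V D :: real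
  assumes \<beta>: "0 < \<beta>" and V: "0 \<le> V" and \<tau>: "0 < \<tau>" and c: "0 \<le> c"
    and bounds: "\<And>n \<eta>. 0 < n \<Longrightarrow> 0 < \<eta> \<Longrightarrow> V / (n * \<eta>\<^sup>2) < \<tau> \<Longrightarrow>
      ereal ((n * (D - \<eta>) - c) / \<beta>) \<le> w n \<and> w n \<le> ereal ((n * (D + \<eta>) + c) / \<beta>)"
  shows "(\<lambda>n. w n / ereal (real n)) \<longlonglongrightarrow> ereal (D / \<beta>)"
proof (rule tendsto_divide_n_ereal)
  fix \<theta> :: real assume \<theta>: "0 < \<theta>"
  \<comment> \<open>After division by \<open>\<beta>\<close>, half of the tolerance
    \<open>\<theta>\<close> goes to \<open>\<eta>\<close> and half to the constant \<open>c\<close>,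
    which \<open>n * \<eta>\<close> eventually exceeds.\<close>
  define \<eta> where "\<eta> = \<beta> * \<theta> / 2"
  have \<eta>: "0 < \<eta>" unfolding \<eta>_def using \<beta> \<theta> by simp
  have big: "eventually (\<lambda>n. a < real n) sequentially" for a
    using filterlim_real_sequentially unfolding filterlim_at_top_dense by blast
  show "eventually (\<lambda>n. ereal (n * (D / \<beta> - \<theta>)) \<le> w n \<and> w n \<le> ereal (n * (D / \<beta> + \<theta>))) sequentially"
    using big[of 0] big[of "V / (\<tau> * \<eta>\<^sup>2)"] big[of "c / \<eta>"]
  proof eventually_elim
    case (elim n)
    have n: "0 < n" using elim(1) by simp
    have "V / (n * \<eta>\<^sup>2) < \<tau>" using elim(2) n \<eta> \<tau> by (simp add: field_simps)
    from bounds[OF n \<eta> this]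
    have w: "ereal ((n * (D - \<eta>) - c) / \<beta>) \<le> w n" "w n \<le> ereal ((n * (D + \<eta>) + c) / \<beta>)" by auto
    have c: "c \<le> n * \<eta>" using elim(3) \<eta> by (simp add: field_simps)
    have "n * (D / \<beta> - \<theta>) = (n * (D - \<eta>) - n * \<eta>) / \<beta>" "n * (D / \<beta> + \<theta>) = (n * (D + \<eta>) + n * \<eta>) / \<beta>"
      using \<beta> by (simp_all add: \<eta>_def field_simps)
    moreover have "(n * (D - \<eta>) - n * \<eta>) / \<beta> \<le> (n * (D - \<eta>) - c) / \<beta>" "(n * (D + \<eta>) + c) / \<beta> \<le> (n * (D + \<eta>) + n * \<eta>) / \<beta>"
      using c \<beta> by (simp_all add: divide_right_mono)
    ultimately show ?case using w by (metis ereal_less_eq(3) order_trans)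
  qed
qed

text \<open>The logarithm of a Gibbs weight is affine in energy and number with constant term
  \<open>- ln ?Z\<close>, so averaging \<open>log_ratio\<close> reproduces the three terms of the
  grand potential up to the factor \<open>\<beta>\<close>.\<close>

lemma free_divergence_grand_potential:
  assumes \<beta>: "0 < \<beta>" and R: "is_state R"
  shows "free_divergence \<beta> \<mu> R = \<beta> * grand_potential \<beta> \<mu> R + ln (partition_function \<beta> \<mu> (sys R))"
proof -
  let ?d = "hdim (sys R)" and ?Z = "partition_function \<beta> \<mu> (sys R)"
  have d: "0 < ?d" using R unfolding is_state_def by simp
  have Z: "0 < ?Z" by (rule partition_function_pos[OF d])
  have "free_divergence \<beta> \<mu> R = (\<Sum>i<?d. weight R i * ln (weight R i)
      + \<beta> * (weight R i * energy (sys R) i) - \<beta> * \<mu> * (weight R i * number (sys R) i) + ln ?Z * weight R i)"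
    unfolding free_divergence_eq
  proof (intro sum.cong refl)
    fix i assume "i \<in> {..<?d}"
    hence r0: "0 \<le> weight R i" using R unfolding is_state_def by simp
    show "weight R i * log_ratio \<beta> \<mu> R i = weight R i * ln (weight R i)
      + \<beta> * (weight R i * energy (sys R) i) - \<beta> * \<mu> * (weight R i * number (sys R) i) + ln ?Z * weight R i"
    proof (cases "weight R i = 0")
      case False
      hence "0 < weight R i" using r0 by simp
      moreover have "ln (boltzmann \<beta> \<mu> (sys R) i) = - \<beta> * (energy (sys R) i - \<mu> * number (sys R) i)"
        unfolding boltzmann_def by simp
      ultimately have e: "log_ratio \<beta> \<mu> R i = ln (weight R i) + \<beta> * (energy (sys R) i - \<mu> * number (sys R) i) + ln ?Z"
        using Z boltzmann_pos[of \<beta> \<mu> "sys R" i] unfolding log_ratio_def gibbs_eq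
        by (simp add: ln_div ln_mult del: boltzmann_pos)
      show ?thesis unfolding e by (simp add: algebra_simps)
    qed simp
  qed
  also have "\<dots> = \<beta> * grand_potential \<beta> \<mu> R + ln ?Z"
    unfolding sum.distrib sum_subtractf sum_distrib_left[symmetric]
    using R \<beta> by (simp add: grand_potential_def entropy_def Let_def is_state_def algebra_simps)
  finally show ?thesis .
qed

theorem mainTheorem5:
  fixes \<beta> \<mu> \<kappa> \<delta> \<epsilon> :: real and R :: state
  assumes "\<beta> > 0" and "is_state R"
    and "\<delta> > 0" \<comment> \<open>the resolution of the battery; the threshold \<open>\<kappa>\<close> for \<open>\<beta> E\<close> is unrestricted\<close>
    and "0 < \<epsilon>" and "\<epsilon> < 1"
  defines "D \<equiv> rel_entropy (hdim (sys R)) (weight R) (weight (equilibrium \<beta> \<mu> (sys R)))"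
  shows "(\<lambda>n. W_gain \<beta> \<mu> \<kappa> \<delta> \<epsilon> (copies n R) / ereal (real n)) \<longlonglongrightarrow> ereal (D / \<beta>)
    \<and> (\<lambda>n. W_cost \<beta> \<mu> \<kappa> \<delta> \<epsilon> (copies n R) / ereal (real n)) \<longlonglongrightarrow> ereal (D / \<beta>)
    \<and> D / \<beta> = grand_potential \<beta> \<mu> R - grand_potential \<beta> \<mu> (equilibrium \<beta> \<mu> (sys R))"
proof -
  have D: "D = free_divergence \<beta> \<mu> R" unfolding D_def free_divergence_def by simp
  \<comment> \<open>\<open>c\<close> dominates the constants of all four work bounds, and
    \<open>\<tau>\<close> ensures both conditions on the Chebyshev tail.\<close>
  define c where "c = ln (2 / (1 - \<epsilon>)) + ln 2"
  define \<tau> where "\<tau> = min \<epsilon> ((1 - \<epsilon>) / 2)"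
  have c: "0 \<le> ln (2 / (1 - \<epsilon>))" "0 \<le> ln (2 :: real)" using assms by simp_all
  have V: "0 \<le> log_ratio_variance \<beta> \<mu> R"
    using assms(2) unfolding log_ratio_variance_def is_state_def by (auto intro!: sum_nonneg)
  have \<tau>: "0 < \<tau>" using assms unfolding \<tau>_def by simp
  have mono: "ereal ((a - c) / \<beta>) \<le> ereal ((a - ln (2 / (1 - \<epsilon>))) / \<beta>)" "ereal ((a - c) / \<beta>) \<le> ereal ((a - ln 2) / \<beta>)"
    "ereal ((a + ln (2 / (1 - \<epsilon>))) / \<beta>) \<le> ereal ((a + c) / \<beta>)" "ereal ((a + ln 2) / \<beta>) \<le> ereal ((a + c) / \<beta>)" for a
    using c \<open>\<beta> > 0\<close> unfolding c_def ereal_less_eq by (intro divide_right_mono; simp)+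
  have "(\<lambda>n. W_gain \<beta> \<mu> \<kappa> \<delta> \<epsilon> (copies n R) / ereal (real n)) \<longlonglongrightarrow> ereal (D / \<beta>)"
  proof (rule tendsto_work[OF \<open>\<beta> > 0\<close> V \<tau>])
    show "0 \<le> c" using c unfolding c_def by simp
    fix n :: nat and \<eta> :: real
    assume n: "0 < n" "0 < \<eta>" and v: "log_ratio_variance \<beta> \<mu> R / (n * \<eta>\<^sup>2) < \<tau>"
    show "ereal ((n * (D - \<eta>) - c) / \<beta>) \<le> W_gain \<beta> \<mu> \<kappa> \<delta> \<epsilon> (copies n R) \<and>
      W_gain \<beta> \<mu> \<kappa> \<delta> \<epsilon> (copies n R) \<le> ereal ((n * (D + \<eta>) + c) / \<beta>)"
      using order_trans[OF mono(2) W_gain_lower[OF assms(1,3,4,2) n(2,1)]]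
        order_trans[OF W_gain_upper[OF assms(1,5,2) n(2,1)] mono(3)] v
      unfolding D \<tau>_def by simp
  qed
  moreover have "(\<lambda>n. W_cost \<beta> \<mu> \<kappa> \<delta> \<epsilon> (copies n R) / ereal (real n)) \<longlonglongrightarrow> ereal (D / \<beta>)"
  proof (rule tendsto_work[OF \<open>\<beta> > 0\<close> V \<tau>])
    show "0 \<le> c" using c unfolding c_def by simp
    fix n :: nat and \<eta> :: real
    assume n: "0 < n" "0 < \<eta>" and v: "log_ratio_variance \<beta> \<mu> R / (n * \<eta>\<^sup>2) < \<tau>"
    show "ereal ((n * (D - \<eta>) - c) / \<beta>) \<le> W_cost \<beta> \<mu> \<kappa> \<delta> \<epsilon> (copies n R) \<and>
      W_cost \<beta> \<mu> \<kappa> \<delta> \<epsilon> (copies n R) \<le> ereal ((n * (D + \<eta>) + c) / \<beta>)"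
      using order_trans[OF mono(1) W_cost_lower[OF assms(1,5,2) n(2,1)]]
        order_trans[OF W_cost_upper[OF assms(1,3,2) n(2,1)] mono(4)] v
      unfolding D \<tau>_def by simp
  qed
  moreover have "D / \<beta> = grand_potential \<beta> \<mu> R - grand_potential \<beta> \<mu> (equilibrium \<beta> \<mu> (sys R))"
  proof -
    have d: "0 < hdim (sys R)" using assms(2) unfolding is_state_def by simp
    \<comment> \<open>Vanishing divergence of the equilibrium state evaluates its grand potential as
      minus \<open>ln\<close> of the partition function over \<open>\<beta>\<close>; the partition
      function is that of \<open>R\<close>, so it cancels the constant there.\<close>
    have "free_divergence \<beta> \<mu> (equilibrium \<beta> \<mu> (sys R)) = 0"
      unfolding free_divergence_def rel_entropy_def using gibbs_pos[OF d, of \<beta> \<mu>] by (simp add: less_imp_neq[symmetric])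
    thus ?thesis using free_divergence_grand_potential[OF assms(1,2), of \<mu>] \<open>\<beta> > 0\<close>
        free_divergence_grand_potential[OF assms(1) is_state_equilibrium[OF d], of \<mu> \<beta> \<mu>]
      unfolding D by (simp add: field_simps)
  qed
  ultimately show ?thesis by blast
qed

end
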